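(* Let $(E\to M,[\cdot,\cdot],\langle\cdot,\cdot\rangle,\rho,H)$ be an $H$-twisted Courant algebroid. For $p\ge 0$ put $$C^p(E,\rho,H):=\Omega^p_M(\ker\rho)\cap\ker\tilde H .$$ Then these cochains together with the derivative $$d:C^p(E,\rho,H)\to C^{p+1}(E,\rho,H),\qquad \alpha\mapsto\mathcal{D}\alpha,$$ form a cochain complex; that is, $\mathcal{D}$ maps $C^p(E,\rho,H)$ into $C^{p+1}(E,\rho,H)$ and $d\circ d=0$.
   Context: Setting: $E\to M$ is a smooth vector bundle with a symmetric non-degenerate bilinear form $\langle\cdot,\cdot\rangle$ on its fibres; $E^*$ is identified with $E$ via $\langle\cdot,\cdot\rangle$, sections of $\wedge^pE$ are regarded as alternating $p$-forms on $\Gamma(E)$, and $\langle\alpha,\psi_1\wedge\dots\wedge\psi_p\rangle$ denotes evaluation. Given a bundle map $\rho:E\to TM$, $\Omega^p_M(\ker\rho)$ is the space of smooth sections of $\wedge^pE$ in the kernel of $\tilde\rho:\wedge^pE\to TM\otimes\wedge^{p-1}E$, $\tilde\rho(\psi_1\wedge\dots\wedge\psi_p)=\sum_i(-1)^{i-1}\rho(\psi_i)\otimes\psi_1\wedge\dots\hat\psi_i\dots\wedge\psi_p$, with $\Omega^0_M(\ker\rho)=C^\infty(M)$. For $\alpha\in\Omega^p_M(\ker\rho)$, $\mathcal{D}\alpha$ is defined by $$\langle \mathcal{D}\alpha,\psi_0\wedge\dots\wedge\psi_p\rangle=\sum_{i=0}^p(-1)^i\rho(\psi_i)\langle\alpha,\psi_0\wedge\dots\hat\psi_i\dots\wedge\psi_p\rangle+\sum_{i<j}(-1)^{i+j}\langle\alpha,[\psi_i,\psi_j]\wedge\psi_0\wedge\dots\hat\psi_i\dots\hat\psi_j\dots\wedge\psi_p\rangle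 ;$$ in particular $\mathcal{D}f=\rho^*df$ for $f\in C^\infty(M)$. An $H$-twisted Courant algebroid is such an $E\to M$ with an $\mathbb{R}$-bilinear (not necessarily skew-symmetric) bracket $[\cdot,\cdot]:\Gamma(E)\otimes\Gamma(E)\to\Gamma(E)$, a vector bundle morphism $\rho:E\to TM$, a symmetric non-degenerate bilinear form $\langle\cdot,\cdot\rangle$, and $H\in\Omega^4_M(\ker\rho)$ such that for all $\phi,\psi,\psi_1,\psi_2\in\Gamma(E)$, $f\in C^\infty(M)$: (1) $\tilde H(\phi,\psi_1,\psi_2)=[\phi,[\psi_1,\psi_2]]-[[\phi,\psi_1],\psi_2]-[\psi_1,[\phi,\psi_2]]$; (2) $\mathcal{D}H=0$; (3) $[\phi,f\psi]=\rho(\phi)[f]\psi+f[\phi,\psi]$; (4) $[\psi,\psi]=\tfrac12\mathcal{D}\langle\psi,\psi\rangle$; (5) $\rho(\phi)\langle\psi,\psi\rangle=2\langle[\phi,\psi],\psi\rangle$. Here $\tilde H$ is $H$ viewed as a three-form with values in $\ker\rho\subset E$: $\langle\tilde H(\phi,\psi_1,\psi_2),\chi\rangle=H(\phi,\psi_1,\psi_2,\chi)$. $\tilde H$ also denotes the induced operator on $\Omega^\bullet_M(\ker\rho)$, raising degree by 2, obtained by inserting the values of $\tilde H$ into a form: for $\alpha\in\Omega^p_M(\ker\rho)$, $$\langle\tilde H\alpha,\psi_0\wedge\dots\wedge\psi_{p+1}\rangle=\sum_{i<j<k}(-1)^{i+j+k}\langle\alpha,\tilde H(\psi_i,\psi_j,\psi_k)\wedge\psi_0\wedge\dots\hat\psi_i\dots\hat\psi_j\dots\hat\psi_k\dots\wedge\psi_{p+1}\rangle,$$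 with $\tilde H\alpha=0$ for $p=0$. $\ker\tilde H$ is the kernel of this operator. A hat denotes omission. *)

theory Defs
  imports "HOL-Analysis.Analysis"
begin

section \<open>Smooth functions on open subsets of $\mathbb{R}^n$\<close>

text \<open>
  $\mathbb{R}^n$ is the space \<^term>\<open>Euclidean_space n\<close> of sequences vanishing from index \<open>n\<close> on, so that
  \<open>n\<close> is an ordinary natural number and \<open>n = 0\<close> is allowed.  A function is $C^k$ on an open set if
  its iterated partial derivatives up to order \<open>k\<close> exist and are continuous.
\<close>

fun C_k_on :: "nat \<Rightarrow> nat \<Rightarrow> (nat \<Rightarrow> real) set \<Rightarrow> ((nat \<Rightarrow> real) \<Rightarrow> real) \<Rightarrow> bool" where
  "C_k_on n 0 W f \<longleftrightarrow> continuous_on W f"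
| "C_k_on n (Suc k) W f \<longleftrightarrow> continuous_on W f \<and>
     (\<forall>i<n. \<exists>g. (\<forall>y\<in>W. ((\<lambda>t. f (y(i := t))) has_real_derivative g y) (at (y i))) \<and> C_k_on n k W g)"

definition C_inf_on :: "nat \<Rightarrow> (nat \<Rightarrow> real) set \<Rightarrow> ((nat \<Rightarrow> real) \<Rightarrow> real) \<Rightarrow> bool" where
  "C_inf_on n W f \<longleftrightarrow> (\<forall>k. C_k_on n k W f)"


section \<open>Smooth manifolds\<close>

text \<open>
  The manifold is the whole type \<open>'m\<close>; Hausdorffness and second countability are the sort
  constraint on \<open>'m\<close>.  An element \<open>(U, \<phi>)\<close> of \<open>charts\<close> is a chart with domain \<open>U\<close>; the atlas need
  not be maximal.
\<close>

record 'm manifold =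
  mdim :: nat
  charts :: "('m set \<times> ('m \<Rightarrow> nat \<Rightarrow> real)) set"

definition smooth_on_mfd ::
  "('m::{t2_space,second_countable_topology}, 'x) manifold_scheme \<Rightarrow> 'm set \<Rightarrow> ('m \<Rightarrow> real) \<Rightarrow> bool" where
  "smooth_on_mfd M S f \<longleftrightarrow>
     (\<forall>(U, \<phi>)\<in>charts M. C_inf_on (mdim M) (\<phi> ` (U \<inter> S)) (f \<circ> inv_into U \<phi>))"

definition smooth_manifold ::
  "('m::{t2_space,second_countable_topology}, 'x) manifold_scheme \<Rightarrow> bool" where
  "smooth_manifold M \<longleftrightarrow>
     (\<Union>(U, \<phi>)\<in>charts M. U) = UNIV \<and>
     (\<forall>(U, \<phi>)\<in>charts M. open U \<and> openin (Euclidean_space (mdim M)) (\<phi> ` U) \<and>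
        homeomorphic_map (top_of_set U) (subtopology (Euclidean_space (mdim M)) (\<phi> ` U)) \<phi>) \<and>
     (\<forall>(U, \<phi>)\<in>charts M. \<forall>(V, \<psi>)\<in>charts M. \<forall>i<mdim M.
        C_inf_on (mdim M) (\<phi> ` (U \<inter> V)) (\<lambda>y. \<psi> (inv_into U \<phi> y) i))"

definition smooth_functions ::
  "('m::{t2_space,second_countable_topology}, 'x) manifold_scheme \<Rightarrow> ('m \<Rightarrow> real) set" where
  "smooth_functions M = {f. smooth_on_mfd M UNIV f}"

text \<open>
  Tangent vectors at \<open>x\<close> are the derivations at \<open>x\<close> of the algebra of smooth functions.  They are set to
  \<open>0\<close> on non-smooth functions, so that equal tangent vectors are equal as HOL functions.
\<close>

definition tangent_space ::
  "('m::{t2_space,second_countable_topology}, 'x) manifold_scheme \<Rightarrow> 'm \<Rightarrow> (('m \<Rightarrow> real) \<Rightarrow> real) set" where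
  "tangent_space M x = {v.
     (\<forall>f. f \<notin> smooth_functions M \<longrightarrow> v f = 0) \<and>
     (\<forall>a b. \<forall>f\<in>smooth_functions M. \<forall>h\<in>smooth_functions M.
        v (\<lambda>y. a * f y + b * h y) = a * v f + b * v h) \<and>
     (\<forall>f\<in>smooth_functions M. \<forall>h\<in>smooth_functions M.
        v (\<lambda>y. f y * h y) = v f * h x + f x * v h)}"


section \<open>Smooth vector bundles\<close>

text \<open>
  The fibres are linear subspaces of one ambient vector space \<open>'e\<close>, on which no topology is used
  (every bundle is of this form: take the direct sum of all its fibres as \<open>'e\<close>).  Local
  trivialisations are given as local frames: \<open>(U, r, e)\<close> stands for the frame \<open>e 0, \<dots>, e (r - 1)\<close>
  over \<open>U\<close>, and the transition matrices between frames are required to be smooth.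
\<close>

record ('m, 'e) vector_bundle = "'m manifold" +
  fibre :: "'m \<Rightarrow> 'e set"
  frames :: "('m set \<times> nat \<times> (nat \<Rightarrow> 'm \<Rightarrow> 'e)) set"

definition frame_coord :: "nat \<Rightarrow> (nat \<Rightarrow> 'm \<Rightarrow> 'e::real_vector) \<Rightarrow> nat \<Rightarrow> 'm \<Rightarrow> 'e \<Rightarrow> real" where
  "frame_coord r e i x v = representation ((\<lambda>j. e j x) ` {..<r}) v (e i x)"

definition smooth_vector_bundle ::
  "('m::{t2_space,second_countable_topology}, 'e::real_vector, 'x) vector_bundle_scheme \<Rightarrow> bool" where
  "smooth_vector_bundle E \<longleftrightarrow>
     smooth_manifold E \<and>
     (\<forall>x. subspace (fibre E x)) \<and>
     (\<Union>(U, r, e)\<in>frames E. U) = UNIV \<and>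
     (\<forall>(U, r, e)\<in>frames E. open U \<and> (\<forall>x\<in>U. inj_on (\<lambda>i. e i x) {..<r} \<and>
        independent ((\<lambda>i. e i x) ` {..<r}) \<and> span ((\<lambda>i. e i x) ` {..<r}) = fibre E x)) \<and>
     (\<forall>(U, r, e)\<in>frames E. \<forall>(U', r', e')\<in>frames E. \<forall>i<r. \<forall>j<r'.
        smooth_on_mfd E (U \<inter> U') (\<lambda>x. frame_coord r e i x (e' j x)))"

definition smooth_sections ::
  "('m::{t2_space,second_countable_topology}, 'e::real_vector, 'x) vector_bundle_scheme \<Rightarrow> ('m \<Rightarrow> 'e) set" where
  "smooth_sections E = {\<psi>. (\<forall>x. \<psi> x \<in> fibre E x) \<and>
     (\<forall>(U, r, e)\<in>frames E. \<forall>i<r. smooth_on_mfd E U (\<lambda>x. frame_coord r e i x (\<psi> x)))}"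


section \<open>Exterior powers\<close>

text \<open>
  As the fibre metric identifies \<open>E\<close> with its dual, an element of the \<open>p\<close>-th exterior power of the
  fibre at \<open>x\<close> is an alternating \<open>p\<close>-linear form on that fibre.  Forms take lists of vectors as
  arguments and are set to \<open>0\<close> on all lists other than lists of length \<open>p\<close> in the fibre.
\<close>

type_synonym ('m, 'e) eform = "'m \<Rightarrow> 'e list \<Rightarrow> real"

definition zero_form :: "('m, 'e) eform" where
  "zero_form = (\<lambda>x vs. 0)"

definition on_sections :: "('m, 'e) eform \<Rightarrow> ('m \<Rightarrow> 'e) list \<Rightarrow> 'm \<Rightarrow> real" where
  "on_sections \<alpha> \<psi>s = (\<lambda>x. \<alpha> x (map (\<lambda>\<psi>. \<psi> x) \<psi>s))"

definition alternating_on :: "'e::real_vector set \<Rightarrow> nat \<Rightarrow> ('e list \<Rightarrow> real) \<Rightarrow> bool" where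
  "alternating_on V p \<omega> \<longleftrightarrow>
     (\<forall>vs. \<not> (length vs = p \<and> set vs \<subseteq> V) \<longrightarrow> \<omega> vs = 0) \<and>
     (\<forall>vs i a b. \<forall>u\<in>V. \<forall>w\<in>V. length vs = p \<and> set vs \<subseteq> V \<and> i < p \<longrightarrow>
        \<omega> (vs[i := a *\<^sub>R u + b *\<^sub>R w]) = a * \<omega> (vs[i := u]) + b * \<omega> (vs[i := w])) \<and>
     (\<forall>vs i j. length vs = p \<and> set vs \<subseteq> V \<and> i < j \<and> j < p \<and> vs ! i = vs ! j \<longrightarrow> \<omega> vs = 0)"

definition smooth_forms ::
  "('m::{t2_space,second_countable_topology}, 'e::real_vector, 'x) vector_bundle_scheme \<Rightarrow> nat \<Rightarrow> ('m, 'e) eform set" where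
  "smooth_forms E p = {\<alpha>. (\<forall>x. alternating_on (fibre E x) p (\<alpha> x)) \<and>
     (\<forall>\<psi>s. length \<psi>s = p \<and> set \<psi>s \<subseteq> smooth_sections E \<longrightarrow> on_sections \<alpha> \<psi>s \<in> smooth_functions E)}"

text \<open>\<open>omit I xs\<close> is the list \<open>xs\<close> with a hat on the entries whose index is in \<open>I\<close>.\<close>

abbreviation omit :: "nat set \<Rightarrow> 'a list \<Rightarrow> 'a list" where
  "omit I xs \<equiv> nths xs (- I)"


section \<open>Metric, anchor and the kernel of the anchor\<close>

text \<open>
  \<open>metric\<close> is the bilinear form, \<open>anchor\<close> is $\rho$, \<open>bracket\<close> is the bracket of sections and
  \<open>twist\<close> is $H$.
\<close>

record ('m, 'e) courant = "('m, 'e) vector_bundle" +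
  metric :: "'m \<Rightarrow> 'e \<Rightarrow> 'e \<Rightarrow> real"
  anchor :: "'m \<Rightarrow> 'e \<Rightarrow> ('m \<Rightarrow> real) \<Rightarrow> real"
  bracket :: "('m \<Rightarrow> 'e) \<Rightarrow> ('m \<Rightarrow> 'e) \<Rightarrow> 'm \<Rightarrow> 'e"
  twist :: "('m, 'e) eform"

definition fibre_metric ::
  "('m::{t2_space,second_countable_topology}, 'e::real_vector, 'x) courant_scheme \<Rightarrow> bool" where
  "fibre_metric C \<longleftrightarrow>
     (\<forall>x. \<forall>u\<in>fibre C x. \<forall>v\<in>fibre C x. metric C x u v = metric C x v u) \<and>
     (\<forall>x a b. \<forall>u\<in>fibre C x. \<forall>v\<in>fibre C x. \<forall>w\<in>fibre C x.
        metric C x (a *\<^sub>R u + b *\<^sub>R v) w = a * metric C x u w + b * metric C x v w) \<and>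
     (\<forall>x. \<forall>u\<in>fibre C x. (\<forall>v\<in>fibre C x. metric C x u v = 0) \<longrightarrow> u = 0) \<and>
     (\<forall>\<phi>\<in>smooth_sections C. \<forall>\<psi>\<in>smooth_sections C.
        (\<lambda>x. metric C x (\<phi> x) (\<psi> x)) \<in> smooth_functions C)"

definition anchor_map ::
  "('m::{t2_space,second_countable_topology}, 'e::real_vector, 'x) courant_scheme \<Rightarrow> bool" where
  "anchor_map C \<longleftrightarrow>
     (\<forall>x. \<forall>u\<in>fibre C x. anchor C x u \<in> tangent_space C x) \<and>
     (\<forall>x a b f. \<forall>u\<in>fibre C x. \<forall>v\<in>fibre C x.
        anchor C x (a *\<^sub>R u + b *\<^sub>R v) f = a * anchor C x u f + b * anchor C x v f) \<and>
     (\<forall>\<psi>\<in>smooth_sections C. \<forall>f\<in>smooth_functions C.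
        (\<lambda>x. anchor C x (\<psi> x) f) \<in> smooth_functions C)"

text \<open>The action $\rho(\psi)[f]$ of a section on a function.\<close>

definition act :: "('m, 'e, 'x) courant_scheme \<Rightarrow> ('m \<Rightarrow> 'e) \<Rightarrow> ('m \<Rightarrow> real) \<Rightarrow> 'm \<Rightarrow> real" where
  "act C \<psi> f = (\<lambda>x. anchor C x (\<psi> x) f)"

text \<open>The vector of the fibre at \<open>x\<close> corresponding to a covector under the metric.\<close>

definition sharp :: "('m, 'e, 'x) courant_scheme \<Rightarrow> 'm \<Rightarrow> ('e \<Rightarrow> real) \<Rightarrow> 'e" where
  "sharp C x l = (THE w. w \<in> fibre C x \<and> (\<forall>u\<in>fibre C x. metric C x w u = l u))"

text \<open>The section $\mathcal{D} f = \rho^* df$.\<close>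

definition grad :: "('m, 'e, 'x) courant_scheme \<Rightarrow> ('m \<Rightarrow> real) \<Rightarrow> 'm \<Rightarrow> 'e" where
  "grad C f = (\<lambda>x. sharp C x (\<lambda>u. anchor C x u f))"

text \<open>
  The map $\tilde\rho : \wedge^p E \to TM \otimes \wedge^{p-1} E$, whose values are read as alternating
  $(p-1)$-forms with values in \<open>TM\<close>: take the vector corresponding to the contraction of the
  first slot, and apply $\rho$.  The lemma \<open>rho_tilde_wedge\<close> below gives its values on decomposables.
\<close>

definition rho_tilde ::
  "('m, 'e, 'x) courant_scheme \<Rightarrow> 'm \<Rightarrow> ('e list \<Rightarrow> real) \<Rightarrow> 'e list \<Rightarrow> ('m \<Rightarrow> real) \<Rightarrow> real" where
  "rho_tilde C x \<omega> vs = anchor C x (sharp C x (\<lambda>u. \<omega> (u # vs)))"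

definition ker_rho_forms ::
  "('m::{t2_space,second_countable_topology}, 'e::real_vector, 'x) courant_scheme \<Rightarrow> nat \<Rightarrow> ('m, 'e) eform set" where
  "ker_rho_forms C p = {\<alpha> \<in> smooth_forms C p.
     \<forall>x vs. Suc (length vs) = p \<and> set vs \<subseteq> fibre C x \<longrightarrow> rho_tilde C x (\<alpha> x) vs = (\<lambda>f. 0)}"

text \<open>
  \<open>wedge C x us\<close> is $u_1 \wedge \dots \wedge u_p$ regarded as a form, i.e. $\det \langle u_i, v_j\rangle$,
  by Laplace expansion along the first column.
\<close>

fun wedge :: "('m, 'e, 'x) courant_scheme \<Rightarrow> 'm \<Rightarrow> 'e list \<Rightarrow> 'e list \<Rightarrow> real" where
  "wedge C x us [] = (if us = [] then 1 else 0)"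
| "wedge C x us (v # vs) =
     (\<Sum>i<length us. (-1) ^ i * metric C x (us ! i) v * wedge C x (omit {i} us) vs)"

lemma sharp_eqI:
  assumes E: "smooth_vector_bundle C" and g: "fibre_metric C"
    and w: "w \<in> fibre C x" and l: "\<And>u. u \<in> fibre C x \<Longrightarrow> metric C x w u = l u"
  shows "sharp C x l = w"
  unfolding sharp_def
proof (rule the_equality)
  show "w \<in> fibre C x \<and> (\<forall>u\<in>fibre C x. metric C x w u = l u)" using w l by blast
next
  fix w' assume w': "w' \<in> fibre C x \<and> (\<forall>u\<in>fibre C x. metric C x w' u = l u)"
  have sub: "subspace (fibre C x)" using E by (simp add: smooth_vector_bundle_def)
  have lin: "metric C x (a *\<^sub>R u + b *\<^sub>R v) z = a * metric C x u z + b * metric C x v z"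
    if "u \<in> fibre C x" "v \<in> fibre C x" "z \<in> fibre C x" for a b u v z
    using g that by (simp add: fibre_metric_def)
  have nd: "u = 0" if "u \<in> fibre C x" "\<And>v. v \<in> fibre C x \<Longrightarrow> metric C x u v = 0" for u
    using g that by (simp add: fibre_metric_def)
  have "1 *\<^sub>R w' + (-1) *\<^sub>R w = 0"
  proof (rule nd)
    show "1 *\<^sub>R w' + (-1) *\<^sub>R w \<in> fibre C x"
      using sub w w' by (intro subspace_add subspace_scale) auto
    show "metric C x (1 *\<^sub>R w' + (-1) *\<^sub>R w) v = 0" if "v \<in> fibre C x" for v
      using lin[of w' w v 1 "-1"] w w' l that by simp
  qed
  then show "w' = w" by simp
qed

lemma rho_tilde_wedge:
  assumes E: "smooth_vector_bundle C" and g: "fibre_metric C" and r: "anchor_map C"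
    and us: "set us \<subseteq> fibre C x"
  shows "rho_tilde C x (wedge C x us) vs f =
    (\<Sum>i<length us. (-1) ^ i * anchor C x (us ! i) f * wedge C x (omit {i} us) vs)"
proof -
  define c where "c = (\<lambda>i. (-1) ^ i * wedge C x (omit {i} us) vs)"
  define s where "s = (\<lambda>m. \<Sum>i<m. c i *\<^sub>R (us ! i))"
  have sub: "subspace (fibre C x)" using E by (simp add: smooth_vector_bundle_def)
  have mem: "s m \<in> fibre C x" if "m \<le> length us" for m
    unfolding s_def using that us by (intro subspace_sum subspace_scale sub) auto
  have nth: "us ! m \<in> fibre C x" if "m < length us" for m using us that by auto
  have glin: "metric C x (a *\<^sub>R u + b *\<^sub>R v) z = a * metric C x u z + b * metric C x v z"
    if "u \<in> fibre C x" "v \<in> fibre C x" "z \<in> fibre C x" for a b u v z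
    using g that by (simp add: fibre_metric_def)
  have rlin: "anchor C x (a *\<^sub>R u + b *\<^sub>R v) h = a * anchor C x u h + b * anchor C x v h"
    if "u \<in> fibre C x" "v \<in> fibre C x" for a b u v h
    using r that by (simp add: anchor_map_def)
  have z: "0 \<in> fibre C x" using sub by (rule subspace_0)
  have gs: "metric C x (s m) z = (\<Sum>i<m. c i * metric C x (us ! i) z)"
    if "m \<le> length us" "z \<in> fibre C x" for m z
    using that(1)
  proof (induction m)
    case 0
    show ?case using glin[of 0 0 z 0 0] z that(2) by (simp add: s_def)
  next
    case (Suc m)
    have "s (Suc m) = 1 *\<^sub>R s m + c m *\<^sub>R (us ! m)" by (simp add: s_def)
    then show ?case using Suc glin[of "s m" "us ! m" z 1 "c m"] mem[of m] nth[of m] that(2) by simp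
  qed
  have rs: "anchor C x (s m) f = (\<Sum>i<m. c i * anchor C x (us ! i) f)" if "m \<le> length us" for m
    using that
  proof (induction m)
    case 0
    show ?case using rlin[of 0 0 0 0 f] z by (simp add: s_def)
  next
    case (Suc m)
    have "s (Suc m) = 1 *\<^sub>R s m + c m *\<^sub>R (us ! m)" by (simp add: s_def)
    then show ?case using Suc rlin[of "s m" "us ! m" 1 "c m" f] mem[of m] nth[of m] by simp
  qed
  have "sharp C x (\<lambda>u. wedge C x us (u # vs)) = s (length us)"
    by (rule sharp_eqI[OF E g mem[OF order_refl]]) (simp add: gs c_def mult.commute mult.left_commute)
  then show ?thesis
    unfolding rho_tilde_def using rs[of "length us"] by (simp add: c_def mult.commute mult.left_commute)
qed


section \<open>The derivative and the twisted Courant algebroid\<close>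

definition D_on_sections ::
  "('m, 'e, 'x) courant_scheme \<Rightarrow> ('m, 'e) eform \<Rightarrow> ('m \<Rightarrow> 'e) list \<Rightarrow> 'm \<Rightarrow> real" where
  "D_on_sections C \<alpha> \<psi>s = (\<lambda>x.
     (\<Sum>i<length \<psi>s. (-1) ^ i * act C (\<psi>s ! i) (on_sections \<alpha> (omit {i} \<psi>s)) x) +
     (\<Sum>j<length \<psi>s. \<Sum>i<j. (-1) ^ (i + j) *
        on_sections \<alpha> (bracket C (\<psi>s ! i) (\<psi>s ! j) # omit {i, j} \<psi>s) x))"

text \<open>
  \<open>calD C p \<alpha>\<close> is the \<open>(p + 1)\<close>-form determined by its values on sections; that such a form
  exists is part of what is claimed wherever the derivative is asserted to lie in a set of forms.
\<close>

definition calD ::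
  "('m::{t2_space,second_countable_topology}, 'e::real_vector, 'x) courant_scheme \<Rightarrow> nat \<Rightarrow> ('m, 'e) eform \<Rightarrow> ('m, 'e) eform" where
  "calD C p \<alpha> = (THE \<beta>. \<beta> \<in> smooth_forms C (Suc p) \<and>
     (\<forall>\<psi>s. length \<psi>s = Suc p \<and> set \<psi>s \<subseteq> smooth_sections C \<longrightarrow>
        on_sections \<beta> \<psi>s = D_on_sections C \<alpha> \<psi>s))"

definition H_tilde :: "('m, 'e, 'x) courant_scheme \<Rightarrow> 'm \<Rightarrow> 'e \<Rightarrow> 'e \<Rightarrow> 'e \<Rightarrow> 'e" where
  "H_tilde C x u v w = sharp C x (\<lambda>z. twist C x [u, v, w, z])"

definition twisted_courant_algebroid ::
  "('m::{t2_space,second_countable_topology}, 'e::real_vector, 'x) courant_scheme \<Rightarrow> bool" where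
  "twisted_courant_algebroid C \<longleftrightarrow>
     smooth_vector_bundle C \<and> fibre_metric C \<and> anchor_map C \<and>
     (\<forall>\<phi>\<in>smooth_sections C. \<forall>\<psi>\<in>smooth_sections C. bracket C \<phi> \<psi> \<in> smooth_sections C) \<and>
     (\<forall>a b. \<forall>\<phi>\<in>smooth_sections C. \<forall>\<psi>\<in>smooth_sections C. \<forall>\<eta>\<in>smooth_sections C. \<forall>x.
        bracket C (\<lambda>y. a *\<^sub>R \<phi> y + b *\<^sub>R \<psi> y) \<eta> x = a *\<^sub>R bracket C \<phi> \<eta> x + b *\<^sub>R bracket C \<psi> \<eta> x \<and>
        bracket C \<eta> (\<lambda>y. a *\<^sub>R \<phi> y + b *\<^sub>R \<psi> y) x = a *\<^sub>R bracket C \<eta> \<phi> x + b *\<^sub>R bracket C \<eta> \<psi> x) \<and>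
     twist C \<in> ker_rho_forms C 4 \<and>
     (\<forall>\<phi>\<in>smooth_sections C. \<forall>\<psi>1\<in>smooth_sections C. \<forall>\<psi>2\<in>smooth_sections C. \<forall>x.
        H_tilde C x (\<phi> x) (\<psi>1 x) (\<psi>2 x) =
          bracket C \<phi> (bracket C \<psi>1 \<psi>2) x - bracket C (bracket C \<phi> \<psi>1) \<psi>2 x
          - bracket C \<psi>1 (bracket C \<phi> \<psi>2) x) \<and>
     calD C 4 (twist C) = zero_form \<and>
     (\<forall>\<phi>\<in>smooth_sections C. \<forall>\<psi>\<in>smooth_sections C. \<forall>f\<in>smooth_functions C. \<forall>x.
        bracket C \<phi> (\<lambda>y. f y *\<^sub>R \<psi> y) x = act C \<phi> f x *\<^sub>R \<psi> x + f x *\<^sub>R bracket C \<phi> \<psi> x) \<and>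
     (\<forall>\<psi>\<in>smooth_sections C. \<forall>x.
        bracket C \<psi> \<psi> x = (1 / 2) *\<^sub>R grad C (\<lambda>y. metric C y (\<psi> y) (\<psi> y)) x) \<and>
     (\<forall>\<phi>\<in>smooth_sections C. \<forall>\<psi>\<in>smooth_sections C. \<forall>x.
        act C \<phi> (\<lambda>y. metric C y (\<psi> y) (\<psi> y)) x = 2 * metric C x (bracket C \<phi> \<psi> x) (\<psi> x))"


section \<open>The cochain complex\<close>

text \<open>The operator $\tilde H$ on \<open>p\<close>-forms; for \<open>p = 0\<close> the sum is empty.\<close>

definition H_op :: "('m, 'e, 'x) courant_scheme \<Rightarrow> nat \<Rightarrow> ('m, 'e) eform \<Rightarrow> ('m, 'e) eform" where
  "H_op C p \<alpha> = (\<lambda>x vs. if length vs = p + 2 \<and> set vs \<subseteq> fibre C x then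
     (\<Sum>k<p + 2. \<Sum>j<k. \<Sum>i<j. (-1) ^ (i + j + k) *
        \<alpha> x (H_tilde C x (vs ! i) (vs ! j) (vs ! k) # omit {i, j, k} vs)) else 0)"

definition cochains ::
  "('m::{t2_space,second_countable_topology}, 'e::real_vector, 'x) courant_scheme \<Rightarrow> nat \<Rightarrow> ('m, 'e) eform set" where
  "cochains C p = {\<alpha> \<in> ker_rho_forms C p. H_op C p \<alpha> = zero_form}"

text \<open>Cochain complexes of real vector spaces of forms; the first three clauses are linearity.\<close>

definition cochain_complex ::
  "(nat \<Rightarrow> ('m, 'e) eform set) \<Rightarrow> (nat \<Rightarrow> ('m, 'e) eform \<Rightarrow> ('m, 'e) eform) \<Rightarrow> bool" where
  "cochain_complex K d \<longleftrightarrow>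
     (\<forall>p. zero_form \<in> K p) \<and>
     (\<forall>p a b. \<forall>\<alpha>\<in>K p. \<forall>\<beta>\<in>K p. (\<lambda>x vs. a * \<alpha> x vs + b * \<beta> x vs) \<in> K p) \<and>
     (\<forall>p a b. \<forall>\<alpha>\<in>K p. \<forall>\<beta>\<in>K p.
        d p (\<lambda>x vs. a * \<alpha> x vs + b * \<beta> x vs) = (\<lambda>x vs. a * d p \<alpha> x vs + b * d p \<beta> x vs)) \<and>
     (\<forall>p. \<forall>\<alpha>\<in>K p. d p \<alpha> \<in> K (Suc p)) \<and>
     (\<forall>p. \<forall>\<alpha>\<in>K p. d (Suc p) (d p \<alpha>) = zero_form)"

end

theory Submission
  imports Defs "HOL-Library.Function_Algebras"
begin

text \<open>
  Evaluating a form on sections turns the statement into algebra.  Let \<open>A\<close> be the ring of smooth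
  functions and \<open>\<Gamma>\<close> the \<open>A\<close>-module of smooth sections.  The square $[\psi,\psi]$ is half the gradient of
  $\langle\psi,\psi\rangle$, and at a given point the gradients of such functions determine whether
  $\rho$ annihilates a vector.  Hence the forms in the kernel of $\tilde\rho$ are exactly the alternating
  \<open>A\<close>-multilinear functionals on \<open>\<Gamma>\<close> that vanish as soon as one argument is a square $[\psi,\psi]$
  (\<open>ker_rho_forms_iff\<close>, \<open>form_on_sections\<close>, \<open>pointwise_form_ker_rho\<close>).  On such functionals the bracket
  behaves as if it were skew-symmetric, because $[\phi,\psi]+[\psi,\phi]$ is a combination of squares.

  This makes the usual Cartan calculus available.  The identities
  $\iota_y L_x = L_x \iota_y - \iota_{[x,y]}$ and $\iota_x d = L_x - d\,\iota_x$ can be read as recursive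
  definitions of $L_x$ and $d$ on functionals of lists of sections, and every property is then an
  induction on the degree: $d$ preserves multilinearity, alternation and vanishing on squares
  (\<open>form_ext_d\<close>).  The failure of the Jacobi identity first shows up in $[L_x,L_y]-L_{[x,y]}$, then in
  $[L_x,d]$, and finally in $d^2$, which inserts the Jacobiator into three arguments
  (\<open>ext_d_ext_d\<close>).  Written as a sum (\<open>jac_op_eq_sum\<close>) this says $d^2 = \tilde H$, with the same sign.

  Consequently a form in $\ker\tilde\rho$ is a cochain if and only if $d^2$ annihilates it
  (\<open>cochains_iff\<close>).  For a cochain $\alpha$ this gives $d^2\alpha=0$ directly, and also
  $\tilde H(d\alpha)=d(d^2\alpha)=0$, so that $d\alpha$ is a cochain.

  What remains is analysis: a functional on sections comes from a form on the fibres.  This uses bump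
  functions (\<open>smooth_bump\<close>), which extend a fibre vector to a global section (\<open>section_through\<close>) and
  show that a tensorial functional depends only on the value of its argument at the point
  (\<open>tensorial_vanishes\<close>).
\<close>

section \<open>Cartan calculus over a module with a Leibniz bracket\<close>

text \<open>
  Explicit sums over omitted indices are compared with recursions along the list by splitting off the
  index \<open>0\<close>; these rules describe what that does to the omitted entries.
\<close>

lemma omit_Cons:
  "omit {0} (x # xs) = xs"
  "omit {Suc i} (x # xs) = x # omit {i} xs"
  "omit {0, Suc j} (x # xs) = omit {j} xs"
  "omit {Suc i, Suc j} (x # xs) = x # omit {i, j} xs"
  "omit {0, Suc j, Suc k} (x # xs) = omit {j, k} xs"
  "omit {Suc i, Suc j, Suc k} (x # xs) = x # omit {i, j, k} xs"
proof -
  have "{j. Suc j \<in> - {0}} = UNIV" "{j. Suc j \<noteq> Suc i} = - {i}"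
    "{k. k \<noteq> j} = - {j}" 
    by auto
  then show "omit {0} (x # xs) = xs" "omit {Suc i} (x # xs) = x # omit {i} xs"
    "omit {0, Suc j} (x # xs) = omit {j} xs"
    by (auto simp: nths_Cons nths_all)
  have "{l. l \<noteq> i \<and> l \<noteq> j} = - {i, j}" "{l. l \<noteq> j \<and> l \<noteq> k} = - {j, k}"
    "{l. l \<noteq> i \<and> l \<noteq> j \<and> l \<noteq> k} = - {i, j, k}"
    by auto
  then show "omit {Suc i, Suc j} (x # xs) = x # omit {i, j} xs"
    "omit {0, Suc j, Suc k} (x # xs) = omit {j, k} xs"
    "omit {Suc i, Suc j, Suc k} (x # xs) = x # omit {i, j, k} xs"
    by (auto simp: nths_Cons)
qed

lemma length_omit:
  "i < length xs \<Longrightarrow> Suc (length (omit {i} xs)) = length xs"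
  "i < j \<Longrightarrow> j < length xs \<Longrightarrow> Suc (Suc (length (omit {i, j} xs))) = length xs"
  "i < j \<Longrightarrow> j < k \<Longrightarrow> k < length xs \<Longrightarrow> Suc (Suc (Suc (length (omit {i, j, k} xs)))) = length xs"
proof -
  show 1: "Suc (length (omit {i} xs)) = length xs" if "i < length xs" for i and xs :: "'a list"
    using that by (induction xs arbitrary: i) (auto simp: omit_Cons less_Suc_eq_0_disj)
  show 2: "Suc (Suc (length (omit {i, j} xs))) = length xs" if "i < j" "j < length xs" for i j and xs :: "'a list"
    using that
  proof (induction xs arbitrary: i j)
    case (Cons x xs)
    then obtain j' where "j = Suc j'" by (cases j) auto
    then show ?case using Cons by (cases i) (auto simp: omit_Cons 1)
  qed simp
  show "Suc (Suc (Suc (length (omit {i, j, k} xs)))) = length xs" if "i < j" "j < k" "k < length xs"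
    using that
  proof (induction xs arbitrary: i j k)
    case (Cons x xs)
    then obtain j' k' where "j = Suc j'" "k = Suc k'" by (cases j; cases k) auto
    then show ?case using Cons by (cases i) (auto simp: omit_Cons 2)
  qed simp
qed

lemma triple_sum_shift:
  fixes F :: "nat \<Rightarrow> nat \<Rightarrow> nat \<Rightarrow> 'a::comm_monoid_add"
  shows "(\<Sum>k<Suc n. \<Sum>j<k. \<Sum>i<j. F i j k) =
    (\<Sum>k<n. \<Sum>j<k. F 0 (Suc j) (Suc k)) + (\<Sum>k<n. \<Sum>j<k. \<Sum>i<j. F (Suc i) (Suc j) (Suc k))"
  by (simp add: sum.lessThan_Suc_shift sum.distrib del: sum.lessThan_Suc)

text \<open>
  The algebra behind twisted Courant algebroids: the elements of \<open>A\<close> are the functions, those of \<open>\<Gamma>\<close>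
  the sections.  Carriers are explicit because the smooth functions
  and sections are subsets of function types.  The last two axioms are the traces of the Jacobi identity
  that survive the twist: an alternating Jacobiator vanishes on repeated arguments, and an
  \<open>A\<close>-linear one forces the anchor to preserve brackets.
\<close>

locale leibniz_algebroid = module scale
  for scale :: "'f::comm_ring_1 \<Rightarrow> 's::ab_group_add \<Rightarrow> 's" (infixr "\<cdot>" 75) +
  fixes A :: "'f set" and \<Gamma> :: "'s set"
    and rho :: "'s \<Rightarrow> 'f \<Rightarrow> 'f" and br :: "'s \<Rightarrow> 's \<Rightarrow> 's"
  assumes one_A: "1 \<in> A"
    and uminus_A: "f \<in> A \<Longrightarrow> - f \<in> A"
    and add_A: "\<lbrakk>f \<in> A; g \<in> A\<rbrakk> \<Longrightarrow> f + g \<in> A"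
    and mult_A: "\<lbrakk>f \<in> A; g \<in> A\<rbrakk> \<Longrightarrow> f * g \<in> A"
    and add_\<Gamma>: "\<lbrakk>x \<in> \<Gamma>; y \<in> \<Gamma>\<rbrakk> \<Longrightarrow> x + y \<in> \<Gamma>"
    and scale_\<Gamma>: "\<lbrakk>f \<in> A; x \<in> \<Gamma>\<rbrakk> \<Longrightarrow> f \<cdot> x \<in> \<Gamma>"
    and rho_A: "\<lbrakk>x \<in> \<Gamma>; f \<in> A\<rbrakk> \<Longrightarrow> rho x f \<in> A"
    and rho_add: "\<lbrakk>x \<in> \<Gamma>; f \<in> A; g \<in> A\<rbrakk> \<Longrightarrow> rho x (f + g) = rho x f + rho x g"
    and rho_mult: "\<lbrakk>x \<in> \<Gamma>; f \<in> A; g \<in> A\<rbrakk> \<Longrightarrow> rho x (f * g) = rho x f * g + f * rho x g"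
    and rho_add_left: "\<lbrakk>x \<in> \<Gamma>; y \<in> \<Gamma>; f \<in> A\<rbrakk> \<Longrightarrow> rho (x + y) f = rho x f + rho y f"
    and rho_scale_left: "\<lbrakk>x \<in> \<Gamma>; f \<in> A; g \<in> A\<rbrakk> \<Longrightarrow> rho (f \<cdot> x) g = f * rho x g"
    and br_\<Gamma>: "\<lbrakk>x \<in> \<Gamma>; y \<in> \<Gamma>\<rbrakk> \<Longrightarrow> br x y \<in> \<Gamma>"
    and br_add_left: "\<lbrakk>x \<in> \<Gamma>; y \<in> \<Gamma>; z \<in> \<Gamma>\<rbrakk> \<Longrightarrow> br (x + y) z = br x z + br y z"
    and br_add_right: "\<lbrakk>x \<in> \<Gamma>; y \<in> \<Gamma>; z \<in> \<Gamma>\<rbrakk> \<Longrightarrow> br z (x + y) = br z x + br z y"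
    and br_scale_right: "\<lbrakk>x \<in> \<Gamma>; y \<in> \<Gamma>; f \<in> A\<rbrakk> \<Longrightarrow> br x (f \<cdot> y) = rho x f \<cdot> y + f \<cdot> br x y"
    and br_square_left: "\<lbrakk>x \<in> \<Gamma>; y \<in> \<Gamma>\<rbrakk> \<Longrightarrow> br (br y y) x = 0"
    and rho_br: "\<lbrakk>x \<in> \<Gamma>; y \<in> \<Gamma>; f \<in> A\<rbrakk> \<Longrightarrow> rho (br x y) f = rho x (rho y f) - rho y (rho x f)"
begin

lemma zero_A: "0 \<in> A" using add_A[OF one_A uminus_A[OF one_A]] by simp
lemma diff_A: "\<lbrakk>f \<in> A; g \<in> A\<rbrakk> \<Longrightarrow> f - g \<in> A" using add_A[of f "- g"] uminus_A by simp
lemma uminus_\<Gamma>: "x \<in> \<Gamma> \<Longrightarrow> - x \<in> \<Gamma>" using scale_\<Gamma>[OF uminus_A[OF one_A], of x] by simp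
lemma diff_\<Gamma>: "\<lbrakk>x \<in> \<Gamma>; y \<in> \<Gamma>\<rbrakk> \<Longrightarrow> x - y \<in> \<Gamma>" using add_\<Gamma>[of x "- y"] uminus_\<Gamma> by simp

lemmas closed = zero_A one_A uminus_A add_A diff_A mult_A rho_A add_\<Gamma> uminus_\<Gamma> diff_\<Gamma> scale_\<Gamma> br_\<Gamma>

lemma rho_zero: "x \<in> \<Gamma> \<Longrightarrow> rho x 0 = 0"
  using rho_add[of x 0 0] zero_A by simp

definition secs :: "nat \<Rightarrow> 's list set" where
  "secs p = {xs. length xs = p \<and> set xs \<subseteq> \<Gamma>}"

lemma secs_simps [simp]:
  "xs \<in> secs 0 \<longleftrightarrow> xs = []"
  "[] \<in> secs p \<longleftrightarrow> p = 0"
  "x # xs \<in> secs (Suc p) \<longleftrightarrow> x \<in> \<Gamma> \<and> xs \<in> secs p"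
  by (auto simp: secs_def)

lemma secs_Suc_cases:
  assumes "xs \<in> secs (Suc p)"
  obtains x ys where "xs = x # ys" "x \<in> \<Gamma>" "ys \<in> secs p"
  using assms by (cases xs) (auto simp: secs_def)

abbreviation contract :: "'s \<Rightarrow> ('s list \<Rightarrow> 'f) \<Rightarrow> 's list \<Rightarrow> 'f" where
  "contract x a \<equiv> \<lambda>xs. a (x # xs)"

text \<open>
  The functionals to which a form in the kernel of the anchor gives rise.  The recursion asks for each
  condition in the first slot only, but of all contractions: adjacent transpositions generate the
  symmetric group, so this is full multilinearity and alternation, and squares are killed in every
  slot.
\<close>

fun alt_form :: "nat \<Rightarrow> ('s list \<Rightarrow> 'f) \<Rightarrow> bool" where
  "alt_form 0 a \<longleftrightarrow> a [] \<in> A"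
| "alt_form (Suc p) a \<longleftrightarrow>
     (\<forall>x\<in>\<Gamma>. alt_form p (contract x a)) \<and>
     (\<forall>x\<in>\<Gamma>. \<forall>y\<in>\<Gamma>. \<forall>xs\<in>secs p. a ((x + y) # xs) = a (x # xs) + a (y # xs)) \<and>
     (\<forall>f\<in>A. \<forall>x\<in>\<Gamma>. \<forall>xs\<in>secs p. a (f \<cdot> x # xs) = f * a (x # xs)) \<and>
     (\<forall>x\<in>\<Gamma>. \<forall>xs. x # xs \<in> secs p \<longrightarrow> a (x # x # xs) = 0) \<and>
     (\<forall>x\<in>\<Gamma>. \<forall>xs\<in>secs p. a (br x x # xs) = 0)"

lemma form_contract: "\<lbrakk>alt_form (Suc p) a; x \<in> \<Gamma>\<rbrakk> \<Longrightarrow> alt_form p (contract x a)" by simp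

lemma form_plus: "\<lbrakk>alt_form (Suc p) a; x \<in> \<Gamma>; y \<in> \<Gamma>; xs \<in> secs p\<rbrakk> \<Longrightarrow>
    a ((x + y) # xs) = a (x # xs) + a (y # xs)"
  and form_times: "\<lbrakk>alt_form (Suc p) a; f \<in> A; x \<in> \<Gamma>; xs \<in> secs p\<rbrakk> \<Longrightarrow> a (f \<cdot> x # xs) = f * a (x # xs)"
  and form_square: "\<lbrakk>alt_form (Suc p) a; x \<in> \<Gamma>; xs \<in> secs p\<rbrakk> \<Longrightarrow> a (br x x # xs) = 0"
  by simp_all

lemma form_repeat: "\<lbrakk>alt_form (Suc (Suc p)) a; x \<in> \<Gamma>; xs \<in> secs p\<rbrakk> \<Longrightarrow> a (x # x # xs) = 0"
  by auto

lemma form_neg: "\<lbrakk>alt_form (Suc p) a; x \<in> \<Gamma>; xs \<in> secs p\<rbrakk> \<Longrightarrow> a ((- x) # xs) = - a (x # xs)"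
  using form_times[of p a "- 1" x xs] by (simp add: closed del: alt_form.simps)

lemma form_minus: "\<lbrakk>alt_form (Suc p) a; x \<in> \<Gamma>; y \<in> \<Gamma>; xs \<in> secs p\<rbrakk> \<Longrightarrow>
    a ((x - y) # xs) = a (x # xs) - a (y # xs)"
  using form_plus[of p a x "- y" xs] form_neg[of p a y xs] by (simp add: closed del: alt_form.simps)

lemma form_zero_slot: "\<lbrakk>alt_form (Suc p) a; x \<in> \<Gamma>; xs \<in> secs p\<rbrakk> \<Longrightarrow> a (0 # xs) = 0"
  using form_times[of p a 0 x xs] by (simp add: closed del: alt_form.simps)

lemma form_swap:
  assumes "alt_form (Suc (Suc p)) a" "x \<in> \<Gamma>" "y \<in> \<Gamma>" "xs \<in> secs p"
  shows "a (x # y # xs) = - a (y # x # xs)"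
proof -
  have 1: "a ((x + y) # z # xs) = a (x # z # xs) + a (y # z # xs)" if "z \<in> \<Gamma>" for z
    by (rule form_plus[OF assms(1)]) (use assms that in auto)
  have 2: "a (z # (x + y) # xs) = a (z # x # xs) + a (z # y # xs)" if "z \<in> \<Gamma>" for z
    using form_plus[OF form_contract[OF assms(1) that] assms(2-4)] .
  have "a ((x + y) # (x + y) # xs) = 0"
    by (rule form_repeat[OF assms(1)]) (use assms in \<open>auto simp: closed\<close>)
  then have "a (x # y # xs) + a (y # x # xs) = 0"
    using 1[of "x + y"] 2[of x] 2[of y] assms(2,3) form_repeat[OF assms(1,2,4)]
      form_repeat[OF assms(1,3,4)] by (simp add: closed del: alt_form.simps)
  then show ?thesis by (simp add: eq_neg_iff_add_eq_0)
qed

text \<open>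
  Polarisation: $[x,y]+[y,x]$ is $[x+y,x+y]-[x,x]-[y,y]$, a combination of squares.
\<close>

lemma form_br_skew:
  assumes "alt_form (Suc p) a" "x \<in> \<Gamma>" "y \<in> \<Gamma>" "xs \<in> secs p"
  shows "a (br x y # xs) = - a (br y x # xs)"
proof -
  have "br (x + y) (x + y) = (br x x + br y y) + (br x y + br y x)"
    using assms by (simp add: br_add_left br_add_right closed algebra_simps)
  moreover have "a (br (x + y) (x + y) # xs) = 0"
    by (rule form_square[OF assms(1)]) (use assms in \<open>auto simp: closed\<close>)
  ultimately have "a (br x y # xs) + a (br y x # xs) = 0"
    using assms form_plus[OF assms(1), of _ _ xs] form_square[OF assms(1), of _ xs]
    by (simp add: closed del: alt_form.simps)
  then show ?thesis by (simp add: eq_neg_iff_add_eq_0)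
qed

text \<open>
  The bracket obeys no Leibniz rule in its first argument, but inside a form it can be turned around,
  and the rule for the second argument applies.
\<close>

lemma form_br_scale_left:
  assumes "alt_form (Suc p) a" "x \<in> \<Gamma>" "y \<in> \<Gamma>" "f \<in> A" "xs \<in> secs p"
  shows "a (br (f \<cdot> x) y # xs) = f * a (br x y # xs) - rho y f * a (x # xs)"
proof -
  have "a (br (f \<cdot> x) y # xs) = - a (br y (f \<cdot> x) # xs)"
    by (rule form_br_skew[OF assms(1)]) (use assms in \<open>auto simp: closed\<close>)
  also have "\<dots> = - (rho y f * a (x # xs) + f * a (br y x # xs))"
    using assms form_plus[OF assms(1), of _ _ xs] form_times[OF assms(1), of _ _ xs]
    by (simp add: br_scale_right closed del: alt_form.simps)
  also have "\<dots> = f * a (br x y # xs) - rho y f * a (x # xs)"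
    using form_br_skew[OF assms(1,2,3,5)] by (simp add: algebra_simps)
  finally show ?thesis .
qed

lemma form_br_square_right:
  assumes "alt_form (Suc p) a" "x \<in> \<Gamma>" "y \<in> \<Gamma>" "xs \<in> secs p"
  shows "a (br x (br y y) # xs) = 0"
  using form_br_skew[OF assms(1,2), of "br y y" xs] br_square_left[OF assms(2,3)]
    form_zero_slot[OF assms(1,2,4)] assms by (simp add: closed del: alt_form.simps)

lemma form_A: "\<lbrakk>alt_form p a; xs \<in> secs p\<rbrakk> \<Longrightarrow> a xs \<in> A"
proof (induction p arbitrary: a xs)
  case (Suc p)
  then show ?case by (elim secs_Suc_cases) (use Suc.IH[of "contract _ a"] in auto)
qed simp

lemma form_add: "\<lbrakk>alt_form p a; alt_form p b\<rbrakk> \<Longrightarrow> alt_form p (\<lambda>xs. a xs + b xs)"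
proof (induction p arbitrary: a b)
  case (Suc p)
  then show ?case by (auto simp: algebra_simps)
qed (simp add: closed)

lemma form_scale: "\<lbrakk>alt_form p a; f \<in> A\<rbrakk> \<Longrightarrow> alt_form p (\<lambda>xs. f * a xs)"
proof (induction p arbitrary: a)
  case (Suc p)
  then show ?case by (auto simp: algebra_simps)
qed (simp add: closed)

lemma form_diff: "\<lbrakk>alt_form p a; alt_form p b\<rbrakk> \<Longrightarrow> alt_form p (\<lambda>xs. a xs - b xs)"
  using form_add[of p a "\<lambda>xs. - 1 * b xs"] form_scale[of p b "- 1"] by (simp add: closed)

text \<open>
  The Lie derivative, from $\iota_y L_x = L_x\,\iota_y - \iota_{[x,y]}$.
\<close>

fun lie :: "'s \<Rightarrow> ('s list \<Rightarrow> 'f) \<Rightarrow> 's list \<Rightarrow> 'f" where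
  "lie x a [] = rho x (a [])"
| "lie x a (y # ys) = lie x (contract y a) ys - a (br x y # ys)"

text \<open>
  The exterior derivative, from $\iota_x d = L_x - d\,\iota_x$.  There is no $(-1)$-form to
  differentiate, whence the value \<open>0\<close> at the empty list.
\<close>

fun ext_d :: "('s list \<Rightarrow> 'f) \<Rightarrow> 's list \<Rightarrow> 'f" where
  "ext_d a [] = 0"
| "ext_d a (x # xs) = lie x a xs - ext_d (contract x a) xs"

lemma lie_cong:
  "\<lbrakk>x \<in> \<Gamma>; xs \<in> secs p; \<And>zs. zs \<in> secs p \<Longrightarrow> b zs = a zs\<rbrakk> \<Longrightarrow> lie x b xs = lie x a xs"
proof (induction p arbitrary: a b xs)
  case (Suc p)
  from Suc.prems(2) show ?case
  proof (cases rule: secs_Suc_cases)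
    case (1 y ys)
    then show ?thesis using Suc.IH[of ys "contract y b" "contract y a"] Suc.prems by (simp add: closed)
  qed
qed simp

lemma ext_d_cong:
  "\<lbrakk>xs \<in> secs (Suc p); \<And>zs. zs \<in> secs p \<Longrightarrow> b zs = a zs\<rbrakk> \<Longrightarrow> ext_d b xs = ext_d a xs"
proof (induction p arbitrary: a b xs)
  case 0
  from 0(1) show ?case
    by (cases rule: secs_Suc_cases) (use 0(2) in simp)
next
  case (Suc p)
  from Suc.prems(1) show ?case
  proof (cases rule: secs_Suc_cases)
    case (1 y ys)
    then show ?thesis
      using Suc.IH[of ys "contract y b" "contract y a"] Suc.prems(2) lie_cong[of y ys "Suc p" b a]
      by simp
  qed
qed

lemma lie_add:
  "\<lbrakk>x \<in> \<Gamma>; alt_form p a; alt_form p b; xs \<in> secs p\<rbrakk> \<Longrightarrow>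
     lie x (\<lambda>zs. a zs + b zs) xs = lie x a xs + lie x b xs"
proof (induction p arbitrary: a b xs)
  case (Suc p)
  from Suc.prems(4) show ?case
  proof (cases rule: secs_Suc_cases)
    case (1 y ys)
    then show ?thesis using Suc.IH[of "contract y a" "contract y b" ys] Suc.prems by (simp add: algebra_simps)
  qed
qed (simp add: rho_add)

lemma lie_scale:
  "\<lbrakk>x \<in> \<Gamma>; alt_form p a; f \<in> A; xs \<in> secs p\<rbrakk> \<Longrightarrow>
     lie x (\<lambda>zs. f * a zs) xs = rho x f * a xs + f * lie x a xs"
proof (induction p arbitrary: a xs)
  case (Suc p)
  from Suc.prems(4) show ?case
  proof (cases rule: secs_Suc_cases)
    case (1 y ys)
    then show ?thesis using Suc.IH[of "contract y a" ys] Suc.prems by (simp add: algebra_simps)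
  qed
qed (simp add: rho_mult)

lemma form_lie: "\<lbrakk>alt_form p a; x \<in> \<Gamma>\<rbrakk> \<Longrightarrow> alt_form p (lie x a)"
proof (induction p arbitrary: a)
  case 0
  then show ?case by (simp add: closed)
next
  case (Suc p)
  note a = \<open>alt_form (Suc p) a\<close> and x = \<open>x \<in> \<Gamma>\<close>
  show ?case unfolding alt_form.simps
  proof (intro conjI ballI allI impI)
    fix y assume y: "y \<in> \<Gamma>"
    show "alt_form p (contract y (lie x a))"
      using form_diff[OF Suc.IH[OF form_contract[OF a y] x] form_contract[OF a br_\<Gamma>[OF x y]]] by simp
  next
    fix y z xs assume h: "y \<in> \<Gamma>" "z \<in> \<Gamma>" "xs \<in> secs p"
    have "lie x (contract (y + z) a) xs = lie x (contract y a) xs + lie x (contract z a) xs"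
      using lie_cong[OF x h(3), of "contract (y + z) a" "\<lambda>zs. a (y # zs) + a (z # zs)"]
        lie_add[OF x form_contract[OF a h(1)] form_contract[OF a h(2)] h(3)] form_plus[OF a h(1,2)] by simp
    then show "lie x a ((y + z) # xs) = lie x a (y # xs) + lie x a (z # xs)"
      using h x form_plus[OF a, of "br x y" "br x z" xs] by (simp add: br_add_right closed del: alt_form.simps)
  next
    fix f y xs assume h: "f \<in> A" "y \<in> \<Gamma>" "xs \<in> secs p"
    have "lie x (contract (f \<cdot> y) a) xs = rho x f * a (y # xs) + f * lie x (contract y a) xs"
      using lie_cong[OF x h(3), of "contract (f \<cdot> y) a" "\<lambda>zs. f * a (y # zs)"]
        lie_scale[OF x form_contract[OF a h(2)] h(1,3)] form_times[OF a h(1,2)] by simp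
    then show "lie x a (f \<cdot> y # xs) = f * lie x a (y # xs)"
      using h x form_plus[OF a, of "rho x f \<cdot> y" "f \<cdot> br x y" xs] form_times[OF a, of _ _ xs]
      by (simp add: br_scale_right closed algebra_simps del: alt_form.simps)
  next
    fix y xs assume y: "y \<in> \<Gamma>" and h: "y # xs \<in> secs p"
    then obtain q where q: "p = Suc q" and xs: "xs \<in> secs q" by (cases p) auto
    have "lie x (contract y (contract y a)) xs = 0"
    proof -
      have "lie x (contract y (contract y a)) xs = lie x (\<lambda>zs. 0 * a (y # y # zs)) xs"
        by (rule lie_cong[OF x xs]) (use form_repeat[of q a y] a q y in simp)
      also have "\<dots> = 0"
        using lie_scale[OF x form_contract[OF form_contract[OF a[unfolded q] y] y] zero_A xs]
        by (simp add: rho_zero x)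
      finally show ?thesis .
    qed
    then show "lie x a (y # y # xs) = 0"
      using form_swap[of q a y "br x y" xs] a q y x xs by (simp add: closed del: alt_form.simps)
  next
    fix y xs assume y: "y \<in> \<Gamma>" and xs: "xs \<in> secs p"
    have "lie x (contract (br y y) a) xs = lie x (\<lambda>zs. 0 * a (y # zs)) xs"
      by (rule lie_cong[OF x xs]) (use form_square[OF a y] in simp)
    also have "\<dots> = 0"
      using lie_scale[OF x form_contract[OF a y] zero_A xs] by (simp add: rho_zero x)
    finally show "lie x a (br y y # xs) = 0"
      using form_br_square_right[OF a x y xs] by simp
  qed
qed

lemma ext_d_add:
  "\<lbrakk>alt_form p a; alt_form p b; xs \<in> secs (Suc p)\<rbrakk> \<Longrightarrow>
     ext_d (\<lambda>zs. a zs + b zs) xs = ext_d a xs + ext_d b xs"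
proof (induction p arbitrary: a b xs)
  case 0
  from 0(3) show ?case
    by (cases rule: secs_Suc_cases) (use 0 in \<open>simp add: rho_add\<close>)
next
  case (Suc p)
  from Suc.prems(3) show ?case
  proof (cases rule: secs_Suc_cases)
    case (1 y ys)
    then show ?thesis
      using Suc.IH[of "contract y a" "contract y b" ys] Suc.prems lie_add[of y "Suc p" a b ys]
      by simp
  qed
qed

lemma ext_d_const_scale:
  "\<lbrakk>alt_form p a; c \<in> A; \<And>x. x \<in> \<Gamma> \<Longrightarrow> rho x c = 0; xs \<in> secs (Suc p)\<rbrakk> \<Longrightarrow>
     ext_d (\<lambda>zs. c * a zs) xs = c * ext_d a xs"
proof (induction p arbitrary: a xs)
  case 0
  from 0(4) show ?case
    by (cases rule: secs_Suc_cases) (use 0 in \<open>simp add: rho_mult\<close>)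
next
  case (Suc p)
  from Suc.prems(4) show ?case
  proof (cases rule: secs_Suc_cases)
    case (1 y ys)
    then show ?thesis
      using Suc.IH[of "contract y a" ys] Suc.prems lie_scale[of y "Suc p" a c ys]
      by (simp add: algebra_simps)
  qed
qed

lemma ext_d_zero:
  assumes "\<And>zs. zs \<in> secs p \<Longrightarrow> a zs = 0" "xs \<in> secs (Suc p)"
  shows "ext_d a xs = 0"
proof -
  have "alt_form p (\<lambda>zs. 0)" by (induction p) (auto simp: closed)
  then have "ext_d (\<lambda>zs. 0 + 0) xs = ext_d (\<lambda>zs. 0) xs + ext_d (\<lambda>zs. 0) xs"
    using ext_d_add[of p "\<lambda>zs. 0" "\<lambda>zs. 0" xs] assms(2) by simp
  then show ?thesis using ext_d_cong[of xs p a "\<lambda>zs. 0"] assms by simp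
qed

lemma ext_d_minus:
  assumes "alt_form p a" "alt_form p b" "xs \<in> secs (Suc p)"
  shows "ext_d (\<lambda>zs. a zs - b zs) xs = ext_d a xs - ext_d b xs"
proof -
  have "ext_d (\<lambda>zs. (a zs - b zs) + b zs) xs = ext_d (\<lambda>zs. a zs - b zs) xs + ext_d b xs"
    by (rule ext_d_add[OF form_diff[OF assms(1,2)] assms(2,3)])
  then show ?thesis by simp
qed

text \<open>
  \<open>A\<close>-linearity of $d\alpha$ in its first argument.  Separately, $L_{fx}$ and $d(f\,\iota_x\alpha)$ both
  contain a wedge product with $df$; only their difference is linear in \<open>f\<close>, so the induction is on that
  difference.
\<close>

lemma lie_scale_left:
  "\<lbrakk>alt_form (Suc p) a; x \<in> \<Gamma>; f \<in> A; xs \<in> secs (Suc p)\<rbrakk> \<Longrightarrow>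
     lie (f \<cdot> x) a xs - ext_d (\<lambda>zs. f * a (x # zs)) xs = f * (lie x a xs - ext_d (contract x a) xs)"
proof (induction p arbitrary: a xs)
  case 0
  from 0(4) obtain y where xs: "xs = [y]" and y: "y \<in> \<Gamma>" by (auto elim!: secs_Suc_cases)
  have "a [x] \<in> A" "a [y] \<in> A" using form_A[OF 0(1)] 0 y by auto
  then show ?case using 0 xs y form_br_scale_left[OF 0(1), of x y f "[]"]
    by (simp add: rho_mult rho_scale_left algebra_simps del: alt_form.simps)
next
  case (Suc p)
  from Suc.prems(4) obtain y ys where xs: "xs = y # ys" and y: "y \<in> \<Gamma>" and ys: "ys \<in> secs (Suc p)"
    by (auto elim!: secs_Suc_cases)
  note a = Suc.prems(1) and x = Suc.prems(2) and f = Suc.prems(3)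
  \<comment> \<open>The induction hypothesis contracts with \<open>y\<close> before \<open>x\<close>, the derivative of the contraction with \<open>x\<close>
    produces the opposite order.\<close>
  have s: "a (x # y # zs) = - a (y # x # zs)" if "zs \<in> secs p" for zs
    using form_swap[OF a x y that] .
  have fyx: "alt_form p (\<lambda>zs. a (y # x # zs))" using a x y by simp
  have neg: "ext_d (\<lambda>zs. - b zs) ys = - ext_d b ys" if "alt_form p b" for b
    using ext_d_minus[of p "\<lambda>zs. b zs - b zs" b ys] form_diff[OF that that] that ys
      ext_d_zero[of p "\<lambda>zs. 0" ys]
    by simp
  have d1: "ext_d (\<lambda>zs. f * a (x # y # zs)) ys = - ext_d (\<lambda>zs. f * a (y # x # zs)) ys"
    using ext_d_cong[OF ys, of "\<lambda>zs. f * a (x # y # zs)" "\<lambda>zs. - (f * a (y # x # zs))"]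
      neg[OF form_scale[OF fyx f]] s by simp
  have d2: "ext_d (\<lambda>zs. a (x # y # zs)) ys = - ext_d (\<lambda>zs. a (y # x # zs)) ys"
    using ext_d_cong[OF ys, of "\<lambda>zs. a (x # y # zs)" "\<lambda>zs. - a (y # x # zs)"]
      neg[OF fyx] s by simp
  have l: "lie y (\<lambda>zs. f * a (x # zs)) ys = rho y f * a (x # ys) + f * lie y (contract x a) ys"
    by (rule lie_scale[OF y form_contract[OF a x] f ys])
  have IH: "lie (f \<cdot> x) (contract y a) ys - ext_d (\<lambda>zs. f * a (y # x # zs)) ys
     = f * (lie x (contract y a) ys - ext_d (\<lambda>zs. a (y # x # zs)) ys)"
    by (rule Suc.IH[OF form_contract[OF a y] x f ys])
  show ?case
    using IH form_br_scale_left[OF a x y f ys] unfolding xs by (simp add: l d1 d2 algebra_simps del: alt_form.simps)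
qed

lemma lie_add_left:
  "\<lbrakk>alt_form p a; x \<in> \<Gamma>; y \<in> \<Gamma>; xs \<in> secs p\<rbrakk> \<Longrightarrow> lie (x + y) a xs = lie x a xs + lie y a xs"
proof (induction p arbitrary: a xs)
  case 0
  then show ?case by (simp add: rho_add_left)
next
  case (Suc p)
  from Suc.prems(4) show ?case
  proof (cases rule: secs_Suc_cases)
    case (1 z zs)
    then show ?thesis
      using Suc.IH[of "contract z a" zs] Suc.prems form_plus[OF Suc.prems(1), of "br x z" "br y z" zs]
      by (simp add: br_add_left closed del: alt_form.simps) (simp add: algebra_simps)
  qed
qed

text \<open>
  A square acts trivially: its anchor is a commutator of a derivation with itself, and its left bracket
  vanishes.  This is why $d\alpha$ again kills squares.
\<close>

lemma lie_square: "\<lbrakk>alt_form p a; x \<in> \<Gamma>; xs \<in> secs p\<rbrakk> \<Longrightarrow> lie (br x x) a xs = 0"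
proof (induction p arbitrary: a xs)
  case 0
  then show ?case by (simp add: rho_br)
next
  case (Suc p)
  from Suc.prems(3) show ?case
  proof (cases rule: secs_Suc_cases)
    case (1 z zs)
    then show ?thesis
      using Suc.IH[of "contract z a" zs] Suc.prems form_zero_slot[OF Suc.prems(1), of z zs]
      by (simp add: br_square_left)
  qed
qed

lemma form_ext_d: "alt_form p a \<Longrightarrow> alt_form (Suc p) (ext_d a)"
proof (induction p arbitrary: a)
  case 0
  then show ?case by (simp add: closed rho_add_left rho_scale_left rho_br)
next
  case (Suc p)
  note a = \<open>alt_form (Suc p) a\<close>
  show ?case unfolding alt_form.simps(2)[of "Suc p"]
  proof (intro conjI ballI allI impI)
    fix x assume x: "x \<in> \<Gamma>"
    show "alt_form (Suc p) (contract x (ext_d a))"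
      using form_diff[OF form_lie[OF a x] Suc.IH[OF form_contract[OF a x]]] by simp
  next
    fix x y xs assume h: "x \<in> \<Gamma>" "y \<in> \<Gamma>" "xs \<in> secs (Suc p)"
    have "ext_d (contract (x + y) a) xs = ext_d (contract x a) xs + ext_d (contract y a) xs"
      using ext_d_cong[OF h(3), of "contract (x + y) a" "\<lambda>zs. a (x # zs) + a (y # zs)"]
        ext_d_add[OF form_contract[OF a h(1)] form_contract[OF a h(2)] h(3)] form_plus[OF a h(1,2)] by simp
    then show "ext_d a ((x + y) # xs) = ext_d a (x # xs) + ext_d a (y # xs)"
      using lie_add_left[OF a h] by simp
  next
    fix f x xs assume h: "f \<in> A" "x \<in> \<Gamma>" "xs \<in> secs (Suc p)"
    have "ext_d (contract (f \<cdot> x) a) xs = ext_d (\<lambda>zs. f * a (x # zs)) xs"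
      by (rule ext_d_cong[OF h(3)]) (use form_times[OF a h(1,2)] in simp)
    then show "ext_d a (f \<cdot> x # xs) = f * ext_d a (x # xs)"
      using lie_scale_left[OF a h(2,1,3)] by simp
  next
    fix x xs assume x: "x \<in> \<Gamma>" and "x # xs \<in> secs (Suc p)"
    then have xs: "xs \<in> secs p" by simp
    have "ext_d (contract x (contract x a)) xs = 0"
    proof (cases p)
      case (Suc q)
      then show ?thesis using ext_d_zero[of q "contract x (contract x a)" xs] xs form_repeat[of q a x] a x by simp
    qed (use xs in simp)
    then show "ext_d a (x # x # xs) = 0"
      using form_square[OF a x xs] by simp
  next
    fix x xs assume x: "x \<in> \<Gamma>" and xs: "xs \<in> secs (Suc p)"
    have "ext_d (contract (br x x) a) xs = 0"
      by (rule ext_d_zero[OF _ xs]) (use form_square[OF a x] in simp)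
    then show "ext_d a (br x x # xs) = 0" using lie_square[OF a x xs] by simp
  qed
qed

definition jacobiator :: "'s \<Rightarrow> 's \<Rightarrow> 's \<Rightarrow> 's" where
  "jacobiator x y z = br x (br y z) - br (br x y) z - br y (br x z)"

lemma jacobiator_\<Gamma>: "\<lbrakk>x \<in> \<Gamma>; y \<in> \<Gamma>; z \<in> \<Gamma>\<rbrakk> \<Longrightarrow> jacobiator x y z \<in> \<Gamma>"
  by (simp add: jacobiator_def closed)

text \<open>
  The operators that measure the failure of the Jacobi identity: \<open>jac_op2 x y\<close> is
  $[L_x,L_y]-L_{[x,y]}$, \<open>jac_op1 x\<close> is $[L_x,d]$, and \<open>jac_op\<close> is $d^2$.  Their recursions are the ones that
  these expressions inherit from the Cartan identities.
\<close>

fun jac_op2 :: "'s \<Rightarrow> 's \<Rightarrow> ('s list \<Rightarrow> 'f) \<Rightarrow> 's list \<Rightarrow> 'f" where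
  "jac_op2 x y a [] = 0"
| "jac_op2 x y a (z # zs) = jac_op2 x y (contract z a) zs - a (jacobiator x y z # zs)"

fun jac_op1 :: "'s \<Rightarrow> ('s list \<Rightarrow> 'f) \<Rightarrow> 's list \<Rightarrow> 'f" where
  "jac_op1 x a [] = 0"
| "jac_op1 x a (y # ys) = jac_op2 x y a ys - jac_op1 x (contract y a) ys"

fun jac_op :: "('s list \<Rightarrow> 'f) \<Rightarrow> 's list \<Rightarrow> 'f" where
  "jac_op a [] = 0"
| "jac_op a (x # xs) = jac_op1 x a xs + jac_op (contract x a) xs"

text \<open>
  The defining identity of \<open>lie y\<close> under a further Lie derivative, which has to be additive for this.
\<close>

lemma lie_contract_lie: "\<lbrakk>alt_form (Suc p) a; x \<in> \<Gamma>; z \<in> \<Gamma>; y \<in> \<Gamma>; zs \<in> secs p\<rbrakk> \<Longrightarrow>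
  lie x (contract z (lie y a)) zs = lie x (lie y (contract z a)) zs - lie x (contract (br y z) a) zs"
  using lie_add[of x p "contract z (lie y a)" "contract (br y z) a" zs] form_lie[of "Suc p" a y] form_contract[of p a "br y z"]
  by (simp add: closed)

lemma lie_commutator:
  "\<lbrakk>alt_form p a; x \<in> \<Gamma>; y \<in> \<Gamma>; zs \<in> secs p\<rbrakk> \<Longrightarrow>
     lie x (lie y a) zs - lie y (lie x a) zs - lie (br x y) a zs = jac_op2 x y a zs"
proof (induction p arbitrary: a zs)
  case 0
  then show ?case by (simp add: rho_br)
next
  case (Suc p)
  note a = Suc.prems(1) and x = Suc.prems(2) and y = Suc.prems(3)
  from Suc.prems(4) obtain z ws where zs: "zs = z # ws" and z: "z \<in> \<Gamma>" and ws: "ws \<in> secs p"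
    by (auto elim!: secs_Suc_cases)
  have "a (jacobiator x y z # ws) = a (br x (br y z) # ws) - a (br (br x y) z # ws) - a (br y (br x z) # ws)"
    unfolding jacobiator_def using form_minus[OF a, of _ _ ws] x y z ws by (simp add: closed del: alt_form.simps)
  then show ?case
    using lie_contract_lie[OF a x z y ws] lie_contract_lie[OF a y z x ws] Suc.IH[OF form_contract[OF a z] x y ws]
    unfolding zs by (simp add: algebra_simps del: alt_form.simps)
qed

lemma lie_ext_d:
  "\<lbrakk>alt_form p a; x \<in> \<Gamma>; zs \<in> secs (Suc p)\<rbrakk> \<Longrightarrow>
     lie x (ext_d a) zs - ext_d (lie x a) zs = jac_op1 x a zs"
proof (induction p arbitrary: a zs)
  case 0
  then obtain z where "zs = [z]" "z \<in> \<Gamma>" by (auto elim!: secs_Suc_cases)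
  then show ?case using 0 by (simp add: rho_br)
next
  case (Suc p)
  note a = Suc.prems(1) and x = Suc.prems(2)
  from Suc.prems(3) obtain y ws where zs: "zs = y # ws" and y: "y \<in> \<Gamma>" and ws: "ws \<in> secs (Suc p)"
    by (auto elim!: secs_Suc_cases)
  have fy: "alt_form p (contract y a)" and fb: "alt_form p (contract (br x y) a)" using a x y by (auto simp: closed)
  have 1: "lie x (contract y (ext_d a)) ws = lie x (lie y a) ws - lie x (ext_d (contract y a)) ws"
    using lie_add[OF x, of "Suc p" "contract y (ext_d a)" "ext_d (contract y a)" ws]
      form_contract[OF form_ext_d[OF a] y] form_ext_d[OF fy] ws by (simp del: alt_form.simps)
  have 2: "ext_d (contract y (lie x a)) ws = ext_d (lie x (contract y a)) ws - ext_d (contract (br x y) a) ws"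
    using ext_d_minus[OF form_lie[OF fy x] fb ws] by simp
  show ?case
    by (simp add: zs 1[simplified] 2[simplified] algebra_simps
        flip: Suc.IH[OF fy x ws] lie_commutator[OF a x y ws])
qed

theorem ext_d_ext_d:
  "\<lbrakk>alt_form p a; zs \<in> secs (Suc (Suc p))\<rbrakk> \<Longrightarrow> ext_d (ext_d a) zs = jac_op a zs"
proof (induction p arbitrary: a zs)
  case 0
  then obtain x y where "zs = [x, y]" "x \<in> \<Gamma>" "y \<in> \<Gamma>" by (auto elim!: secs_Suc_cases)
  then show ?case using 0 by (simp add: rho_br)
next
  case (Suc p)
  note a = Suc.prems(1)
  from Suc.prems(2) obtain x ws where zs: "zs = x # ws" and x: "x \<in> \<Gamma>" and ws: "ws \<in> secs (Suc (Suc p))"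
    by (auto elim!: secs_Suc_cases)
  have fx: "alt_form p (contract x a)" using a x by auto
  have "ext_d (contract x (ext_d a)) ws = ext_d (lie x a) ws - ext_d (ext_d (contract x a)) ws"
    using ext_d_minus[OF form_lie[OF a x] form_ext_d[OF fx] ws] by simp
  then show ?case
    using Suc.IH[OF fx ws] lie_ext_d[OF a x ws] unfolding zs by (simp add: algebra_simps del: alt_form.simps)
qed

lemma omit1_secs: "xs \<in> secs (Suc p) \<Longrightarrow> i < Suc p \<Longrightarrow> omit {i} xs \<in> secs p"
  using length_omit(1)[of i xs] set_nths_subset[of xs] by (auto simp: secs_def)

lemma omit2_secs: "xs \<in> secs (Suc (Suc p)) \<Longrightarrow> i < j \<Longrightarrow> j < Suc (Suc p) \<Longrightarrow> omit {i, j} xs \<in> secs p"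
  using length_omit(2)[of i j xs] set_nths_subset[of xs] by (auto simp: secs_def)

lemma omit3_secs: "xs \<in> secs (Suc (Suc (Suc p))) \<Longrightarrow> i < j \<Longrightarrow> j < k \<Longrightarrow> k < Suc (Suc (Suc p)) \<Longrightarrow>
    omit {i, j, k} xs \<in> secs p"
  using length_omit(3)[of i j k xs] set_nths_subset[of xs] by (auto simp: secs_def)

lemma nth_secs: "xs \<in> secs p \<Longrightarrow> i < p \<Longrightarrow> xs ! i \<in> \<Gamma>"
  by (auto simp: secs_def)

lemma length_secs: "xs \<in> secs p \<Longrightarrow> length xs = p"
  by (simp add: secs_def)

text \<open>
  Unrolling the recursion leaves the bracket in the slot of the argument that it replaces; moving it to
  the front past \<open>j\<close> arguments produces the sign.
\<close>

lemma lie_eq_sum: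
  "\<lbrakk>alt_form p a; x \<in> \<Gamma>; xs \<in> secs p\<rbrakk> \<Longrightarrow>
    lie x a xs = rho x (a xs) + (\<Sum>j<p. (-1) ^ Suc j * a (br x (xs ! j) # omit {j} xs))"
proof (induction p arbitrary: a xs)
  case (Suc p)
  note a = Suc.prems(1) and x = Suc.prems(2)
  from Suc.prems(3) obtain y ys where xs: "xs = y # ys" and y: "y \<in> \<Gamma>" and ys: "ys \<in> secs p"
    by (auto elim!: secs_Suc_cases)
  have sw: "(-1) ^ Suc j * a (y # br x (ys ! j) # omit {j} ys)
      = (-1) ^ Suc (Suc j) * a (br x (ys ! j) # y # omit {j} ys)" if j: "j < p" for j
  proof -
    obtain q where q: "p = Suc q" using j by (cases p) auto
    show ?thesis
      using form_swap[of q a y "br x (ys ! j)" "omit {j} ys"] a y x ys j nth_secs[OF ys j]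
        omit1_secs[of ys q j] unfolding q by (simp add: closed del: alt_form.simps)
  qed
  have "lie x (contract y a) ys = rho x (a (y # ys)) + (\<Sum>j<p. (-1) ^ Suc j * a (y # br x (ys ! j) # omit {j} ys))"
    by (rule Suc.IH[OF form_contract[OF a y] x ys])
  also have "\<dots> = rho x (a (y # ys)) + (\<Sum>j<p. (-1) ^ Suc (Suc j) * a (br x (ys ! j) # y # omit {j} ys))"
    using sw by simp
  finally show ?case unfolding xs by (simp add: sum.lessThan_Suc_shift omit_Cons del: sum.lessThan_Suc)
qed simp

theorem ext_d_eq_sum:
  "\<lbrakk>alt_form p a; xs \<in> secs (Suc p)\<rbrakk> \<Longrightarrow>
    ext_d a xs = (\<Sum>i<Suc p. (-1) ^ i * rho (xs ! i) (a (omit {i} xs))) +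
     (\<Sum>j<Suc p. \<Sum>i<j. (-1) ^ (i + j) * a (br (xs ! i) (xs ! j) # omit {i, j} xs))"
proof (induction p arbitrary: a xs)
  case 0
  then show ?case by (auto elim!: secs_Suc_cases simp: omit_Cons)
next
  case (Suc p)
  note a = Suc.prems(1)
  from Suc.prems(2) obtain x ys where xs: "xs = x # ys" and x: "x \<in> \<Gamma>" and ys: "ys \<in> secs (Suc p)"
    by (auto elim!: secs_Suc_cases)
  have sw: "a (x # br (ys ! i) (ys ! j) # omit {i, j} ys)
      = - a (br (ys ! i) (ys ! j) # x # omit {i, j} ys)" if j: "j < Suc p" "i < j" for i j
  proof -
    obtain q where q: "p = Suc q" using j by (cases p) auto
    show ?thesis
      using form_swap[of q a x "br (ys ! i) (ys ! j)" "omit {i, j} ys"] a x ys j nth_secs[OF ys, of i]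
        nth_secs[OF ys, of j] omit2_secs[of ys q i j] unfolding q by (simp add: closed del: alt_form.simps)
  qed
  have s: "(\<Sum>j<Suc p. \<Sum>i<j. (-1) ^ (i + j) * a (x # br (ys ! i) (ys ! j) # omit {i, j} ys))
     = - (\<Sum>j<Suc p. \<Sum>i<j. (-1) ^ (i + j) * a (br (ys ! i) (ys ! j) # x # omit {i, j} ys))"
    unfolding sum_negf[symmetric] using sw by (intro sum.cong refl) auto
  have "ext_d (contract x a) ys = (\<Sum>i<Suc p. (-1) ^ i * rho (ys ! i) (a (x # omit {i} ys)))
      - (\<Sum>j<Suc p. \<Sum>i<j. (-1) ^ (i + j) * a (br (ys ! i) (ys ! j) # x # omit {i, j} ys))"
    using Suc.IH[OF form_contract[OF a x] ys] unfolding s by simp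
  moreover have "lie x a ys = rho x (a ys) + (\<Sum>j<Suc p. (-1) ^ Suc j * a (br x (ys ! j) # omit {j} ys))"
    by (rule lie_eq_sum[OF a x ys])
  ultimately show ?case unfolding xs
    by (simp add: sum.lessThan_Suc_shift omit_Cons sum.distrib sum_negf del: sum.lessThan_Suc)
qed

lemma jac_op2_eq_sum:
  "\<lbrakk>alt_form p a; x \<in> \<Gamma>; y \<in> \<Gamma>; xs \<in> secs p\<rbrakk> \<Longrightarrow>
    jac_op2 x y a xs = (\<Sum>k<p. (-1) ^ Suc k * a (jacobiator x y (xs ! k) # omit {k} xs))"
proof (induction p arbitrary: a xs)
  case (Suc p)
  note a = Suc.prems(1) and x = Suc.prems(2) and y = Suc.prems(3)
  from Suc.prems(4) obtain z ys where xs: "xs = z # ys" and z: "z \<in> \<Gamma>" and ys: "ys \<in> secs p"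
    by (auto elim!: secs_Suc_cases)
  have sw: "(-1) ^ Suc j * a (z # jacobiator x y (ys ! j) # omit {j} ys)
      = (-1) ^ Suc (Suc j) * a (jacobiator x y (ys ! j) # z # omit {j} ys)" if j: "j < p" for j
  proof -
    obtain q where q: "p = Suc q" using j by (cases p) auto
    show ?thesis
      using form_swap[of q a z "jacobiator x y (ys ! j)" "omit {j} ys"] a y x z ys j nth_secs[OF ys j]
        omit1_secs[of ys q j] unfolding q by (simp add: jacobiator_\<Gamma> del: alt_form.simps)
  qed
  have "jac_op2 x y (contract z a) ys = (\<Sum>j<p. (-1) ^ Suc j * a (z # jacobiator x y (ys ! j) # omit {j} ys))"
    by (rule Suc.IH[OF form_contract[OF a z] x y ys])
  also have "\<dots> = (\<Sum>j<p. (-1) ^ Suc (Suc j) * a (jacobiator x y (ys ! j) # z # omit {j} ys))"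
    using sw by simp
  finally show ?case unfolding xs by (simp add: sum.lessThan_Suc_shift omit_Cons del: sum.lessThan_Suc)
qed simp

lemma jac_op1_eq_sum:
  "\<lbrakk>alt_form p a; x \<in> \<Gamma>; xs \<in> secs (Suc p)\<rbrakk> \<Longrightarrow>
    jac_op1 x a xs = (\<Sum>k<Suc p. \<Sum>j<k. (-1) ^ (j + k) * a (jacobiator x (xs ! j) (xs ! k) # omit {j, k} xs))"
proof (induction p arbitrary: a xs)
  case 0
  then show ?case by (auto elim!: secs_Suc_cases)
next
  case (Suc p)
  note a = Suc.prems(1) and x = Suc.prems(2)
  from Suc.prems(3) obtain y ys where xs: "xs = y # ys" and y: "y \<in> \<Gamma>" and ys: "ys \<in> secs (Suc p)"
    by (auto elim!: secs_Suc_cases)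
  have sw: "a (y # jacobiator x (ys ! i) (ys ! j) # omit {i, j} ys)
      = - a (jacobiator x (ys ! i) (ys ! j) # y # omit {i, j} ys)" if j: "j < Suc p" "i < j" for i j
  proof -
    obtain q where q: "p = Suc q" using j by (cases p) auto
    show ?thesis
      using form_swap[of q a y "jacobiator x (ys ! i) (ys ! j)" "omit {i, j} ys"] a x y ys j nth_secs[OF ys, of i]
        nth_secs[OF ys, of j] omit2_secs[of ys q i j] unfolding q by (simp add: jacobiator_\<Gamma> del: alt_form.simps)
  qed
  have s: "(\<Sum>j<Suc p. \<Sum>i<j. (-1) ^ (i + j) * a (y # jacobiator x (ys ! i) (ys ! j) # omit {i, j} ys))
     = - (\<Sum>j<Suc p. \<Sum>i<j. (-1) ^ (i + j) * a (jacobiator x (ys ! i) (ys ! j) # y # omit {i, j} ys))"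
    unfolding sum_negf[symmetric] using sw by (intro sum.cong refl) auto
  have "jac_op1 x (contract y a) ys = - (\<Sum>j<Suc p. \<Sum>i<j. (-1) ^ (i + j) * a (jacobiator x (ys ! i) (ys ! j) # y # omit {i, j} ys))"
    using Suc.IH[OF form_contract[OF a y] x ys] unfolding s by simp
  moreover have "jac_op2 x y a ys = (\<Sum>k<Suc p. (-1) ^ Suc k * a (jacobiator x y (ys ! k) # omit {k} ys))"
    by (rule jac_op2_eq_sum[OF a x y ys])
  ultimately show ?case unfolding xs
    by (simp add: sum.lessThan_Suc_shift omit_Cons sum.distrib sum_negf del: sum.lessThan_Suc)
qed

theorem jac_op_eq_sum:
  "\<lbrakk>alt_form p a; xs \<in> secs (Suc (Suc p))\<rbrakk> \<Longrightarrow>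
    jac_op a xs = (\<Sum>k<Suc (Suc p). \<Sum>j<k. \<Sum>i<j. (-1) ^ (i + j + k) *
      a (jacobiator (xs ! i) (xs ! j) (xs ! k) # omit {i, j, k} xs))"
proof (induction p arbitrary: a xs)
  case 0
  then obtain x y where "xs = [x, y]" by (auto elim!: secs_Suc_cases)
  then show ?case by (simp add: sum.lessThan_Suc)
next
  case (Suc p)
  note a = Suc.prems(1)
  from Suc.prems(2) obtain x ys where xs: "xs = x # ys" and x: "x \<in> \<Gamma>" and ys: "ys \<in> secs (Suc (Suc p))"
    by (auto elim!: secs_Suc_cases)
  have sw: "a (x # jacobiator (ys ! i) (ys ! j) (ys ! k) # omit {i, j, k} ys)
      = - a (jacobiator (ys ! i) (ys ! j) (ys ! k) # x # omit {i, j, k} ys)" if j: "k < Suc (Suc p)" "j < k" "i < j" for i j k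
  proof -
    obtain q where q: "p = Suc q" using j by (cases p) auto
    show ?thesis
      using form_swap[of q a x "jacobiator (ys ! i) (ys ! j) (ys ! k)" "omit {i, j, k} ys"] a x ys j nth_secs[OF ys, of i]
        nth_secs[OF ys, of j] nth_secs[OF ys, of k] omit3_secs[of ys q i j k] unfolding q
      by (simp add: jacobiator_\<Gamma> del: alt_form.simps)
  qed
  have s: "(\<Sum>k<Suc (Suc p). \<Sum>j<k. \<Sum>i<j. (-1) ^ (i + j + k) * a (x # jacobiator (ys ! i) (ys ! j) (ys ! k) # omit {i, j, k} ys))
     = - (\<Sum>k<Suc (Suc p). \<Sum>j<k. \<Sum>i<j. (-1) ^ (i + j + k) * a (jacobiator (ys ! i) (ys ! j) (ys ! k) # x # omit {i, j, k} ys))"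
    unfolding sum_negf[symmetric] using sw by (intro sum.cong refl) auto
  have "jac_op (contract x a) ys = - (\<Sum>k<Suc (Suc p). \<Sum>j<k. \<Sum>i<j. (-1) ^ (i + j + k) * a (jacobiator (ys ! i) (ys ! j) (ys ! k) # x # omit {i, j, k} ys))"
    using Suc.IH[OF form_contract[OF a x] ys] unfolding s by simp
  moreover have "jac_op1 x a ys = (\<Sum>k<Suc (Suc p). \<Sum>j<k. (-1) ^ (j + k) * a (jacobiator x (ys ! j) (ys ! k) # omit {j, k} ys))"
    by (rule jac_op1_eq_sum[OF a x ys])
  ultimately show ?case unfolding xs
    by (simp add: triple_sum_shift omit_Cons sum_negf del: sum.lessThan_Suc)
qed

lemma form_nth_linear:
  "\<lbrakk>alt_form p a; xs \<in> secs p; i < p; x \<in> \<Gamma>; y \<in> \<Gamma>; f \<in> A; g \<in> A\<rbrakk> \<Longrightarrow>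
    a (xs[i := f \<cdot> x + g \<cdot> y]) = f * a (xs[i := x]) + g * a (xs[i := y])"
proof (induction p arbitrary: a xs i)
  case (Suc p)
  note a = Suc.prems(1)
  from Suc.prems(2) obtain z ys where xs: "xs = z # ys" and z: "z \<in> \<Gamma>" and ys: "ys \<in> secs p"
    by (auto elim!: secs_Suc_cases)
  show ?case
  proof (cases i)
    case 0
    then show ?thesis using form_plus[OF a, of "f \<cdot> x" "g \<cdot> y" ys] form_times[OF a, of _ _ ys] Suc.prems ys
      unfolding xs by (simp add: closed del: alt_form.simps)
  next
    case (Suc j)
    then show ?thesis using Suc.IH[OF form_contract[OF a z] ys, of j] Suc.prems unfolding xs by simp
  qed
qed simp

lemma form_repeat_later:
  "\<lbrakk>alt_form p a; x # ys @ x # zs \<in> secs p\<rbrakk> \<Longrightarrow> a (x # ys @ x # zs) = 0"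
proof (induction ys arbitrary: p a)
  case Nil
  then obtain q where "p = Suc (Suc q)" "x \<in> \<Gamma>" "zs \<in> secs q"
    by (cases p; cases "p - 1") (auto simp: secs_def)
  then show ?case using Nil form_repeat[of q a x zs] by simp
next
  case (Cons y ys)
  then obtain q where q: "p = Suc (Suc q)" and x: "x \<in> \<Gamma>" and y: "y \<in> \<Gamma>" and r: "ys @ x # zs \<in> secs q"
    by (cases p; cases "p - 1") (auto simp: secs_def)
  have "a (x # y # ys @ x # zs) = - a (y # x # ys @ x # zs)"
    by (rule form_swap[OF Cons.prems(1)[unfolded q] x y r])
  also have "a (y # x # ys @ x # zs) = 0"
    using Cons.IH[of "Suc q" "contract y a"] Cons.prems(1) q x y r by simp
  finally show ?case by simp
qed

lemma form_alternating:
  "\<lbrakk>alt_form p a; xs \<in> secs p; i < j; j < p; xs ! i = xs ! j\<rbrakk> \<Longrightarrow> a xs = 0"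
proof (induction p arbitrary: a xs i j)
  case (Suc p)
  from Suc.prems(2) obtain z ys where xs: "xs = z # ys" and z: "z \<in> \<Gamma>" and ys: "ys \<in> secs p"
    by (auto elim!: secs_Suc_cases)
  obtain j' where j': "j = Suc j'" using Suc.prems(3) by (cases j) auto
  show ?case
  proof (cases i)
    case 0
    have "ys = take j' ys @ z # drop (Suc j') ys"
      using id_take_nth_drop[of j' ys] Suc.prems j' 0 ys unfolding xs by (simp add: length_secs)
    then show ?thesis
      using form_repeat_later[OF Suc.prems(1), of z "take j' ys" "drop (Suc j') ys"] Suc.prems(2) unfolding xs by simp
  next
    case (Suc i')
    then show ?thesis using Suc.IH[OF form_contract[OF Suc.prems(1) z] ys, of i' j'] Suc.prems j' unfolding xs by simp
  qed
qed simp

text \<open>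
  The converse of the lemmas above: slotwise conditions give the recursive ones.  Squares are required
  to be killed in the first slot only, and the swap of the first two arguments carries this over to
  contractions.
\<close>

lemma form_of_multilinear:
  assumes clA: "\<And>xs. xs \<in> secs p \<Longrightarrow> a xs \<in> A"
    and lin: "\<And>xs i x y f g. \<lbrakk>xs \<in> secs p; i < p; x \<in> \<Gamma>; y \<in> \<Gamma>; f \<in> A; g \<in> A\<rbrakk> \<Longrightarrow>
      a (xs[i := f \<cdot> x + g \<cdot> y]) = f * a (xs[i := x]) + g * a (xs[i := y])"
    and alt: "\<And>xs i. \<lbrakk>xs \<in> secs p; Suc i < p; xs ! i = xs ! Suc i\<rbrakk> \<Longrightarrow> a xs = 0"
    and sq: "\<And>x xs. \<lbrakk>x \<in> \<Gamma>; br x x # xs \<in> secs p\<rbrakk> \<Longrightarrow> a (br x x # xs) = 0"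
  shows "alt_form p a"
  using assms
proof (induction p arbitrary: a)
  case (Suc p)
  have lin0: "a ((f \<cdot> x + g \<cdot> y) # xs) = f * a (x # xs) + g * a (y # xs)"
    if "xs \<in> secs p" "x \<in> \<Gamma>" "y \<in> \<Gamma>" "f \<in> A" "g \<in> A" for f g x y xs
    using Suc.prems(2)[of "x # xs" 0 x y f g] that by simp
  have plus: "a ((x + y) # xs) = a (x # xs) + a (y # xs)" if "x \<in> \<Gamma>" "y \<in> \<Gamma>" "xs \<in> secs p" for x y xs
    using lin0[of xs x y 1 1] that by (simp add: closed)
  have rep: "a (x # x # xs) = 0" if "x \<in> \<Gamma>" "x # xs \<in> secs p" for x xs
    using Suc.prems(3)[of "x # x # xs" 0] that by (cases p) auto
  have swap: "a (x # y # xs) = - a (y # x # xs)" if x: "x \<in> \<Gamma>" and y: "y \<in> \<Gamma>" and xs: "y # xs \<in> secs p" for x y xs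
  proof -
    obtain q where q: "p = Suc q" and xs': "xs \<in> secs q" using xs by (cases p) auto
    have 1: "a (z # (x + y) # xs) = a (z # x # xs) + a (z # y # xs)" if "z \<in> \<Gamma>" for z
      using Suc.prems(2)[of "z # x # xs" 1 x y 1 1] that x y xs' q by (simp add: closed)
    have "a ((x + y) # (x + y) # xs) = 0" using rep[of "x + y" xs] x y xs' q by (simp add: closed)
    then have "a (x # y # xs) + a (y # x # xs) = 0"
      using plus[of x y "(x + y) # xs"] 1[of x] 1[of y] rep[of x xs] rep[of y xs] x y xs' q
      by (simp add: closed)
    then show ?thesis by (simp add: eq_neg_iff_add_eq_0)
  qed
  have "alt_form p (contract x a)" if x: "x \<in> \<Gamma>" for x
  proof (rule Suc.IH)
    show "a (x # xs[i := f \<cdot> y + g \<cdot> z]) = f * a (x # xs[i := y]) + g * a (x # xs[i := z])"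
      if "xs \<in> secs p" "i < p" "y \<in> \<Gamma>" "z \<in> \<Gamma>" "f \<in> A" "g \<in> A" for xs i y z f g
      using Suc.prems(2)[of "x # xs" "Suc i" y z f g] that x by simp
    show "a (x # xs) = 0" if "xs \<in> secs p" "Suc i < p" "xs ! i = xs ! Suc i" for xs i
      using Suc.prems(3)[of "x # xs" "Suc i"] that x by simp
    show "a (x # br y y # xs) = 0" if y: "y \<in> \<Gamma>" and xs: "br y y # xs \<in> secs p" for y xs
    proof -
      have "x # xs \<in> secs p" using x xs by (simp add: secs_def)
      then have "a (br y y # x # xs) = 0" using Suc.prems(4)[of y "x # xs"] y by (simp add: closed)
      then show ?thesis using swap[OF x br_\<Gamma>[OF y y] xs] by simp
    qed
  qed (use Suc.prems(1) x in simp)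
  moreover have "a (f \<cdot> x # xs) = f * a (x # xs)" if "f \<in> A" "x \<in> \<Gamma>" "xs \<in> secs p" for f x xs
    using lin0[of xs x x f 0] that by (simp add: closed)
  moreover have "a (br x x # xs) = 0" if "x \<in> \<Gamma>" "xs \<in> secs p" for x xs
    using Suc.prems(4)[of x xs] that by (simp add: closed)
  ultimately show ?case using plus rep by simp
qed simp

end

section \<open>Smooth functions on open subsets of Euclidean space\<close>

lemma C_k_on_subset: "\<lbrakk>C_k_on n k W f; W' \<subseteq> W\<rbrakk> \<Longrightarrow> C_k_on n k W' f"
proof (induction k arbitrary: f)
  case 0
  then show ?case by (auto intro: continuous_on_subset)
next
  case (Suc k)
  then have "\<forall>i<n. \<exists>g. (\<forall>y\<in>W'. ((\<lambda>t. f (y(i := t))) has_real_derivative g y) (at (y i))) \<and> C_k_on n k W' g"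
    by (simp, meson subsetD)
  then show ?case using Suc.prems by (auto intro: continuous_on_subset)
qed

lemma C_k_on_Suc_le: "C_k_on n (Suc k) W f \<Longrightarrow> C_k_on n k W f"
proof (induction k arbitrary: f)
  case (Suc k)
  have "\<exists>g. (\<forall>y\<in>W. ((\<lambda>t. f (y(i := t))) has_real_derivative g y) (at (y i))) \<and> C_k_on n k W g"
    if i: "i < n" for i
    using Suc.prems Suc.IH i by (subst (asm) C_k_on.simps(2)) blast
  then show ?case using Suc.prems by simp
qed simp

lemma C_k_on_const: "C_k_on n k W (\<lambda>y. c)"
proof (induction k arbitrary: c)
  case (Suc k)
  have "\<exists>g. (\<forall>y\<in>W. ((\<lambda>t. c) has_real_derivative g y) (at (y i))) \<and> C_k_on n k W g" for i
    by (rule exI[of _ "\<lambda>y. 0"]) (use Suc in auto)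
  then show ?case by simp
qed simp

lemma C_k_on_add: "\<lbrakk>C_k_on n k W f; C_k_on n k W g\<rbrakk> \<Longrightarrow> C_k_on n k W (\<lambda>y. f y + g y)"
proof (induction k arbitrary: f g)
  case 0
  then show ?case using continuous_on_add[of W f g] by simp
next
  case (Suc k)
  have "\<exists>h. (\<forall>y\<in>W. ((\<lambda>t. f (y(i := t)) + g (y(i := t))) has_real_derivative h y) (at (y i))) \<and> C_k_on n k W h"
    if i: "i < n" for i
  proof -
    obtain f' where f': "\<forall>y\<in>W. ((\<lambda>t. f (y(i := t))) has_real_derivative f' y) (at (y i))" "C_k_on n k W f'"
      using Suc.prems(1) i by auto
    obtain g' where g': "\<forall>y\<in>W. ((\<lambda>t. g (y(i := t))) has_real_derivative g' y) (at (y i))" "C_k_on n k W g'"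
      using Suc.prems(2) i by auto
    show ?thesis
      by (rule exI[of _ "\<lambda>y. f' y + g' y"]) (use f' g' Suc.IH in \<open>auto intro: DERIV_add\<close>)
  qed
  moreover have "continuous_on W (\<lambda>y. f y + g y)"
    using Suc.prems continuous_on_add[of W f g] by simp
  ultimately show ?case by simp
qed

lemma C_k_on_mult: "\<lbrakk>C_k_on n k W f; C_k_on n k W g\<rbrakk> \<Longrightarrow> C_k_on n k W (\<lambda>y. f y * g y)"
proof (induction k arbitrary: f g)
  case 0
  then show ?case using continuous_on_mult[of W f g] by simp
next
  case (Suc k)
  have "\<exists>h. (\<forall>y\<in>W. ((\<lambda>t. f (y(i := t)) * g (y(i := t))) has_real_derivative h y) (at (y i))) \<and> C_k_on n k W h"
    if i: "i < n" for i
  proof -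
    obtain f' where f': "\<forall>y\<in>W. ((\<lambda>t. f (y(i := t))) has_real_derivative f' y) (at (y i))" "C_k_on n k W f'"
      using Suc.prems(1) i by auto
    obtain g' where g': "\<forall>y\<in>W. ((\<lambda>t. g (y(i := t))) has_real_derivative g' y) (at (y i))" "C_k_on n k W g'"
      using Suc.prems(2) i by auto
    have fg: "C_k_on n k W f" "C_k_on n k W g"
      by (rule C_k_on_Suc_le[OF Suc.prems(1)], rule C_k_on_Suc_le[OF Suc.prems(2)])
    have "C_k_on n k W (\<lambda>y. f' y * g y + g' y * f y)"
      by (rule C_k_on_add[OF Suc.IH[OF f'(2) fg(2)] Suc.IH[OF g'(2) fg(1)]])
    moreover have "((\<lambda>t. f (y(i := t)) * g (y(i := t))) has_real_derivative f' y * g y + g' y * f y) (at (y i))"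
      if "y \<in> W" for y
      using DERIV_mult[OF bspec[OF f'(1) that] bspec[OF g'(1) that]] by simp
    ultimately show ?thesis by (intro exI[of _ "\<lambda>y. f' y * g y + g' y * f y"]) simp
  qed
  moreover have "continuous_on W (\<lambda>y. f y * g y)"
    using Suc.prems continuous_on_mult[of W f g] by simp
  ultimately show ?case by simp
qed

lemma C_k_on_compose_real:
  assumes G: "\<And>m t. (G m has_real_derivative G (Suc m) t) (at t)"
  shows "C_k_on n k W h \<Longrightarrow> C_k_on n k W (\<lambda>y. G m (h y))"
proof (induction k arbitrary: m)
  case 0
  have "continuous_on UNIV (G m)" by (rule DERIV_continuous_on[OF has_field_derivative_at_within[OF G]])
  then show ?case using 0 continuous_on_compose2[of UNIV "G m" W h] by simp
next
  case (Suc k)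
  have "\<exists>g. (\<forall>y\<in>W. ((\<lambda>t. G m (h (y(i := t)))) has_real_derivative g y) (at (y i))) \<and> C_k_on n k W g"
    if i: "i < n" for i
  proof -
    obtain h' where h': "\<forall>y\<in>W. ((\<lambda>t. h (y(i := t))) has_real_derivative h' y) (at (y i))" "C_k_on n k W h'"
      using Suc.prems i by auto
    have "C_k_on n k W (\<lambda>y. G (Suc m) (h y) * h' y)"
      using Suc.IH[OF C_k_on_Suc_le[OF Suc.prems]] h'(2) by (rule C_k_on_mult)
    moreover have "((\<lambda>t. G m (h (y(i := t)))) has_real_derivative G (Suc m) (h y) * h' y) (at (y i))"
      if "y \<in> W" for y
      using DERIV_chain2[OF _ bspec[OF h'(1) that], of "G m" "G (Suc m) (h y)"] G[of m "h y"] by simp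
    ultimately show ?thesis by (intro exI[of _ "\<lambda>y. G (Suc m) (h y) * h' y"]) simp
  qed
  moreover have "continuous_on W (\<lambda>y. G m (h y))"
  proof -
    have "continuous_on UNIV (G m)" by (rule DERIV_continuous_on[OF has_field_derivative_at_within[OF G]])
    then show ?thesis using Suc.prems continuous_on_compose2[of UNIV "G m" W h] by simp
  qed
  ultimately show ?case by simp
qed

lemma openin_EuclideanE:
  assumes "openin (Euclidean_space n) W"
  obtains T where "open T" "W = T \<inter> {x. \<forall>i\<ge>n. x i = 0}"
proof -
  have "\<exists>T. openin euclidean T \<and> W = T \<inter> {x. \<forall>i\<ge>n. x i = 0}"
    using assms unfolding Euclidean_space_def euclidean_product_topology openin_subtopology .
  then show thesis using that unfolding open_openin[symmetric] by (elim exE conjE)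
qed

lemma openin_Euclidean_slice:
  assumes W: "openin (Euclidean_space n) W" and y: "y \<in> W" and i: "i < n"
  shows "eventually (\<lambda>t. y(i := t) \<in> W) (nhds (y i))"
proof -
  obtain T where T: "open T" "W = T \<inter> {x. \<forall>i\<ge>n. x i = 0}"
    using W by (rule openin_EuclideanE)
  have cont: "continuous_on UNIV (\<lambda>t. y(i := t))"
  proof (rule continuous_on_coordinatewise_then_product)
    show "continuous_on UNIV (\<lambda>t. (y(i := t)) j)" for j by (cases "j = i") simp_all
  qed
  have "eventually (\<lambda>t. t \<in> (\<lambda>t. y(i := t)) -` T) (nhds (y i))"
    by (rule eventually_nhds_in_open[OF open_vimage[OF T(1) cont]]) (use y T(2) in simp)
  then show ?thesis by (rule eventually_mono) (use y i T(2) in simp)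
qed

text \<open>
  Partial derivatives at \<open>y\<close> see the function along lines through \<open>y\<close>, and these remain in a relatively
  open set for a short time.
\<close>

lemma C_k_on_cong:
  assumes W: "openin (Euclidean_space n) W" and eq: "\<And>y. y \<in> W \<Longrightarrow> f y = g y" and g: "C_k_on n k W g"
  shows "C_k_on n k W f"
proof -
  have c: "continuous_on W f" if "continuous_on W g"
    using continuous_on_eq[OF that] eq by metis
  show ?thesis
  proof (cases k)
    case 0
    then show ?thesis using g c by simp
  next
    case (Suc l)
    have "\<exists>h. (\<forall>y\<in>W. ((\<lambda>t. f (y(i := t))) has_real_derivative h y) (at (y i))) \<and> C_k_on n l W h"
      if i: "i < n" for i
    proof -
      obtain h where h: "\<forall>y\<in>W. ((\<lambda>t. g (y(i := t))) has_real_derivative h y) (at (y i))" "C_k_on n l W h"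
        using g i unfolding Suc by auto
      have "((\<lambda>t. f (y(i := t))) has_real_derivative h y) (at (y i))" if y: "y \<in> W" for y
      proof -
        have "eventually (\<lambda>t. f (y(i := t)) = g (y(i := t))) (nhds (y i))"
          by (rule eventually_mono[OF openin_Euclidean_slice[OF W y i]]) (rule eq)
        then show ?thesis
          using DERIV_cong_ev[of "y i" "y i" "\<lambda>t. f (y(i := t))" "\<lambda>t. g (y(i := t))" "h y" "h y"] h(1) y by simp
      qed
      then show ?thesis using h(2) by (intro exI[of _ h]) simp
    qed
    then show ?thesis using g c unfolding Suc by simp
  qed
qed

lemma continuous_on_Un_Euclidean:
  fixes f :: "(nat \<Rightarrow> real) \<Rightarrow> real"
  assumes W: "openin (Euclidean_space n) W1" "openin (Euclidean_space n) W2"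
    and f: "continuous_on W1 f" "continuous_on W2 f"
  shows "continuous_on (W1 \<union> W2) f"
proof -
  obtain T1 where T1: "open T1" "W1 = T1 \<inter> {x. \<forall>i\<ge>n. x i = 0}" using W(1) by (rule openin_EuclideanE)
  obtain T2 where T2: "open T2" "W2 = T2 \<inter> {x. \<forall>i\<ge>n. x i = 0}" using W(2) by (rule openin_EuclideanE)
  have "W1 = (W1 \<union> W2) \<inter> T1" "W2 = (W1 \<union> W2) \<inter> T2" unfolding T1(2) T2(2) by auto
  then have "openin (top_of_set (W1 \<union> W2)) W1" "openin (top_of_set (W1 \<union> W2)) W2"
    using openin_open_Int[OF T1(1), of "W1 \<union> W2"] openin_open_Int[OF T2(1), of "W1 \<union> W2"] by simp_all
  then show ?thesis using f by (rule continuous_on_Un_local_open)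
qed

text \<open>
  Smoothness is local.  The partial derivatives on the two sets agree on the overlap by uniqueness of
  derivatives, so they can be glued.
\<close>

lemma C_k_on_Un:
  assumes W: "openin (Euclidean_space n) W1" "openin (Euclidean_space n) W2"
  shows "\<lbrakk>C_k_on n k W1 f; C_k_on n k W2 f\<rbrakk> \<Longrightarrow> C_k_on n k (W1 \<union> W2) f"
proof (induction k arbitrary: f)
  case 0
  then show ?case using continuous_on_Un_Euclidean[OF W] by simp
next
  case (Suc k)
  have "continuous_on (W1 \<union> W2) f" using Suc.prems continuous_on_Un_Euclidean[OF W] by simp
  moreover have "\<exists>h. (\<forall>y\<in>W1 \<union> W2. ((\<lambda>t. f (y(i := t))) has_real_derivative h y) (at (y i))) \<and> C_k_on n k (W1 \<union> W2) h"
    if i: "i < n" for i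
  proof -
    obtain g1 where g1: "\<forall>y\<in>W1. ((\<lambda>t. f (y(i := t))) has_real_derivative g1 y) (at (y i))" "C_k_on n k W1 g1"
      using Suc.prems(1) i by auto
    obtain g2 where g2: "\<forall>y\<in>W2. ((\<lambda>t. f (y(i := t))) has_real_derivative g2 y) (at (y i))" "C_k_on n k W2 g2"
      using Suc.prems(2) i by auto
    define h where "h = (\<lambda>y. if y \<in> W1 then g1 y else g2 y)"
    have h1: "h y = g1 y" if "y \<in> W1" for y using that by (simp add: h_def)
    have h2: "h y = g2 y" if "y \<in> W2" for y
    proof (cases "y \<in> W1")
      case True
      then show ?thesis using DERIV_unique[OF bspec[OF g1(1) True] bspec[OF g2(1) that]] h1 by simp
    qed (simp add: h_def)
    have "C_k_on n k (W1 \<union> W2) h"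
      using C_k_on_cong[OF W(1) h1 g1(2)] C_k_on_cong[OF W(2) h2 g2(2)] by (rule Suc.IH)
    moreover have "((\<lambda>t. f (y(i := t))) has_real_derivative h y) (at (y i))" if "y \<in> W1 \<union> W2" for y
    proof (cases "y \<in> W1")
      case True
      then show ?thesis using bspec[OF g1(1) True] h1 by simp
    next
      case False
      then have "y \<in> W2" using that by simp
      then show ?thesis using bspec[OF g2(1), of y] h2 by simp
    qed
    ultimately show ?thesis by (intro exI[of _ h]) simp
  qed
  ultimately show ?case by simp
qed

section \<open>A smooth function that is flat at the origin\<close>

text \<open>
  The functions $p(1/t)\,e^{-1/t}$, extended by \<open>0\<close> to $t\le 0$.  The class is closed under
  differentiation: $p$ is replaced by $X^2(p-p')$.
\<close>

definition flat :: "real poly \<Rightarrow> real \<Rightarrow> real" where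
  "flat p t = (if t > 0 then poly p (inverse t) * exp (- inverse t) else 0)"

lemma tendsto_poly_div_exp: "((\<lambda>x::real. poly p x * exp (- x)) \<longlongrightarrow> 0) at_top"
proof -
  have "((\<lambda>x::real. \<Sum>i\<le>degree p. coeff p i * (x ^ i / exp x)) \<longlongrightarrow> (\<Sum>i\<le>degree p. coeff p i * 0)) at_top"
    by (intro tendsto_intros tendsto_power_div_exp_0)
  moreover have "(\<Sum>i\<le>degree p. coeff p i * (x ^ i / exp x)) = poly p x * exp (- x)" for x
    unfolding poly_altdef sum_distrib_right exp_minus divide_inverse by (simp only: mult.assoc)
  ultimately show ?thesis by simp
qed

lemma flat_has_derivative:
  "(flat p has_real_derivative flat ([:0, 0, 1:] * (p - pderiv p)) t) (at t)"
proof -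
  consider "t > 0" | "t < 0" | "t = 0" by linarith
  then show ?thesis
  proof cases
    case 1
    have "((\<lambda>t. poly p (inverse t) * exp (- inverse t)) has_real_derivative
        flat ([:0, 0, 1:] * (p - pderiv p)) t) (at t)"
      using DERIV_mult[OF DERIV_chain2[OF poly_DERIV[of p "inverse t"] DERIV_inverse] DERIV_chain2[OF DERIV_exp DERIV_minus[OF DERIV_inverse]]] 1
      by (simp add: flat_def algebra_simps)
    moreover have "eventually (\<lambda>s. flat p s = poly p (inverse s) * exp (- inverse s)) (nhds t)"
      using eventually_nhds_in_open[of "{0<..}" t] 1 by (auto simp: flat_def elim!: eventually_mono)
    ultimately show ?thesis using DERIV_cong_ev[of t t "flat p" "\<lambda>t. poly p (inverse t) * exp (- inverse t)"] by simp
  next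
    case 2
    have "eventually (\<lambda>s. flat p s = 0) (nhds t)"
      using eventually_nhds_in_open[of "{..<0}" t] 2 by (auto simp: flat_def elim!: eventually_mono)
    then have "(flat p has_real_derivative 0) (at t)"
      using DERIV_cong_ev[of t t "flat p" "\<lambda>t. 0" 0 0] by simp
    then show ?thesis using 2 by (simp add: flat_def)
  next
    case 3
    have "((\<lambda>h. flat p h / h) \<longlongrightarrow> 0) (at_left 0)"
      by (rule tendsto_eventually) (auto simp: flat_def eventually_at_left_field intro!: exI[of _ "-1"])
    moreover have "((\<lambda>h. flat p h / h) \<longlongrightarrow> 0) (at_right 0)"
    proof -
      have "((\<lambda>h. poly ([:0, 1:] * p) (inverse h) * exp (- inverse h)) \<longlongrightarrow> 0) (at_right (0::real))"
        by (rule filterlim_compose[OF tendsto_poly_div_exp filterlim_inverse_at_top_right])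
      moreover have "eventually (\<lambda>h. poly ([:0, 1:] * p) (inverse h) * exp (- inverse h) = flat p h / h) (at_right 0)"
        by (auto simp: flat_def eventually_at_right_field field_simps intro!: exI[of _ 1])
      ultimately show ?thesis by (rule Lim_transform_eventually)
    qed
    ultimately have "((\<lambda>h. flat p h / h) \<longlongrightarrow> 0) (at 0)"
      by (simp add: filterlim_split_at)
    then show ?thesis using 3 by (simp add: DERIV_def flat_def)
  qed
qed

definition flat_derivs :: "nat \<Rightarrow> real \<Rightarrow> real" where
  "flat_derivs m = flat (((\<lambda>p. [:0, 0, 1:] * (p - pderiv p)) ^^ m) 1)"

lemma flat_derivs: "(flat_derivs m has_real_derivative flat_derivs (Suc m) t) (at t)"
  using flat_has_derivative by (simp add: flat_derivs_def)

lemma flat_derivs_0: "flat_derivs 0 t = (if t > 0 then exp (- inverse t) else 0)"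
  by (simp add: flat_derivs_def flat_def)

section \<open>Smooth functions on manifolds and bump functions\<close>

lemma smooth_on_mfdI:
  assumes "\<And>U \<phi> k. (U, \<phi>) \<in> charts M \<Longrightarrow> C_k_on (mdim M) k (\<phi> ` (U \<inter> S)) (\<lambda>y. f (inv_into U \<phi> y))"
  shows "smooth_on_mfd M S f"
  using assms by (auto simp: smooth_on_mfd_def C_inf_on_def comp_def)

lemma smooth_on_mfdD:
  assumes "smooth_on_mfd M S f" "(U, \<phi>) \<in> charts M"
  shows "C_k_on (mdim M) k (\<phi> ` (U \<inter> S)) (\<lambda>y. f (inv_into U \<phi> y))"
  using assms by (auto simp: smooth_on_mfd_def C_inf_on_def comp_def)

lemma smooth_on_mfd_subset:
  assumes "smooth_on_mfd M S f" "S' \<subseteq> S"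
  shows "smooth_on_mfd M S' f"
proof (rule smooth_on_mfdI)
  fix U \<phi> k assume c: "(U, \<phi>) \<in> charts M"
  have "\<phi> ` (U \<inter> S') \<subseteq> \<phi> ` (U \<inter> S)" using assms(2) by (intro image_mono Int_mono) simp_all
  then show "C_k_on (mdim M) k (\<phi> ` (U \<inter> S')) (\<lambda>y. f (inv_into U \<phi> y))"
    by (rule C_k_on_subset[OF smooth_on_mfdD[OF assms(1) c]])
qed

lemma smooth_on_mfd_const: "smooth_on_mfd M S (\<lambda>x. c)"
  by (rule smooth_on_mfdI) (rule C_k_on_const)

lemma smooth_on_mfd_add:
  assumes "smooth_on_mfd M S f" "smooth_on_mfd M S g"
  shows "smooth_on_mfd M S (\<lambda>x. f x + g x)"
  by (rule smooth_on_mfdI) (rule C_k_on_add[OF smooth_on_mfdD[OF assms(1)] smooth_on_mfdD[OF assms(2)]])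

lemma smooth_on_mfd_mult:
  assumes "smooth_on_mfd M S f" "smooth_on_mfd M S g"
  shows "smooth_on_mfd M S (\<lambda>x. f x * g x)"
  by (rule smooth_on_mfdI) (rule C_k_on_mult[OF smooth_on_mfdD[OF assms(1)] smooth_on_mfdD[OF assms(2)]])

lemma smooth_on_mfd_sum:
  assumes "\<And>i. i < (n::nat) \<Longrightarrow> smooth_on_mfd M S (f i)"
  shows "smooth_on_mfd M S (\<lambda>x. \<Sum>i<n. f i x)"
  using assms
proof (induction n)
  case 0
  then show ?case by (simp add: smooth_on_mfd_const)
next
  case (Suc n)
  then show ?case using smooth_on_mfd_add[of M S "\<lambda>x. \<Sum>i<n. f i x" "f n"] by simp
qed

lemma smooth_on_mfd_compose_real:
  assumes "\<And>m t. (G m has_real_derivative G (Suc m) t) (at t)" "smooth_on_mfd M S f"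
  shows "smooth_on_mfd M S (\<lambda>x. G m (f x))"
  by (rule smooth_on_mfdI) (rule C_k_on_compose_real[of G, OF assms(1) smooth_on_mfdD[OF assms(2)]])

lemma chart_homeo:
  assumes "smooth_manifold M" "(U, \<phi>) \<in> charts M"
  shows "open U" "openin (Euclidean_space (mdim M)) (\<phi> ` U)"
    "homeomorphic_map (top_of_set U) (subtopology (Euclidean_space (mdim M)) (\<phi> ` U)) \<phi>"
  using assms unfolding smooth_manifold_def by fast+

lemma chart_inj:
  assumes "smooth_manifold M" "(U, \<phi>) \<in> charts M"
  shows "inj_on \<phi> U"
  using homeomorphic_imp_injective_map[OF chart_homeo(3)[OF assms]] by simp

lemma chart_image_openin:
  assumes M: "smooth_manifold M" "(U, \<phi>) \<in> charts M" and S: "open S"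
  shows "openin (Euclidean_space (mdim M)) (\<phi> ` (U \<inter> S))"
proof -
  have "openin (top_of_set U) (U \<inter> S)" using S by (rule openin_open_Int)
  then have "openin (subtopology (Euclidean_space (mdim M)) (\<phi> ` U)) (\<phi> ` (U \<inter> S))"
    using homeomorphic_imp_open_map[OF chart_homeo(3)[OF M]] by (simp add: open_map_def)
  then show ?thesis using chart_homeo(2)[OF M] by (rule openin_trans_full)
qed

lemma inv_into_chart:
  assumes "smooth_manifold M" "(U, \<phi>) \<in> charts M" "y \<in> \<phi> ` (U \<inter> S)"
  shows "inv_into U \<phi> y \<in> U \<inter> S"
  using assms(3) inv_into_f_f[OF chart_inj[OF assms(1,2)]] by force

lemma smooth_on_mfd_cong:
  assumes M: "smooth_manifold M" and S: "open S" and eq: "\<And>x. x \<in> S \<Longrightarrow> f x = g x"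
    and g: "smooth_on_mfd M S g"
  shows "smooth_on_mfd M S f"
proof (rule smooth_on_mfdI)
  fix U \<phi> k assume c: "(U, \<phi>) \<in> charts M"
  show "C_k_on (mdim M) k (\<phi> ` (U \<inter> S)) (\<lambda>y. f (inv_into U \<phi> y))"
  proof (rule C_k_on_cong[OF chart_image_openin[OF M c S] _ smooth_on_mfdD[OF g c]])
    fix y assume "y \<in> \<phi> ` (U \<inter> S)"
    then have "inv_into U \<phi> y \<in> U \<inter> S" by (rule inv_into_chart[OF M c])
    then show "f (inv_into U \<phi> y) = g (inv_into U \<phi> y)" using eq by simp
  qed
qed

lemma smooth_on_mfd_Un:
  assumes M: "smooth_manifold M" and S: "open S1" "open S2"
    and f: "smooth_on_mfd M S1 f" "smooth_on_mfd M S2 f"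
  shows "smooth_on_mfd M (S1 \<union> S2) f"
proof (rule smooth_on_mfdI)
  fix U \<phi> k assume c: "(U, \<phi>) \<in> charts M"
  show "C_k_on (mdim M) k (\<phi> ` (U \<inter> (S1 \<union> S2))) (\<lambda>y. f (inv_into U \<phi> y))"
    unfolding Int_Un_distrib image_Un
    by (rule C_k_on_Un[OF chart_image_openin[OF M c S(1)] chart_image_openin[OF M c S(2)]
          smooth_on_mfdD[OF f(1) c] smooth_on_mfdD[OF f(2) c]])
qed

lemma smooth_on_mfd_coordinate:
  assumes M: "smooth_manifold M" and V: "(V, \<psi>) \<in> charts M" and i: "i < mdim M"
  shows "smooth_on_mfd M V (\<lambda>x. \<psi> x i)"
proof (rule smooth_on_mfdI)
  fix U \<phi> k assume "(U, \<phi>) \<in> charts M"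
  then have "C_inf_on (mdim M) (\<phi> ` (U \<inter> V)) (\<lambda>y. \<psi> (inv_into U \<phi> y) i)"
    using M V i unfolding smooth_manifold_def by fast
  then show "C_k_on (mdim M) k (\<phi> ` (U \<inter> V)) (\<lambda>y. \<psi> (inv_into U \<phi> y) i)"
    by (simp add: C_inf_on_def)
qed

text \<open>
  Boxes play the role of closed balls, because they are products and Tychonoff's theorem applies.
\<close>

lemma compact_box_Euclidean: "compact {z :: nat \<Rightarrow> real. (\<forall>i\<ge>n. z i = 0) \<and> (\<forall>i<n. \<bar>z i - c i\<bar> \<le> r)}"
proof -
  have "compactin (powertop_real UNIV) (PiE UNIV (\<lambda>i. if i < n then cball (c i) r else {0}))"
    unfolding compactin_PiE by simp
  moreover have "PiE UNIV (\<lambda>i. if i < n then cball (c i) r else {0})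
      = {z. (\<forall>i\<ge>n. z i = 0) \<and> (\<forall>i<n. \<bar>z i - c i\<bar> \<le> r)}"
  proof (intro set_eqI iffI)
    fix z assume z: "z \<in> PiE UNIV (\<lambda>i. if i < n then cball (c i) r else {0})"
    then have "z i \<in> (if i < n then cball (c i) r else {0})" for i by (simp add: PiE_def Pi_def)
    then show "z \<in> {z. (\<forall>i\<ge>n. z i = 0) \<and> (\<forall>i<n. \<bar>z i - c i\<bar> \<le> r)}"
      by (smt (verit, best) dist_real_def insert_iff mem_Collect_eq mem_cball singletonD linorder_not_le)
  next
    fix z assume "z \<in> {z. (\<forall>i\<ge>n. z i = 0) \<and> (\<forall>i<n. \<bar>z i - c i\<bar> \<le> r)}"
    then show "z \<in> PiE UNIV (\<lambda>i. if i < n then cball (c i) r else {0})"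
      by (auto simp: dist_real_def abs_minus_commute)
  qed
  ultimately show ?thesis by (simp add: euclidean_product_topology)
qed

lemma openin_Euclidean_contains_box:
  assumes "openin (Euclidean_space n) W" and c: "c \<in> W"
  obtains r where "r > 0" "{z. (\<forall>i\<ge>n. z i = 0) \<and> (\<forall>i<n. \<bar>z i - c i\<bar> \<le> r)} \<subseteq> W"
proof -
  obtain T where T: "open T" "W = T \<inter> {x. \<forall>i\<ge>n. x i = 0}"
    using assms(1) by (rule openin_EuclideanE)
  have "openin (powertop_real UNIV) T" using T(1) by (simp add: euclidean_product_topology)
  then obtain X where X: "c \<in> PiE UNIV X" "\<And>i. openin euclidean (X i)" "PiE UNIV X \<subseteq> T"
    using product_topology_open_contains_basis[of "\<lambda>i. euclidean" UNIV T c] c T(2) by auto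
  have "\<exists>e>0. cball (c i) e \<subseteq> X i" for i
  proof -
    have "open (X i)" "c i \<in> X i" using X(1,2) by (auto simp: PiE_def Pi_def)
    then show ?thesis by (simp add: open_contains_cball)
  qed
  then obtain e where e: "\<And>i. e i > 0" "\<And>i. cball (c i) (e i) \<subseteq> X i" by metis
  define r where "r = Min (insert 1 (e ` {..<n}))"
  have "r > 0" unfolding r_def using e(1) by (simp add: Min_gr_iff)
  moreover have "{z. (\<forall>i\<ge>n. z i = 0) \<and> (\<forall>i<n. \<bar>z i - c i\<bar> \<le> r)} \<subseteq> W"
  proof
    fix z assume "z \<in> {z. (\<forall>i\<ge>n. z i = 0) \<and> (\<forall>i<n. \<bar>z i - c i\<bar> \<le> r)}"
    then have z: "\<And>i. i \<ge> n \<Longrightarrow> z i = 0" "\<And>i. i < n \<Longrightarrow> \<bar>z i - c i\<bar> \<le> r" by auto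
    have "z i \<in> X i" for i
    proof (cases "i < n")
      case True
      then have "r \<le> e i" unfolding r_def by (intro Min_le) auto
      then have "z i \<in> cball (c i) (e i)" using z(2)[OF True] by (simp add: dist_real_def abs_minus_commute)
      then show ?thesis using e(2) by blast
    next
      case False
      then have "z i = c i" using z(1) c T(2) by simp
      then show ?thesis using X(1) by (simp add: PiE_def Pi_def)
    qed
    then have "z \<in> PiE UNIV X" by (simp add: PiE_def Pi_def)
    then have "z \<in> T" using X(3) by blast
    then show "z \<in> W" using z(1) T(2) by simp
  qed
  ultimately show thesis by (rule that)
qed

text \<open>
  In a chart around \<open>x\<close> take $e^{-1/s}$ with $s = r^2-|\psi-c|^2$, and extend it by \<open>0\<close>.  The extension is
  smooth because the preimage \<open>K\<close> of a box is compact and hence, in a Hausdorff space, closed: on the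
  open complement of \<open>K\<close> the function is \<open>0\<close>.
\<close>

lemma smooth_bump:
  fixes M :: "('m::{t2_space,second_countable_topology}, 'x) manifold_scheme"
  assumes M: "smooth_manifold M" and W: "open W" and x: "x \<in> W"
  obtains h K where "h \<in> smooth_functions M" "h x = 1" "closed K" "K \<subseteq> W" "\<And>y. y \<notin> K \<Longrightarrow> h y = 0"
proof -
  have "x \<in> (\<Union>(U, \<phi>)\<in>charts M. U)" using M by (simp add: smooth_manifold_def)
  then obtain V \<psi> where V: "(V, \<psi>) \<in> charts M" "x \<in> V" by blast
  define n where "n = mdim M"
  define c where "c = \<psi> x"
  have cm: "c \<in> \<psi> ` (V \<inter> W)" unfolding c_def using V(2) x by (intro imageI IntI)
  obtain r where r: "r > 0"
    and box: "{z. (\<forall>i\<ge>n. z i = 0) \<and> (\<forall>i<n. \<bar>z i - c i\<bar> \<le> r)} \<subseteq> \<psi> ` (V \<inter> W)" (is "?Q \<subseteq> _")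
    using chart_image_openin[OF M V(1) W, folded n_def] cm by (rule openin_Euclidean_contains_box)
  obtain v where v: "homeomorphic_maps (top_of_set V) (subtopology (Euclidean_space n) (\<psi> ` V)) \<psi> v"
    using chart_homeo(3)[OF M V(1)] unfolding homeomorphic_map_maps n_def by (elim exE)
  have inv: "v (\<psi> y) = y" if "y \<in> V" for y
    using v that unfolding homeomorphic_maps_def by simp
  have "continuous_map (subtopology (Euclidean_space n) (\<psi> ` V)) (top_of_set V) v"
    using v unfolding homeomorphic_maps_def by (elim conjE)
  then have cont: "continuous_map (subtopology (Euclidean_space n) (\<psi> ` V)) euclidean v"
    unfolding continuous_map_in_subtopology by (rule conjunct1)
  define K where "K = v ` ?Q"
  have "compactin euclidean ?Q" using compact_box_Euclidean[of n c r] by simp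
  moreover have "?Q \<subseteq> \<psi> ` V" using box by (rule order_trans) (intro image_mono Int_lower1)
  moreover have "?Q \<subseteq> {x. \<forall>i\<ge>n. x i = 0}" by (rule Collect_mono) simp
  ultimately have "compactin (subtopology (Euclidean_space n) (\<psi> ` V)) ?Q"
    unfolding Euclidean_space_def subtopology_subtopology euclidean_product_topology compactin_subtopology
    by simp
  from image_compactin[OF this cont] have "compact K" by (simp add: K_def)
  then have clK: "closed K" by (rule compact_imp_closed)
  have KVW: "K \<subseteq> V \<inter> W"
  proof
    fix y assume "y \<in> K"
    then obtain z where z: "z \<in> ?Q" "y = v z" unfolding K_def by (elim imageE)
    then obtain w where "w \<in> V \<inter> W" "z = \<psi> w" using subsetD[OF box z(1)] by (elim imageE)
    then show "y \<in> V \<inter> W" using inv z(2) by simp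
  qed
  define g where "g = (\<lambda>y. r\<^sup>2 - (\<Sum>i<n. (\<psi> y i - c i) * (\<psi> y i - c i)))"
  define b where "b = (\<lambda>y. if y \<in> V then flat_derivs 0 (g y) else 0)"
  have bK: "b y = 0" if y: "y \<notin> K" for y
  proof (cases "y \<in> V")
    case True
    have top: "\<psi> y i = 0" if "i \<ge> n" for i
      using subsetD[OF openin_subset[OF chart_homeo(2)[OF M V(1)]] imageI[OF True]] that
      by (simp add: topspace_Euclidean_space n_def)
    have "\<psi> y \<notin> ?Q"
    proof
      assume "\<psi> y \<in> ?Q"
      then have "v (\<psi> y) \<in> K" unfolding K_def by (rule imageI)
      then show False using y inv[OF True] by simp
    qed
    then obtain j where j: "j < n" "r < \<bar>\<psi> y j - c j\<bar>" using top by (auto simp: not_le)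
    have "r\<^sup>2 \<le> \<bar>\<psi> y j - c j\<bar>\<^sup>2" using j(2) r by (intro power_mono) auto
    also have "\<dots> = (\<psi> y j - c j) * (\<psi> y j - c j)" by (simp add: power2_eq_square)
    also have "\<dots> \<le> (\<Sum>i<n. (\<psi> y i - c i) * (\<psi> y i - c i))"
      using j(1) by (intro member_le_sum) auto
    finally have "g y \<le> 0" by (simp add: g_def)
    then show ?thesis by (simp add: b_def flat_derivs_0)
  qed (simp add: b_def)
  have diff: "smooth_on_mfd M V (\<lambda>y. \<psi> y i - c i)" if "i < n" for i
    using smooth_on_mfd_add[OF smooth_on_mfd_coordinate[OF M V(1)] smooth_on_mfd_const, of i "- c i"] that
    by (simp add: n_def)
  have "smooth_on_mfd M V (\<lambda>y. r\<^sup>2 + (- 1) * (\<Sum>i<n. (\<psi> y i - c i) * (\<psi> y i - c i)))"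
    by (rule smooth_on_mfd_add[OF smooth_on_mfd_const smooth_on_mfd_mult[OF smooth_on_mfd_const smooth_on_mfd_sum]])
      (rule smooth_on_mfd_mult[OF diff diff])
  then have "smooth_on_mfd M V g" by (simp add: g_def)
  then have "smooth_on_mfd M V (\<lambda>y. flat_derivs 0 (g y))"
    by (rule smooth_on_mfd_compose_real[of flat_derivs, OF flat_derivs])
  then have s1: "smooth_on_mfd M V b"
    by (rule smooth_on_mfd_cong[OF M chart_homeo(1)[OF M V(1)], rotated]) (simp add: b_def)
  have s2: "smooth_on_mfd M (- K) b"
    using smooth_on_mfd_const[of M "- K" 0] clK
    by (rule smooth_on_mfd_cong[OF M open_Compl, rotated 2]) (simp add: bK)
  have "V \<union> - K = UNIV" using KVW by blast
  then have s: "smooth_on_mfd M UNIV b"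
    using smooth_on_mfd_Un[OF M chart_homeo(1)[OF M V(1)] _ s1 s2] clK by (simp add: open_Compl)
  have bx: "b x > 0" using V(2) r by (simp add: b_def g_def c_def flat_derivs_0)
  show thesis
  proof (rule that[of "\<lambda>y. (1 / b x) * b y" K])
    show "(\<lambda>y. (1 / b x) * b y) \<in> smooth_functions M"
      unfolding smooth_functions_def using smooth_on_mfd_mult[OF smooth_on_mfd_const s] by blast
  qed (use bx clK KVW bK in simp_all)
qed

section \<open>Smooth sections and locality of tensorial maps\<close>

lemma frameD:
  assumes "smooth_vector_bundle E" "(U, r, e) \<in> frames E"
  shows "open U"
    and "x \<in> U \<Longrightarrow> inj_on (\<lambda>i. e i x) {..<r}"
    and "x \<in> U \<Longrightarrow> independent ((\<lambda>i. e i x) ` {..<r})"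
    and "x \<in> U \<Longrightarrow> span ((\<lambda>i. e i x) ` {..<r}) = fibre E x"
  using assms unfolding smooth_vector_bundle_def by fast+

lemma bundle_manifold: "smooth_vector_bundle E \<Longrightarrow> smooth_manifold E"
  and bundle_fibre: "smooth_vector_bundle E \<Longrightarrow> subspace (fibre E x)"
  by (simp_all add: smooth_vector_bundle_def)

lemma frame_at:
  assumes "smooth_vector_bundle E"
  obtains U r e where "(U, r, e) \<in> frames E" "x \<in> U"
proof -
  have "x \<in> (\<Union>(U, r, e)\<in>frames E. U)" using assms by (simp add: smooth_vector_bundle_def)
  then show thesis using that by blast
qed

lemma frame_vector: "\<lbrakk>smooth_vector_bundle E; (U, r, e) \<in> frames E; x \<in> U; j < r\<rbrakk> \<Longrightarrow> e j x \<in> fibre E x"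
  using frameD(4)[of E U r e x] span_base[of "e j x" "(\<lambda>i. e i x) ` {..<r}"] by simp

lemma frame_coord_linear:
  assumes E: "smooth_vector_bundle E" and fr: "(U, r, e) \<in> frames E" "x \<in> U"
    and "u \<in> fibre E x" "v \<in> fibre E x"
  shows "frame_coord r e i x (u + v) = frame_coord r e i x u + frame_coord r e i x v"
    and "frame_coord r e i x (c *\<^sub>R u) = c * frame_coord r e i x u"
  using representation_add[OF frameD(3)[OF E fr], of v u] representation_scale[OF frameD(3)[OF E fr], of u c]
    assms(4,5) frameD(4)[OF E fr] by (simp_all add: frame_coord_def)

lemma frame_coord_zero: "frame_coord r e i x 0 = 0"
  by (simp add: frame_coord_def representation_zero)

lemma frame_expansion:
  assumes E: "smooth_vector_bundle E" and fr: "(U, r, e) \<in> frames E" "x \<in> U"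
    and v: "v \<in> fibre E x"
  shows "(\<Sum>i<r. frame_coord r e i x v *\<^sub>R e i x) = v"
proof -
  let ?B = "(\<lambda>i. e i x) ` {..<r}"
  have "(\<Sum>b\<in>?B. representation ?B v b *\<^sub>R b) = v"
    by (rule sum_representation_eq[OF frameD(3)[OF E fr]]) (use v frameD(4)[OF E fr] in simp_all)
  then show ?thesis
    using sum.reindex[OF frameD(2)[OF E fr], of "\<lambda>b. representation ?B v b *\<^sub>R b"]
    by (simp add: frame_coord_def)
qed

lemma smooth_sectionsI:
  assumes "\<And>x. \<psi> x \<in> fibre E x"
    and "\<And>U r e i. (U, r, e) \<in> frames E \<Longrightarrow> i < r \<Longrightarrow> smooth_on_mfd E U (\<lambda>x. frame_coord r e i x (\<psi> x))"
  shows "\<psi> \<in> smooth_sections E"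
  unfolding smooth_sections_def using assms by fast

lemma smooth_sectionsD:
  assumes "\<psi> \<in> smooth_sections E"
  shows "\<psi> x \<in> fibre E x"
    and "(U, r, e) \<in> frames E \<Longrightarrow> i < r \<Longrightarrow> smooth_on_mfd E U (\<lambda>x. frame_coord r e i x (\<psi> x))"
  using assms unfolding smooth_sections_def by fast+

lemma smooth_functions_const: "(\<lambda>x. c) \<in> smooth_functions M"
  and smooth_functions_add:
    "\<lbrakk>f \<in> smooth_functions M; g \<in> smooth_functions M\<rbrakk> \<Longrightarrow> (\<lambda>x. f x + g x) \<in> smooth_functions M"
  and smooth_functions_mult:
    "\<lbrakk>f \<in> smooth_functions M; g \<in> smooth_functions M\<rbrakk> \<Longrightarrow> (\<lambda>x. f x * g x) \<in> smooth_functions M"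
  by (simp_all add: smooth_functions_def smooth_on_mfd_const smooth_on_mfd_add smooth_on_mfd_mult)

lemma smooth_functions_on: "f \<in> smooth_functions M \<Longrightarrow> smooth_on_mfd M S f"
  using smooth_on_mfd_subset[of M UNIV f S] by (simp add: smooth_functions_def)

lemma smooth_sections_zero:
  assumes E: "smooth_vector_bundle E"
  shows "(\<lambda>x. 0) \<in> smooth_sections E"
  by (rule smooth_sectionsI)
    (simp_all add: subspace_0[OF bundle_fibre[OF E]] frame_coord_zero smooth_on_mfd_const)

lemma smooth_sections_add:
  assumes E: "smooth_vector_bundle E" and s: "\<phi> \<in> smooth_sections E" "\<psi> \<in> smooth_sections E"
  shows "(\<lambda>x. \<phi> x + \<psi> x) \<in> smooth_sections E"
proof (rule smooth_sectionsI)
  show "\<phi> x + \<psi> x \<in> fibre E x" for x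
    by (rule subspace_add[OF bundle_fibre[OF E] smooth_sectionsD(1)[OF s(1)] smooth_sectionsD(1)[OF s(2)]])
  fix U r e i assume fr: "(U, r, e) \<in> frames E" and i: "i < r"
  show "smooth_on_mfd E U (\<lambda>x. frame_coord r e i x (\<phi> x + \<psi> x))"
    by (rule smooth_on_mfd_cong[OF bundle_manifold[OF E] frameD(1)[OF E fr] _
          smooth_on_mfd_add[OF smooth_sectionsD(2)[OF s(1) fr i] smooth_sectionsD(2)[OF s(2) fr i]]])
      (rule frame_coord_linear(1)[OF E fr _ smooth_sectionsD(1)[OF s(1)] smooth_sectionsD(1)[OF s(2)]])
qed

lemma smooth_sections_scale:
  assumes E: "smooth_vector_bundle E" and f: "f \<in> smooth_functions E" and s: "\<psi> \<in> smooth_sections E"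
  shows "(\<lambda>x. f x *\<^sub>R \<psi> x) \<in> smooth_sections E"
proof (rule smooth_sectionsI)
  show "f x *\<^sub>R \<psi> x \<in> fibre E x" for x
    by (rule subspace_scale[OF bundle_fibre[OF E] smooth_sectionsD(1)[OF s]])
  fix U r e i assume fr: "(U, r, e) \<in> frames E" and i: "i < r"
  show "smooth_on_mfd E U (\<lambda>x. frame_coord r e i x (f x *\<^sub>R \<psi> x))"
    by (rule smooth_on_mfd_cong[OF bundle_manifold[OF E] frameD(1)[OF E fr] _
          smooth_on_mfd_mult[OF smooth_functions_on[OF f] smooth_sectionsD(2)[OF s fr i]]])
      (rule frame_coord_linear(2)[OF E fr _ smooth_sectionsD(1)[OF s] smooth_sectionsD(1)[OF s]])
qed

lemma smooth_sections_sum: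
  assumes E: "smooth_vector_bundle E" and "\<And>i. i < (n::nat) \<Longrightarrow> s i \<in> smooth_sections E"
  shows "(\<lambda>x. \<Sum>i<n. s i x) \<in> smooth_sections E"
  using assms(2)
proof (induction n)
  case 0
  then show ?case using smooth_sections_zero[OF E] by simp
next
  case (Suc n)
  then show ?case using smooth_sections_add[OF E, of "\<lambda>x. \<Sum>i<n. s i x" "s n"] by simp
qed

lemma smooth_functions_extend:
  assumes M: "smooth_manifold M" and U: "open U" and f: "smooth_on_mfd M U f"
    and h: "h \<in> smooth_functions M" "closed K" "K \<subseteq> U" "\<And>y. y \<notin> K \<Longrightarrow> h y = 0"
  shows "(\<lambda>y. if y \<in> U then h y * f y else 0) \<in> smooth_functions M" (is "?g \<in> _")
proof -
  have "smooth_on_mfd M U ?g"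
    by (rule smooth_on_mfd_cong[OF M U _ smooth_on_mfd_mult[OF smooth_functions_on[OF h(1)] f]]) simp
  moreover have "smooth_on_mfd M (- K) ?g"
    by (rule smooth_on_mfd_cong[OF M _ _ smooth_on_mfd_const[of M _ 0]]) (use h(2,4) in auto)
  moreover have "U \<union> - K = UNIV" using h(3) by blast
  ultimately show ?thesis
    using smooth_on_mfd_Un[OF M U, of "- K" ?g] h(2) by (simp add: smooth_functions_def open_Compl)
qed

lemma smooth_sections_extend_frame:
  assumes E: "smooth_vector_bundle E" and fr: "(U, r, e) \<in> frames E" and j: "j < r"
    and h: "h \<in> smooth_functions E" "closed K" "K \<subseteq> U" "\<And>y. y \<notin> K \<Longrightarrow> h y = 0"
  shows "(\<lambda>y. if y \<in> U then h y *\<^sub>R e j y else 0) \<in> smooth_sections E" (is "?s \<in> _")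
proof (rule smooth_sectionsI)
  note M = bundle_manifold[OF E]
  show "?s x \<in> fibre E x" for x
    using subspace_0[OF bundle_fibre[OF E, of x]] subspace_scale[OF bundle_fibre[OF E, of x] frame_vector[OF E fr _ j]]
    by simp
  fix U' r' e' i assume fr': "(U', r', e') \<in> frames E" and i: "i < r'"
  note U = frameD(1)[OF E fr] and U' = frameD(1)[OF E fr']
  have "\<forall>(U, r, e)\<in>frames E. \<forall>(U', r', e')\<in>frames E. \<forall>i<r. \<forall>j<r'.
        smooth_on_mfd E (U \<inter> U') (\<lambda>x. frame_coord r e i x (e' j x))"
    using E unfolding smooth_vector_bundle_def by (elim conjE)
  note t = bspec[OF bspec[OF this fr', unfolded prod.case] fr, unfolded prod.case, rule_format, OF i j]
  have "smooth_on_mfd E (U' \<inter> U) (\<lambda>x. frame_coord r' e' i x (?s x))"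
  proof (rule smooth_on_mfd_cong[OF M open_Int[OF U' U] _ smooth_on_mfd_mult[OF smooth_functions_on[OF h(1)] t]])
    fix x assume "x \<in> U' \<inter> U"
    then show "frame_coord r' e' i x (?s x) = h x * frame_coord r' e' i x (e j x)"
      using frame_coord_linear(2)[OF E fr' _ frame_vector[OF E fr _ j] frame_vector[OF E fr _ j], of x] by simp
  qed
  moreover have "smooth_on_mfd E (U' \<inter> - K) (\<lambda>x. frame_coord r' e' i x (?s x))"
  proof (rule smooth_on_mfd_cong[OF M _ _ smooth_on_mfd_const[of E _ 0]])
    show "open (U' \<inter> - K)" using U' h(2) by (intro open_Int open_Compl)
    fix x assume "x \<in> U' \<inter> - K"
    then show "frame_coord r' e' i x (?s x) = 0" using h(4)[of x] by (simp add: frame_coord_zero)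
  qed
  moreover have "(U' \<inter> U) \<union> (U' \<inter> - K) = U'" using h(3) by blast
  ultimately show "smooth_on_mfd E U' (\<lambda>x. frame_coord r' e' i x (?s x))"
    using smooth_on_mfd_Un[OF M open_Int[OF U' U] open_Int[OF U' open_Compl[OF h(2)]], of "\<lambda>x. frame_coord r' e' i x (?s x)"]
    by simp
qed

lemma section_through:
  assumes E: "smooth_vector_bundle E" and v: "v \<in> fibre E x"
  obtains \<psi> where "\<psi> \<in> smooth_sections E" "\<psi> x = v"
proof -
  obtain U r e where fr: "(U, r, e) \<in> frames E" "x \<in> U" using E by (rule frame_at)
  obtain h K where h: "h \<in> smooth_functions E" "h x = 1" "closed K" "K \<subseteq> U" "\<And>y. y \<notin> K \<Longrightarrow> h y = 0"
    by (rule smooth_bump[OF bundle_manifold[OF E] frameD(1)[OF E fr(1)] fr(2)]) (rule that)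
  define s where "s = (\<lambda>j y. if y \<in> U then h y *\<^sub>R e j y else 0)"
  have s: "s j \<in> smooth_sections E" if "j < r" for j
    unfolding s_def by (rule smooth_sections_extend_frame[OF E fr(1) that h(1,3,4,5)])
  show thesis
  proof (rule that)
    show "(\<lambda>y. \<Sum>j<r. frame_coord r e j x v *\<^sub>R s j y) \<in> smooth_sections E"
      by (rule smooth_sections_sum[OF E]) (rule smooth_sections_scale[OF E smooth_functions_const s])
    show "(\<Sum>j<r. frame_coord r e j x v *\<^sub>R s j x) = v"
      using frame_expansion[OF E fr v] by (simp add: s_def fr(2) h(2))
  qed
qed

text \<open>
  With a bump function \<open>h\<close> supported in a frame domain and equal to \<open>1\<close> at \<open>x\<close>, write
  $u = \sum_j (h u_j)(h e_j) + (1-h^2)u$.  All coefficients are global smooth functions that vanish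
  at \<open>x\<close>.
\<close>

lemma tensorial_vanishes:
  fixes F :: "('m::{t2_space,second_countable_topology} \<Rightarrow> 'e::real_vector) \<Rightarrow> real"
  assumes E: "smooth_vector_bundle E"
    and add: "\<And>\<phi> \<psi>. \<lbrakk>\<phi> \<in> smooth_sections E; \<psi> \<in> smooth_sections E\<rbrakk> \<Longrightarrow> F (\<lambda>y. \<phi> y + \<psi> y) = F \<phi> + F \<psi>"
    and scale: "\<And>f \<psi>. \<lbrakk>f \<in> smooth_functions E; \<psi> \<in> smooth_sections E\<rbrakk> \<Longrightarrow> F (\<lambda>y. f y *\<^sub>R \<psi> y) = f x * F \<psi>"
    and u: "u \<in> smooth_sections E" "u x = 0"
  shows "F u = 0"
proof -
  obtain U r e where fr: "(U, r, e) \<in> frames E" "x \<in> U" using E by (rule frame_at)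
  obtain h K where h: "h \<in> smooth_functions E" "h x = 1" "closed K" "K \<subseteq> U" "\<And>y. y \<notin> K \<Longrightarrow> h y = 0"
    by (rule smooth_bump[OF bundle_manifold[OF E] frameD(1)[OF E fr(1)] fr(2)]) (rule that)
  define s where "s = (\<lambda>j y. if y \<in> U then h y *\<^sub>R e j y else 0)"
  have s: "s j \<in> smooth_sections E" if "j < r" for j
    unfolding s_def by (rule smooth_sections_extend_frame[OF E fr(1) that h(1,3,4,5)])
  define f where "f = (\<lambda>j y. if y \<in> U then h y * frame_coord r e j y (u y) else 0)"
  have f: "f j \<in> smooth_functions E" if "j < r" for j
    unfolding f_def
    by (rule smooth_functions_extend[OF bundle_manifold[OF E] frameD(1)[OF E fr(1)] smooth_sectionsD(2)[OF u(1) fr(1) that] h(1,3,4,5)])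
  have fx: "f j x = 0" for j by (simp add: f_def u(2) frame_coord_zero)
  define k where "k = (\<lambda>y. 1 + (- 1) * (h y * h y))"
  have k: "k \<in> smooth_functions E"
    unfolding k_def by (intro smooth_functions_add smooth_functions_mult smooth_functions_const h(1))
  have Fsum: "F (\<lambda>y. \<Sum>j<m. f j y *\<^sub>R s j y) = 0" if "m \<le> r" for m
    using that
  proof (induction m)
    case 0
    then show ?case using scale[OF smooth_functions_const[of 0 E] u(1)] by simp
  next
    case (Suc m)
    have "F (\<lambda>y. (\<Sum>j<m. f j y *\<^sub>R s j y) + f m y *\<^sub>R s m y) = F (\<lambda>y. \<Sum>j<m. f j y *\<^sub>R s j y) + F (\<lambda>y. f m y *\<^sub>R s m y)"
      by (rule add[OF smooth_sections_sum[OF E smooth_sections_scale[OF E f s]] smooth_sections_scale[OF E f s]])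
        (use Suc.prems in simp_all)
    then show ?case using Suc scale[OF f s, of m m] fx by simp
  qed
  have dec: "u = (\<lambda>y. (\<Sum>j<r. f j y *\<^sub>R s j y) + k y *\<^sub>R u y)"
  proof
    fix y
    show "u y = (\<Sum>j<r. f j y *\<^sub>R s j y) + k y *\<^sub>R u y"
    proof (cases "y \<in> U")
      case True
      have "(\<Sum>j<r. f j y *\<^sub>R s j y) = (h y * h y) *\<^sub>R (\<Sum>j<r. frame_coord r e j y (u y) *\<^sub>R e j y)"
        unfolding scaleR_right.sum by (simp add: f_def s_def True mult_ac)
      also have "\<dots> = (h y * h y) *\<^sub>R u y"
        using frame_expansion[OF E fr(1) True smooth_sectionsD(1)[OF u(1)]] by simp
      finally show ?thesis by (simp add: k_def algebra_simps)
    next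
      case False
      then have "h y = 0" using h(4,5) by blast
      then show ?thesis using False by (simp add: f_def k_def)
    qed
  qed
  have "F u = F (\<lambda>y. (\<Sum>j<r. f j y *\<^sub>R s j y) + k y *\<^sub>R u y)" using dec by simp
  also have "\<dots> = F (\<lambda>y. \<Sum>j<r. f j y *\<^sub>R s j y) + F (\<lambda>y. k y *\<^sub>R u y)"
    by (rule add[OF smooth_sections_sum[OF E smooth_sections_scale[OF E f s]] smooth_sections_scale[OF E k u(1)]])
  also have "\<dots> = k x * F u" using Fsum scale[OF k u(1)] by simp
  also have "\<dots> = 0" by (simp add: k_def h(2))
  finally show ?thesis .
qed

section \<open>Vectors representing covectors\<close>

text \<open>
  The ambient space may have infinite dimension, so the dimension count is done inside \<open>span S\<close>: the map
  $w\mapsto\sum_{c\in S} B(w,c)\,c$ is an injective endomorphism of \<open>span S\<close>, hence it maps the basis to a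
  basis and is surjective.
\<close>

lemma nondegenerate_represents:
  fixes B :: "'e::real_vector \<Rightarrow> 'e \<Rightarrow> real" and S :: "'e set"
  assumes S: "finite S" "independent S"
    and lin1: "\<And>a b u v w. \<lbrakk>u \<in> span S; v \<in> span S; w \<in> span S\<rbrakk> \<Longrightarrow> B (a *\<^sub>R u + b *\<^sub>R v) w = a * B u w + b * B v w"
    and lin2: "\<And>a b u v w. \<lbrakk>u \<in> span S; v \<in> span S; w \<in> span S\<rbrakk> \<Longrightarrow> B w (a *\<^sub>R u + b *\<^sub>R v) = a * B w u + b * B w v"
    and nd: "\<And>u. u \<in> span S \<Longrightarrow> (\<And>v. v \<in> span S \<Longrightarrow> B u v = 0) \<Longrightarrow> u = 0"
    and l: "\<And>a b u v. \<lbrakk>u \<in> span S; v \<in> span S\<rbrakk> \<Longrightarrow> l (a *\<^sub>R u + b *\<^sub>R v) = a * l u + b * l v"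
  shows "\<exists>w\<in>span S. \<forall>u\<in>span S. B w u = l u"
proof -
  have z: "0 \<in> span S" by (rule span_zero)
  have agree: "p v = q v" if v: "v \<in> span S" and base: "\<And>b. b \<in> S \<Longrightarrow> p b = q b"
    and p: "\<And>a b u v. \<lbrakk>u \<in> span S; v \<in> span S\<rbrakk> \<Longrightarrow> p (a *\<^sub>R u + b *\<^sub>R v) = a *\<^sub>R p u + b *\<^sub>R p v"
    and q: "\<And>a b u v. \<lbrakk>u \<in> span S; v \<in> span S\<rbrakk> \<Longrightarrow> q (a *\<^sub>R u + b *\<^sub>R v) = a *\<^sub>R q u + b *\<^sub>R q v"
    for p q :: "'e \<Rightarrow> 'a::real_vector" and v
  proof -
    have "v \<in> span S \<and> p v = q v"
      using v
    proof (induction rule: span_induct_alt)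
      case base
      then show ?case using p[OF z z, of 0 0] q[OF z z, of 0 0] z by simp
    next
      case (step c x y)
      then have y: "y \<in> span S" "p y = q y" by simp_all
      have "c *\<^sub>R x + 1 *\<^sub>R y \<in> span S"
        by (intro span_add span_scale span_base[OF step(1)] y(1))
      moreover have "p (c *\<^sub>R x + 1 *\<^sub>R y) = q (c *\<^sub>R x + 1 *\<^sub>R y)"
        by (simp only: p[OF span_base[OF step(1)] y(1)] q[OF span_base[OF step(1)] y(1)] base[OF step(1)] y(2))
      ultimately show ?case by simp
    qed
    then show ?thesis ..
  qed
  obtain T where T: "linear T" "\<And>b. b \<in> S \<Longrightarrow> T b = (\<Sum>c\<in>S. B b c *\<^sub>R c)"
    using linear_independent_extend[OF S(2), of "\<lambda>b. \<Sum>c\<in>S. B b c *\<^sub>R c"] by blast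
  have TB: "T v = (\<Sum>c\<in>S. B v c *\<^sub>R c)" if "v \<in> span S" for v
  proof (rule agree[OF that T(2)])
    show "T (a *\<^sub>R u + b *\<^sub>R v) = a *\<^sub>R T u + b *\<^sub>R T v" for a b u v
      using T(1) by (simp add: linear_add linear_scale)
    show "(\<Sum>c\<in>S. B (a *\<^sub>R u + b *\<^sub>R v) c *\<^sub>R c) = a *\<^sub>R (\<Sum>c\<in>S. B u c *\<^sub>R c) + b *\<^sub>R (\<Sum>c\<in>S. B v c *\<^sub>R c)"
      if "u \<in> span S" "v \<in> span S" for a b u v
      unfolding scaleR_right.sum sum.distrib[symmetric]
      by (rule sum.cong[OF refl]) (simp add: lin1[OF that span_base] scaleR_add_left)
  qed
  have coeff: "f b = g b" if "(\<Sum>c\<in>S. f c *\<^sub>R c) = (\<Sum>c\<in>S. g c *\<^sub>R c)" "b \<in> S" for f g :: "'e \<Rightarrow> real" and b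
  proof -
    have "(\<Sum>c\<in>S. (f c - g c) *\<^sub>R c) = 0"
      using that(1) by (simp add: scaleR_diff_left sum_subtractf)
    then show ?thesis using independentD[OF S(2) S(1) order_refl _ that(2), of "\<lambda>c. f c - g c"] by simp
  qed
  have inj: "inj_on T (span S)"
  proof (subst linear_inj_on_iff_eq_0[OF T(1) subspace_span], intro ballI impI)
    fix v assume v: "v \<in> span S" and "T v = 0"
    then have "(\<Sum>c\<in>S. B v c *\<^sub>R c) = (\<Sum>c\<in>S. 0 *\<^sub>R c)" using TB by simp
    then have b: "B v c = 0" if "c \<in> S" for c using coeff[of "B v" "\<lambda>c. 0"] that by simp
    show "v = 0"
    proof (rule nd[OF v])
      fix w assume w: "w \<in> span S"
      show "B v w = 0"
        by (rule agree[OF w, of "B v" "\<lambda>w. 0"]) (simp_all add: b lin2 v)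
    qed
  qed
  have indep: "independent (T ` S)"
    by (rule linear_independent_injective_image[OF T(1) S(2) inj])
  have card: "card (T ` S) = card S"
    by (rule card_image[OF inj_on_subset[OF inj span_superset]])
  have sub: "T ` S \<subseteq> span S"
  proof (rule image_subsetI)
    fix b assume "b \<in> S"
    show "T b \<in> span S" unfolding T(2)[OF \<open>b \<in> S\<close>]
      by (rule span_sum, rule span_scale, rule span_base)
  qed
  have onto: "span S \<subseteq> span (T ` S)"
  proof
    fix v assume v: "v \<in> span S"
    show "v \<in> span (T ` S)"
    proof (rule ccontr)
      assume n: "v \<notin> span (T ` S)"
      have nT: "v \<notin> T ` S" using n span_base[of v "T ` S"] by blast
      have "independent (insert v (T ` S))"
        using indep n nT by (simp add: independent_insert)
      then have "card (insert v (T ` S)) \<le> card S"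
        using independent_span_bound[OF S(1), of "insert v (T ` S)"] v sub by simp
      then show False using card S(1) nT by simp
    qed
  qed
  have "(\<Sum>c\<in>S. l c *\<^sub>R c) \<in> span (T ` S)"
    by (rule subsetD[OF onto], rule span_sum, rule span_scale, rule span_base)
  then obtain w where w: "w \<in> span S" "T w = (\<Sum>c\<in>S. l c *\<^sub>R c)"
    using linear_span_image[OF T(1)] by force
  show ?thesis
  proof (intro bexI[OF _ w(1)] ballI)
    fix u assume u: "u \<in> span S"
    have "B w c = l c" if "c \<in> S" for c
      using coeff[of "B w" l c] w TB[OF w(1)] that by simp
    then show "B w u = l u"
      using agree[OF u, of "B w" l] lin2 w(1) l by simp
  qed
qed

lemma sharp_props:
  assumes E: "smooth_vector_bundle C" and g: "fibre_metric C"
    and l: "\<And>a b u v. \<lbrakk>u \<in> fibre C x; v \<in> fibre C x\<rbrakk> \<Longrightarrow> l (a *\<^sub>R u + b *\<^sub>R v) = a * l u + b * l v"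
  shows "sharp C x l \<in> fibre C x" and "u \<in> fibre C x \<Longrightarrow> metric C x (sharp C x l) u = l u"
proof -
  obtain U r e where fr: "(U, r, e) \<in> frames C" "x \<in> U" using E by (rule frame_at)
  have sym: "metric C x u v = metric C x v u" if "u \<in> fibre C x" "v \<in> fibre C x" for u v
    using g that by (simp add: fibre_metric_def)
  have lin: "metric C x (a *\<^sub>R u + b *\<^sub>R v) w = a * metric C x u w + b * metric C x v w"
    if "u \<in> fibre C x" "v \<in> fibre C x" "w \<in> fibre C x" for a b u v w
    using g that by (simp add: fibre_metric_def)
  have mem: "a *\<^sub>R u + b *\<^sub>R v \<in> fibre C x" if "u \<in> fibre C x" "v \<in> fibre C x" for a b u v
    using that by (intro subspace_add subspace_scale bundle_fibre[OF E])
  define S where "S = (\<lambda>i. e i x) ` {..<r}"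
  have sp: "span S = fibre C x" and ind: "independent S" and fin: "finite S"
    unfolding S_def using frameD(3,4)[OF E fr] by simp_all
  have "\<exists>w\<in>span S. \<forall>u\<in>span S. metric C x w u = l u"
  proof (rule nondegenerate_represents[OF fin ind], unfold sp)
    show "metric C x w (a *\<^sub>R u + b *\<^sub>R v) = a * metric C x w u + b * metric C x w v"
      if "u \<in> fibre C x" "v \<in> fibre C x" "w \<in> fibre C x" for a b u v w
      using lin[OF that] sym[OF that(3) mem[OF that(1,2)]] sym[OF that(3,1)] sym[OF that(3,2)] by simp
    show "u = 0" if "u \<in> fibre C x" "\<And>v. v \<in> fibre C x \<Longrightarrow> metric C x u v = 0" for u
      using g that by (simp add: fibre_metric_def)
    show "metric C x (a *\<^sub>R u + b *\<^sub>R v) w = a * metric C x u w + b * metric C x v w"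
      if "u \<in> fibre C x" "v \<in> fibre C x" "w \<in> fibre C x" for a b u v w
      by (rule lin[OF that])
    show "l (a *\<^sub>R u + b *\<^sub>R v) = a * l u + b * l v" if "u \<in> fibre C x" "v \<in> fibre C x" for a b u v
      by (rule l[OF that])
  qed
  then obtain w where w: "w \<in> fibre C x" "\<And>u. u \<in> fibre C x \<Longrightarrow> metric C x w u = l u"
    unfolding sp by (elim bexE) (erule that, erule bspec)
  have "sharp C x l = w" by (rule sharp_eqI[OF E g w])
  then show "sharp C x l \<in> fibre C x" "u \<in> fibre C x \<Longrightarrow> metric C x (sharp C x l) u = l u"
    using w by simp_all
qed

section \<open>The sections of a twisted Courant algebroid\<close>

lemma alternating_linear:
  "\<lbrakk>alternating_on V p \<omega>; length vs = p; set vs \<subseteq> V; i < p; u \<in> V; w \<in> V\<rbrakk> \<Longrightarrow>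
    \<omega> (vs[i := a *\<^sub>R u + b *\<^sub>R w]) = a * \<omega> (vs[i := u]) + b * \<omega> (vs[i := w])"
  and alternating_repeat:
  "\<lbrakk>alternating_on V p \<omega>; length vs = p; set vs \<subseteq> V; i < j; j < p; vs ! i = vs ! j\<rbrakk> \<Longrightarrow> \<omega> vs = 0"
  and alternating_default: "\<lbrakk>alternating_on V p \<omega>; \<not> (length vs = p \<and> set vs \<subseteq> V)\<rbrakk> \<Longrightarrow> \<omega> vs = 0"
  unfolding alternating_on_def by metis+

lemma alternating_linear_0:
  assumes "alternating_on V (Suc q) \<omega>" "length vs = q" "set vs \<subseteq> V" "u \<in> V" "w \<in> V"
  shows "\<omega> ((a *\<^sub>R u + b *\<^sub>R w) # vs) = a * \<omega> (u # vs) + b * \<omega> (w # vs)"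
  using alternating_linear[OF assms(1), of "u # vs" 0 u w a b] assms(2-5) by simp

lemma set_list_update: "\<lbrakk>set vs \<subseteq> V; u \<in> V\<rbrakk> \<Longrightarrow> set (vs[i := u]) \<subseteq> V"
  using set_update_subset_insert[of vs i u] by blast

lemma fun_sum_apply: "(\<Sum>i\<in>I. F i) x = (\<Sum>i\<in>I. F i x)" for F :: "'i \<Rightarrow> 'b \<Rightarrow> 'c::comm_monoid_add"
  by (induction I rule: infinite_finite_induct) simp_all

lemma fun_sign_apply: "((-1) ^ n * F) x = (-1) ^ n * F x" for F :: "'b \<Rightarrow> 'c::comm_ring_1"
  by (induction n) simp_all

locale twisted_courant =
  fixes C :: "('m::{t2_space,second_countable_topology}, 'e::real_vector, 'x) courant_scheme"
  assumes twisted_courant: "twisted_courant_algebroid C"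
begin

abbreviation (input) scl :: "('m \<Rightarrow> real) \<Rightarrow> ('m \<Rightarrow> 'e) \<Rightarrow> 'm \<Rightarrow> 'e" (infixr "\<cdot>" 75) where
  "f \<cdot> \<psi> \<equiv> (\<lambda>x. f x *\<^sub>R \<psi> x)"

lemmas courant_axioms = twisted_courant[unfolded twisted_courant_algebroid_def]
lemmas vbundle = courant_axioms[THEN conjunct1]
lemmas fibre_metric = courant_axioms[THEN conjunct2, THEN conjunct1]
lemmas anchor_map = courant_axioms[THEN conjunct2, THEN conjunct2, THEN conjunct1]
lemmas br_closed = courant_axioms[THEN conjunct2, THEN conjunct2, THEN conjunct2, THEN conjunct1]
lemmas br_bilinear = courant_axioms[THEN conjunct2, THEN conjunct2, THEN conjunct2, THEN conjunct2, THEN conjunct1]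
lemmas twist_form = courant_axioms[THEN conjunct2, THEN conjunct2, THEN conjunct2, THEN conjunct2, THEN conjunct2, THEN conjunct1]
lemmas H_jacobi = courant_axioms[THEN conjunct2, THEN conjunct2, THEN conjunct2, THEN conjunct2, THEN conjunct2, THEN conjunct2, THEN conjunct1]
lemmas br_leibniz = courant_axioms[THEN conjunct2, THEN conjunct2, THEN conjunct2, THEN conjunct2, THEN conjunct2, THEN conjunct2, THEN conjunct2, THEN conjunct2, THEN conjunct1]
lemmas br_self = courant_axioms[THEN conjunct2, THEN conjunct2, THEN conjunct2, THEN conjunct2, THEN conjunct2, THEN conjunct2, THEN conjunct2, THEN conjunct2, THEN conjunct2, THEN conjunct1]

lemma sec_fibre: "\<psi> \<in> smooth_sections C \<Longrightarrow> \<psi> x \<in> fibre C x"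
  by (rule smooth_sectionsD(1))

lemma fibre_comb: "\<lbrakk>u \<in> fibre C x; v \<in> fibre C x\<rbrakk> \<Longrightarrow> a *\<^sub>R u + b *\<^sub>R v \<in> fibre C x"
  by (intro subspace_add subspace_scale bundle_fibre[OF vbundle])

lemma metric_sym: "\<lbrakk>u \<in> fibre C x; v \<in> fibre C x\<rbrakk> \<Longrightarrow> metric C x u v = metric C x v u"
  and metric_linear: "\<lbrakk>u \<in> fibre C x; v \<in> fibre C x; w \<in> fibre C x\<rbrakk> \<Longrightarrow>
    metric C x (a *\<^sub>R u + b *\<^sub>R v) w = a * metric C x u w + b * metric C x v w"
  and metric_nondegenerate: "\<lbrakk>u \<in> fibre C x; \<And>v. v \<in> fibre C x \<Longrightarrow> metric C x u v = 0\<rbrakk> \<Longrightarrow> u = 0"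
  and metric_smooth: "\<lbrakk>\<phi> \<in> smooth_sections C; \<psi> \<in> smooth_sections C\<rbrakk> \<Longrightarrow>
    (\<lambda>x. metric C x (\<phi> x) (\<psi> x)) \<in> smooth_functions C"
  using fibre_metric by (simp_all add: fibre_metric_def)

lemma anchor_tangent: "u \<in> fibre C x \<Longrightarrow> anchor C x u \<in> tangent_space C x"
  and anchor_linear: "\<lbrakk>u \<in> fibre C x; v \<in> fibre C x\<rbrakk> \<Longrightarrow>
    anchor C x (a *\<^sub>R u + b *\<^sub>R v) f = a * anchor C x u f + b * anchor C x v f"
  and act_smooth: "\<lbrakk>\<psi> \<in> smooth_sections C; f \<in> smooth_functions C\<rbrakk> \<Longrightarrow> act C \<psi> f \<in> smooth_functions C"
  using anchor_map by (simp_all add: anchor_map_def act_def)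

lemma anchor_nonsmooth: "\<lbrakk>u \<in> fibre C x; f \<notin> smooth_functions C\<rbrakk> \<Longrightarrow> anchor C x u f = 0"
  and anchor_comb: "\<lbrakk>u \<in> fibre C x; f \<in> smooth_functions C; h \<in> smooth_functions C\<rbrakk> \<Longrightarrow>
    anchor C x u (\<lambda>y. a * f y + b * h y) = a * anchor C x u f + b * anchor C x u h"
  and anchor_mult: "\<lbrakk>u \<in> fibre C x; f \<in> smooth_functions C; h \<in> smooth_functions C\<rbrakk> \<Longrightarrow>
    anchor C x u (\<lambda>y. f y * h y) = anchor C x u f * h x + f x * anchor C x u h"
  using anchor_tangent[of u x] by (simp_all add: tangent_space_def)

lemma anchor_const: "u \<in> fibre C x \<Longrightarrow> anchor C x u (\<lambda>y. c) = 0"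
proof -
  assume u: "u \<in> fibre C x"
  have "anchor C x u (\<lambda>y. 1) = 0"
    using anchor_mult[OF u smooth_functions_const[of 1] smooth_functions_const[of 1]] by simp
  then show ?thesis
    using anchor_comb[OF u smooth_functions_const[of 1] smooth_functions_const[of 1], of c 0] by simp
qed

lemma anchor_zero: "anchor C x 0 f = 0"
  using anchor_linear[of 0 x 0 0 0 f] subspace_0[OF bundle_fibre[OF vbundle, of x]] by simp

lemma twist_alternating: "alternating_on (fibre C x) 4 (twist C x)"
  using twist_form by (simp add: ker_rho_forms_def smooth_forms_def)

lemma H_tilde_props:
  assumes "u \<in> fibre C x" "v \<in> fibre C x" "w \<in> fibre C x"
  shows "H_tilde C x u v w \<in> fibre C x"
    and "z \<in> fibre C x \<Longrightarrow> metric C x (H_tilde C x u v w) z = twist C x [u, v, w, z]"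
proof -
  have "twist C x [u, v, w, a *\<^sub>R y + b *\<^sub>R z] = a * twist C x [u, v, w, y] + b * twist C x [u, v, w, z]"
    if "y \<in> fibre C x" "z \<in> fibre C x" for a b y z
    using alternating_linear[OF twist_alternating, of "[u, v, w, y]" x 3 y z a b] assms that
    by (simp add: eval_nat_numeral)
  note s = sharp_props[OF vbundle fibre_metric, of x "\<lambda>z. twist C x [u, v, w, z]", OF this]
  show "H_tilde C x u v w \<in> fibre C x"
    and "z \<in> fibre C x \<Longrightarrow> metric C x (H_tilde C x u v w) z = twist C x [u, v, w, z]"
    unfolding H_tilde_def using s by simp_all
qed

text \<open>
  Being tensorial, $\tilde H$ can be compared with the Jacobiator of \<open>f\<close>-multiples of sections; this is
  how the anchor is seen to preserve brackets.
\<close>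

lemma H_tilde_scale:
  assumes "u \<in> fibre C x" "v \<in> fibre C x" "w \<in> fibre C x"
  shows "H_tilde C x u v (c *\<^sub>R w) = c *\<^sub>R H_tilde C x u v w"
  unfolding H_tilde_def[of C x u v "c *\<^sub>R w"]
proof (rule sharp_eqI[OF vbundle fibre_metric])
  show "c *\<^sub>R H_tilde C x u v w \<in> fibre C x"
    by (rule subspace_scale[OF bundle_fibre[OF vbundle] H_tilde_props(1)[OF assms]])
  fix z assume z: "z \<in> fibre C x"
  show "metric C x (c *\<^sub>R H_tilde C x u v w) z = twist C x [u, v, c *\<^sub>R w, z]"
    using metric_linear[OF H_tilde_props(1)[OF assms] H_tilde_props(1)[OF assms] z, of c 0]
      H_tilde_props(2)[OF assms z] alternating_linear[OF twist_alternating, of "[u, v, w, z]" x 2 w w c 0]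
      assms z by (simp add: eval_nat_numeral)
qed

lemma H_tilde_repeat:
  assumes "u \<in> fibre C x" "w \<in> fibre C x"
  shows "H_tilde C x u u w = 0"
proof (rule metric_nondegenerate[OF H_tilde_props(1)[OF assms(1,1,2)]])
  fix z assume "z \<in> fibre C x"
  then show "metric C x (H_tilde C x u u w) z = 0"
    using H_tilde_props(2)[OF assms(1,1,2)] alternating_repeat[OF twist_alternating, of "[u, u, w, z]" x 0 1] assms
    by simp
qed

lemma bracket_add:
  assumes "\<phi> \<in> smooth_sections C" "\<psi> \<in> smooth_sections C" "\<eta> \<in> smooth_sections C"
  shows "bracket C (\<phi> + \<psi>) \<eta> = bracket C \<phi> \<eta> + bracket C \<psi> \<eta>"
    and "bracket C \<eta> (\<phi> + \<psi>) = bracket C \<eta> \<phi> + bracket C \<eta> \<psi>"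
  using br_bilinear[rule_format, OF assms, of 1 1] by (simp_all add: plus_fun_def fun_eq_iff)

lemma bracket_scale:
  assumes "\<phi> \<in> smooth_sections C" "\<psi> \<in> smooth_sections C" "f \<in> smooth_functions C"
  shows "bracket C \<phi> (f \<cdot> \<psi>) = act C \<phi> f \<cdot> \<psi> + f \<cdot> bracket C \<phi> \<psi>"
  using br_leibniz[rule_format, OF assms] by (simp add: fun_eq_iff)

text \<open>
  Both sides of $\tilde H(\phi,\psi,f\eta)=f\tilde H(\phi,\psi,\eta)$ are Jacobiators.  Expanding the left one with the
  Leibniz rule leaves the defect of the anchor, applied to \<open>f\<close>, as coefficient of \<open>\<eta>\<close>.  If no section is
  nonzero at \<open>x\<close>, the fibre is zero and so are all anchors.
\<close>

lemma act_bracket: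
  assumes \<phi>: "\<phi> \<in> smooth_sections C" and \<psi>: "\<psi> \<in> smooth_sections C" and f: "f \<in> smooth_functions C"
  shows "act C (bracket C \<phi> \<psi>) f = act C \<phi> (act C \<psi> f) - act C \<psi> (act C \<phi> f)"
proof
  fix x
  show "act C (bracket C \<phi> \<psi>) f x = (act C \<phi> (act C \<psi> f) - act C \<psi> (act C \<phi> f)) x"
  proof (cases "\<exists>v\<in>fibre C x. v \<noteq> 0")
    case False
    have "\<eta> x = 0" if "\<eta> \<in> smooth_sections C" for \<eta>
      using sec_fibre[OF that, of x] False by blast
    from this[OF \<phi>] this[OF \<psi>] this[OF br_closed[rule_format, OF \<phi> \<psi>]]
    show ?thesis by (simp add: act_def anchor_zero)
  next
    case True
    then obtain v where v: "v \<in> fibre C x" "v \<noteq> 0" by (elim bexE)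
    obtain \<eta> where \<eta>: "\<eta> \<in> smooth_sections C" "\<eta> x = v" using vbundle v(1) by (rule section_through)
    note cl = br_closed[rule_format] act_smooth smooth_sections_scale[OF vbundle]
    have b1: "bracket C \<xi> (g \<cdot> \<eta>) x = act C \<xi> g x *\<^sub>R \<eta> x + g x *\<^sub>R bracket C \<xi> \<eta> x"
      if "\<xi> \<in> smooth_sections C" "g \<in> smooth_functions C" for \<xi> g
      by (rule br_leibniz[rule_format, OF that(1) \<eta>(1) that(2)])
    have b2: "bracket C \<xi> (bracket C \<zeta> (f \<cdot> \<eta>)) x = act C \<xi> (act C \<zeta> f) x *\<^sub>R \<eta> x + act C \<zeta> f x *\<^sub>R bracket C \<xi> \<eta> x
        + act C \<xi> f x *\<^sub>R bracket C \<zeta> \<eta> x + f x *\<^sub>R bracket C \<xi> (bracket C \<zeta> \<eta>) x"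
      if \<xi>: "\<xi> \<in> smooth_sections C" and \<zeta>: "\<zeta> \<in> smooth_sections C" for \<xi> \<zeta>
      unfolding bracket_scale[OF \<zeta> \<eta>(1) f]
        bracket_add(2)[OF cl(3)[OF cl(2)[OF \<zeta> f] \<eta>(1)] cl(3)[OF f cl(1)[OF \<zeta> \<eta>(1)]] \<xi>]
        bracket_scale[OF \<xi> \<eta>(1) cl(2)[OF \<zeta> f]] bracket_scale[OF \<xi> cl(1)[OF \<zeta> \<eta>(1)] f]
      by (simp add: add.assoc)
    have "H_tilde C x (\<phi> x) (\<psi> x) ((f \<cdot> \<eta>) x) = f x *\<^sub>R H_tilde C x (\<phi> x) (\<psi> x) (\<eta> x)"
      by (rule H_tilde_scale[OF sec_fibre[OF \<phi>] sec_fibre[OF \<psi>] sec_fibre[OF \<eta>(1)]])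
    then have "(act C \<phi> (act C \<psi> f) x - act C (bracket C \<phi> \<psi>) f x - act C \<psi> (act C \<phi> f) x) *\<^sub>R \<eta> x = 0"
      unfolding H_jacobi[rule_format, OF \<phi> \<psi> cl(3)[OF f \<eta>(1)]] H_jacobi[rule_format, OF \<phi> \<psi> \<eta>(1)]
        b1[OF cl(1)[OF \<phi> \<psi>] f] b2[OF \<phi> \<psi>] b2[OF \<psi> \<phi>]
      by (simp add: algebra_simps)
    then show ?thesis using v(2) \<eta>(2) by simp
  qed
qed

sublocale alg: leibniz_algebroid "\<lambda>f \<psi> x. f x *\<^sub>R \<psi> x" "smooth_functions C" "smooth_sections C" "act C" "bracket C"
proof
  show "(\<lambda>y. a y *\<^sub>R (x + z) y) = (\<lambda>y. a y *\<^sub>R x y) + (\<lambda>y. a y *\<^sub>R z y)"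
    for a :: "'m \<Rightarrow> real" and x z :: "'m \<Rightarrow> 'e"
    by (simp add: fun_eq_iff scaleR_add_right)
  show "(\<lambda>y. (a + b) y *\<^sub>R x y) = (\<lambda>y. a y *\<^sub>R x y) + (\<lambda>y. b y *\<^sub>R x y)"
    for a b :: "'m \<Rightarrow> real" and x :: "'m \<Rightarrow> 'e"
    by (simp add: fun_eq_iff scaleR_add_left)
  show "(\<lambda>y. a y *\<^sub>R b y *\<^sub>R x y) = (\<lambda>y. (a * b) y *\<^sub>R x y)"
    for a b :: "'m \<Rightarrow> real" and x :: "'m \<Rightarrow> 'e"
    by (simp add: fun_eq_iff)
  show "(\<lambda>y. (1 :: 'm \<Rightarrow> real) y *\<^sub>R x y) = x" for x :: "'m \<Rightarrow> 'e"
    by (simp add: fun_eq_iff)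
  show "1 \<in> smooth_functions C" using smooth_functions_const[of 1] by (simp add: one_fun_def)
  show "- f \<in> smooth_functions C" if "f \<in> smooth_functions C" for f
    using smooth_functions_mult[OF smooth_functions_const[of "-1"] that] by (simp add: fun_Compl_def)
  show "f + g \<in> smooth_functions C" "f * g \<in> smooth_functions C"
    if "f \<in> smooth_functions C" "g \<in> smooth_functions C" for f g
    using smooth_functions_add[OF that] smooth_functions_mult[OF that] by (simp_all add: plus_fun_def times_fun_def)
  show "x + y \<in> smooth_sections C" if "x \<in> smooth_sections C" "y \<in> smooth_sections C" for x y
    using smooth_sections_add[OF vbundle that] by (simp add: plus_fun_def)
  show "(\<lambda>y. f y *\<^sub>R x y) \<in> smooth_sections C" if "f \<in> smooth_functions C" "x \<in> smooth_sections C" for f x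
    by (rule smooth_sections_scale[OF vbundle that])
  show "act C x f \<in> smooth_functions C" if "x \<in> smooth_sections C" "f \<in> smooth_functions C" for x f
    by (rule act_smooth[OF that])
  show "act C x (f + g) = act C x f + act C x g" "act C x (f * g) = act C x f * g + f * act C x g"
    if "x \<in> smooth_sections C" "f \<in> smooth_functions C" "g \<in> smooth_functions C" for x f g
    using anchor_comb[OF sec_fibre[OF that(1)] that(2,3), of _ 1 1] anchor_mult[OF sec_fibre[OF that(1)] that(2,3)]
    by (simp_all add: act_def fun_eq_iff plus_fun_def times_fun_def)
  show "act C (x + y) f = act C x f + act C y f"
    if "x \<in> smooth_sections C" "y \<in> smooth_sections C" "f \<in> smooth_functions C" for x y f
    using anchor_linear[OF sec_fibre[OF that(1)] sec_fibre[OF that(2)], where a = 1 and b = 1] by (simp add: act_def fun_eq_iff)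
  show "act C (\<lambda>y. f y *\<^sub>R x y) g = f * act C x g"
    if "x \<in> smooth_sections C" "f \<in> smooth_functions C" "g \<in> smooth_functions C" for x f g
    using anchor_linear[OF sec_fibre[OF that(1)] sec_fibre[OF that(1)], where b = 0] by (simp add: act_def fun_eq_iff)
  show "bracket C x y \<in> smooth_sections C" if "x \<in> smooth_sections C" "y \<in> smooth_sections C" for x y
    using br_closed that by simp
  show "bracket C (x + y) z = bracket C x z + bracket C y z" "bracket C z (x + y) = bracket C z x + bracket C z y"
    if "x \<in> smooth_sections C" "y \<in> smooth_sections C" "z \<in> smooth_sections C" for x y z
    by (rule bracket_add[OF that])+
  show "bracket C x (\<lambda>z. f z *\<^sub>R y z) = (\<lambda>z. act C x f z *\<^sub>R y z) + (\<lambda>z. f z *\<^sub>R bracket C x y z)"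
    if "x \<in> smooth_sections C" "y \<in> smooth_sections C" "f \<in> smooth_functions C" for x y f
    by (rule bracket_scale[OF that])
  show "bracket C (bracket C y y) x = 0" if x: "x \<in> smooth_sections C" and y: "y \<in> smooth_sections C" for x y
  proof
    fix p
    show "bracket C (bracket C y y) x p = 0 p"
      using H_jacobi[rule_format, OF y y x, of p] H_tilde_repeat[OF sec_fibre[OF y] sec_fibre[OF x], of p] by simp
  qed
  show "act C (bracket C x y) f = act C x (act C y f) - act C y (act C x f)"
    if "x \<in> smooth_sections C" "y \<in> smooth_sections C" "f \<in> smooth_functions C" for x y f
    by (rule act_bracket[OF that])
qed

section \<open>Forms in the kernel of the anchor as functionals on sections\<close>

lemma on_sections_Cons: "on_sections \<alpha> (\<psi> # \<psi>s) x = \<alpha> x (\<psi> x # map (\<lambda>\<psi>. \<psi> x) \<psi>s)"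
  by (simp add: on_sections_def)

lemma secs_eval:
  assumes "xs \<in> alg.secs p"
  shows "length (map (\<lambda>\<psi>. \<psi> x) xs) = p" "set (map (\<lambda>\<psi>. \<psi> x) xs) \<subseteq> fibre C x"
  using assms sec_fibre by (auto simp: alg.secs_def)

lemma smooth_formsD:
  assumes "\<alpha> \<in> smooth_forms C p"
  shows "alternating_on (fibre C x) p (\<alpha> x)"
    and "xs \<in> alg.secs p \<Longrightarrow> on_sections \<alpha> xs \<in> smooth_functions C"
  using assms by (simp_all add: smooth_forms_def alg.secs_def)

lemma sections_through_list:
  assumes "set vs \<subseteq> fibre C x"
  obtains xs where "xs \<in> alg.secs (length vs)" "map (\<lambda>\<psi>. \<psi> x) xs = vs"
proof -
  have "\<exists>xs \<in> alg.secs (length vs). map (\<lambda>\<psi>. \<psi> x) xs = vs"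
    using assms
  proof (induction vs)
    case (Cons v vs)
    then obtain xs where xs: "xs \<in> alg.secs (length vs)" "map (\<lambda>\<psi>. \<psi> x) xs = vs" by auto
    have "v \<in> fibre C x" using Cons.prems by simp
    with vbundle obtain \<psi> where "\<psi> \<in> smooth_sections C" "\<psi> x = v" by (rule section_through)
    then show ?case using xs by (intro bexI[of _ "\<psi> # xs"]) simp_all
  qed simp
  then show thesis using that by (elim bexE)
qed

lemma smooth_forms_eqI:
  assumes \<alpha>: "\<alpha> \<in> smooth_forms C p" and \<beta>: "\<beta> \<in> smooth_forms C p"
    and eq: "\<And>xs. xs \<in> alg.secs p \<Longrightarrow> on_sections \<alpha> xs = on_sections \<beta> xs"
  shows "\<alpha> = \<beta>"
proof (intro ext)
  fix x vs
  show "\<alpha> x vs = \<beta> x vs"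
  proof (cases "length vs = p \<and> set vs \<subseteq> fibre C x")
    case True
    then have "set vs \<subseteq> fibre C x" and p: "length vs = p" by simp_all
    then obtain xs where "xs \<in> alg.secs p" "map (\<lambda>\<psi>. \<psi> x) xs = vs"
      by (elim sections_through_list[where vs = vs, unfolded p]) (rule that)
    then show ?thesis using fun_cong[OF eq, of xs x] by (simp add: on_sections_def)
  next
    case False
    then show ?thesis
      using alternating_default[OF smooth_formsD(1)[OF \<alpha>] False] alternating_default[OF smooth_formsD(1)[OF \<beta>] False]
      by simp
  qed
qed

lemma grad_props:
  shows "grad C f x \<in> fibre C x" and "u \<in> fibre C x \<Longrightarrow> metric C x (grad C f x) u = anchor C x u f"
  using sharp_props[OF vbundle fibre_metric, of x "\<lambda>u. anchor C x u f", OF anchor_linear]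
  by (simp_all add: grad_def)

lemma sharp_form_props:
  assumes "alternating_on (fibre C x) (Suc q) \<omega>" "length vs = q" "set vs \<subseteq> fibre C x"
  shows "sharp C x (\<lambda>u. \<omega> (u # vs)) \<in> fibre C x"
    and "u \<in> fibre C x \<Longrightarrow> metric C x (sharp C x (\<lambda>u. \<omega> (u # vs))) u = \<omega> (u # vs)"
  using sharp_props[OF vbundle fibre_metric, of x "\<lambda>u. \<omega> (u # vs)", OF alternating_linear_0[OF assms]] by simp_all

text \<open>
  $\rho^*$ is adjoint to $\rho$: if \<open>w\<close> represents $\omega(\cdot,v)$, then
  $\rho(w)f=\langle \mathcal{D}f,w\rangle=\omega(\mathcal{D}f,v)$.
\<close>

lemma rho_tilde_eq_grad:
  assumes "alternating_on (fibre C x) (Suc q) \<omega>" "length vs = q" "set vs \<subseteq> fibre C x"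
  shows "rho_tilde C x \<omega> vs f = \<omega> (grad C f x # vs)"
  using grad_props(2)[OF sharp_form_props(1)[OF assms], of f] sharp_form_props(2)[OF assms grad_props(1)]
    metric_sym[OF grad_props(1) sharp_form_props(1)[OF assms]]
  by (simp add: rho_tilde_def)

lemma on_sections_square:
  assumes \<alpha>: "\<alpha> \<in> smooth_forms C (Suc q)" and \<psi>: "\<psi> \<in> smooth_sections C" and xs: "xs \<in> alg.secs q"
  shows "on_sections \<alpha> (bracket C \<psi> \<psi> # xs) x
    = (1 / 2) * rho_tilde C x (\<alpha> x) (map (\<lambda>\<psi>. \<psi> x) xs) (\<lambda>y. metric C y (\<psi> y) (\<psi> y))"
proof -
  let ?g = "grad C (\<lambda>y. metric C y (\<psi> y) (\<psi> y)) x" and ?vs = "map (\<lambda>\<psi>. \<psi> x) xs"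
  have "on_sections \<alpha> (bracket C \<psi> \<psi> # xs) x = \<alpha> x (((1 / 2) *\<^sub>R ?g + 0 *\<^sub>R ?g) # ?vs)"
    using br_self \<psi> by (simp add: on_sections_Cons)
  also have "\<dots> = (1 / 2) * \<alpha> x (?g # ?vs)"
    using alternating_linear_0[OF smooth_formsD(1)[OF \<alpha>] secs_eval[OF xs] grad_props(1) grad_props(1), where b = 0]
    by simp
  finally show ?thesis
    using rho_tilde_eq_grad[OF smooth_formsD(1)[OF \<alpha>] secs_eval[OF xs]] by simp
qed

text \<open>
  If $q=\langle\psi,\psi\rangle$ does not vanish at \<open>x\<close>, then for any smooth \<open>k\<close> the function
  $k^2q=\langle k\psi,k\psi\rangle$ is again annihilated, and the Leibniz rule gives $2k\,q\,\rho(w)k=0$ at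
  \<open>x\<close>.  Adding a constant to a given \<open>f\<close> makes $k(x)=1$ without changing $\rho(w)f$.  If every such \<open>q\<close> vanishes
  at \<open>x\<close>, the fibre is zero by polarisation and nondegeneracy.
\<close>

lemma anchor_zero_of_squares:
  assumes w: "w \<in> fibre C x"
    and sq: "\<And>\<psi>. \<psi> \<in> smooth_sections C \<Longrightarrow> anchor C x w (\<lambda>y. metric C y (\<psi> y) (\<psi> y)) = 0"
  shows "anchor C x w = (\<lambda>f. 0)"
proof (cases "\<exists>v\<in>fibre C x. metric C x v v \<noteq> 0")
  case False
  have "metric C x u v = 0" if u: "u \<in> fibre C x" and v: "v \<in> fibre C x" for u v
  proof -
    have uv: "1 *\<^sub>R u + 1 *\<^sub>R v \<in> fibre C x" using u v by (rule fibre_comb)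
    have "metric C x (1 *\<^sub>R u + 1 *\<^sub>R v) (1 *\<^sub>R u + 1 *\<^sub>R v) = 0" using uv False by blast
    moreover have "metric C x u u = 0" "metric C x v v = 0" using u v False by blast+
    ultimately show ?thesis
      using metric_linear[OF u v uv, of 1 1] metric_linear[OF u v u, of 1 1] metric_linear[OF u v v, of 1 1]
        metric_sym[OF u v] metric_sym[OF u uv] metric_sym[OF v uv] by simp
  qed
  then have "w = 0" using metric_nondegenerate[OF w] w by simp
  then show ?thesis by (simp add: fun_eq_iff anchor_zero)
next
  case True
  then obtain v where v: "v \<in> fibre C x" "metric C x v v \<noteq> 0" by (elim bexE)
  obtain \<psi> where \<psi>: "\<psi> \<in> smooth_sections C" "\<psi> x = v" using vbundle v(1) by (rule section_through)
  define q where "q = (\<lambda>y. metric C y (\<psi> y) (\<psi> y))"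
  have q: "q \<in> smooth_functions C" unfolding q_def by (rule metric_smooth[OF \<psi>(1) \<psi>(1)])
  have Dq: "anchor C x w q = 0" unfolding q_def by (rule sq[OF \<psi>(1)])
  have "anchor C x w f = 0" if f: "f \<in> smooth_functions C" for f
  proof -
    \<comment> \<open>\<open>k\<close> differs from \<open>f\<close> by a constant and has the value \<open>1\<close> at \<open>x\<close>.\<close>
    define k where "k = (\<lambda>y. 1 * f y + (1 - f x) * 1)"
    have k: "k \<in> smooth_functions C"
      unfolding k_def by (intro smooth_functions_add smooth_functions_mult smooth_functions_const f)
    have Dk: "anchor C x w k = anchor C x w f"
      unfolding k_def using anchor_comb[OF w f smooth_functions_const, of 1 "1 - f x" 1] anchor_const[OF w] by simp
    have kk: "(\<lambda>y. k y * k y) \<in> smooth_functions C" by (rule smooth_functions_mult[OF k k])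
    have "metric C y (k y *\<^sub>R \<psi> y) (k y *\<^sub>R \<psi> y) = (k y * k y) * q y" for y
    proof -
      note m = sec_fibre[OF \<psi>(1), of y]
      have s: "metric C y (k y *\<^sub>R \<psi> y) z = k y * metric C y (\<psi> y) z" if "z \<in> fibre C y" for z
        using metric_linear[OF m m that, of "k y" 0] by simp
      have m': "k y *\<^sub>R \<psi> y \<in> fibre C y" by (rule subspace_scale[OF bundle_fibre[OF vbundle] m])
      show ?thesis using s[OF m'] s[OF m] metric_sym[OF m m'] by (simp add: q_def)
    qed
    then have "anchor C x w (\<lambda>y. (k y * k y) * q y) = 0"
      using sq[OF smooth_sections_scale[OF vbundle k \<psi>(1)]] by simp
    then have "2 * anchor C x w k * q x = 0"
      using anchor_mult[OF w kk q] anchor_mult[OF w k k] Dq by (simp add: k_def)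
    then show ?thesis using Dk v(2) \<psi>(2) by (simp add: q_def)
  qed
  then show ?thesis using anchor_nonsmooth[OF w] by (metis (no_types))
qed

text \<open>
  The kernel of $\tilde\rho$ in terms of the bracket alone.
\<close>

lemma ker_rho_forms_iff:
  assumes \<alpha>: "\<alpha> \<in> smooth_forms C (Suc q)"
  shows "\<alpha> \<in> ker_rho_forms C (Suc q) \<longleftrightarrow>
    (\<forall>\<psi>\<in>smooth_sections C. \<forall>xs\<in>alg.secs q. on_sections \<alpha> (bracket C \<psi> \<psi> # xs) = 0)"
proof
  assume "\<alpha> \<in> ker_rho_forms C (Suc q)"
  then have "rho_tilde C x (\<alpha> x) vs = (\<lambda>f. 0)" if "length vs = q" "set vs \<subseteq> fibre C x" for x vs
    using that by (simp add: ker_rho_forms_def)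
  then show "\<forall>\<psi>\<in>smooth_sections C. \<forall>xs\<in>alg.secs q. on_sections \<alpha> (bracket C \<psi> \<psi> # xs) = 0"
    using secs_eval on_sections_square[OF \<alpha>] by (simp add: fun_eq_iff)
next
  assume sq: "\<forall>\<psi>\<in>smooth_sections C. \<forall>xs\<in>alg.secs q. on_sections \<alpha> (bracket C \<psi> \<psi> # xs) = 0"
  have "rho_tilde C x (\<alpha> x) vs = (\<lambda>f. 0)" if vs: "length vs = q" "set vs \<subseteq> fibre C x" for x vs
  proof -
    obtain xs where xs: "xs \<in> alg.secs q" "map (\<lambda>\<psi>. \<psi> x) xs = vs"
      by (rule sections_through_list[OF vs(2), unfolded vs(1)]) (rule that)
    have "anchor C x (sharp C x (\<lambda>u. \<alpha> x (u # vs))) (\<lambda>y. metric C y (\<psi> y) (\<psi> y)) = 0"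
      if \<psi>: "\<psi> \<in> smooth_sections C" for \<psi>
      using on_sections_square[OF \<alpha> \<psi> xs(1), of x] bspec[OF bspec[OF sq \<psi>] xs(1)]
      by (simp add: rho_tilde_def xs(2))
    from anchor_zero_of_squares[OF sharp_form_props(1)[OF smooth_formsD(1)[OF \<alpha>] vs] this]
    show ?thesis unfolding rho_tilde_def by simp
  qed
  then show "\<alpha> \<in> ker_rho_forms C (Suc q)" using \<alpha> by (simp add: ker_rho_forms_def)
qed

lemma ker_rho_forms_0: "ker_rho_forms C 0 = smooth_forms C 0"
  by (simp add: ker_rho_forms_def)

lemma ker_rho_smooth: "\<alpha> \<in> ker_rho_forms C p \<Longrightarrow> \<alpha> \<in> smooth_forms C p"
  by (simp add: ker_rho_forms_def)

lemma form_on_sections: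
  assumes \<alpha>: "\<alpha> \<in> ker_rho_forms C p"
  shows "alg.alt_form p (on_sections \<alpha>)"
proof (rule alg.form_of_multilinear)
  note s = ker_rho_smooth[OF \<alpha>]
  show "on_sections \<alpha> xs \<in> smooth_functions C" if "xs \<in> alg.secs p" for xs
    by (rule smooth_formsD(2)[OF s that])
  show "on_sections \<alpha> (xs[i := (\<lambda>z. f z *\<^sub>R x z) + (\<lambda>z. g z *\<^sub>R y z)])
      = f * on_sections \<alpha> (xs[i := x]) + g * on_sections \<alpha> (xs[i := y])"
    if "xs \<in> alg.secs p" "i < p" "x \<in> smooth_sections C" "y \<in> smooth_sections C" for xs i x y f g
  proof
    fix z
    show "on_sections \<alpha> (xs[i := (\<lambda>z. f z *\<^sub>R x z) + (\<lambda>z. g z *\<^sub>R y z)]) z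
        = (f * on_sections \<alpha> (xs[i := x]) + g * on_sections \<alpha> (xs[i := y])) z"
      using alternating_linear[OF smooth_formsD(1)[OF s, of z] secs_eval[OF that(1)] that(2)
          sec_fibre[OF that(3)] sec_fibre[OF that(4)], where a = "f z" and b = "g z"]
      by (simp add: on_sections_def map_update)
  qed
  show "on_sections \<alpha> xs = 0" if "xs \<in> alg.secs p" "Suc i < p" "xs ! i = xs ! Suc i" for xs i
  proof
    fix z
    have "length xs = p" using that(1) by (rule alg.length_secs)
    then show "on_sections \<alpha> xs z = 0 z"
      using alternating_repeat[OF smooth_formsD(1)[OF s] secs_eval[OF that(1)] lessI that(2), of z] that(2,3)
      by (simp add: on_sections_def)
  qed
  show "on_sections \<alpha> (bracket C x x # xs) = 0" if "x \<in> smooth_sections C" "bracket C x x # xs \<in> alg.secs p" for x xs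
  proof (cases p)
    case 0
    then show ?thesis using that(2) by simp
  next
    case (Suc q)
    then show ?thesis using ker_rho_forms_iff[of \<alpha> q] s \<alpha> that by simp
  qed
qed

lemma form_local_slot:
  assumes a: "alg.alt_form (Suc p) a" and uv: "u \<in> smooth_sections C" "v \<in> smooth_sections C" "u x = v x"
    and xs: "xs \<in> alg.secs p"
  shows "a (u # xs) x = a (v # xs) x"
proof -
  have "a ((u - v) # xs) x = 0"
  proof (rule tensorial_vanishes[OF vbundle, of "\<lambda>w. a (w # xs) x" x])
    show "a ((\<lambda>y. \<phi> y + \<psi> y) # xs) x = a (\<phi> # xs) x + a (\<psi> # xs) x"
      if "\<phi> \<in> smooth_sections C" "\<psi> \<in> smooth_sections C" for \<phi> \<psi>
      using fun_cong[OF alg.form_plus[OF a that xs], of x] by (simp add: plus_fun_def)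
    show "a ((\<lambda>y. f y *\<^sub>R \<psi> y) # xs) x = f x * a (\<psi> # xs) x"
      if "f \<in> smooth_functions C" "\<psi> \<in> smooth_sections C" for f \<psi>
      using fun_cong[OF alg.form_times[OF a that xs], of x] by simp
  qed (use uv alg.diff_\<Gamma>[OF uv(1,2)] in simp_all)
  then show ?thesis using fun_cong[OF alg.form_minus[OF a uv(1,2) xs], of x] by simp
qed

lemma form_local:
  "\<lbrakk>alg.alt_form p a; xs \<in> alg.secs p; ys \<in> alg.secs p; map (\<lambda>\<psi>. \<psi> x) xs = map (\<lambda>\<psi>. \<psi> x) ys\<rbrakk> \<Longrightarrow> a xs x = a ys x"
proof (induction p arbitrary: a xs ys)
  case (Suc p)
  obtain u us where xs: "xs = u # us" "u \<in> smooth_sections C" "us \<in> alg.secs p"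
    using Suc.prems(2) by (rule alg.secs_Suc_cases)
  obtain v vs where ys: "ys = v # vs" "v \<in> smooth_sections C" "vs \<in> alg.secs p"
    using Suc.prems(3) by (rule alg.secs_Suc_cases)
  have "a (u # us) x = a (v # us) x"
    by (rule form_local_slot[OF Suc.prems(1) xs(2) ys(2) _ xs(3)]) (use Suc.prems(4) xs(1) ys(1) in simp)
  also have "\<dots> = a (v # vs) x"
    by (rule Suc.IH[OF alg.form_contract[OF Suc.prems(1) ys(2)] xs(3) ys(3)]) (use Suc.prems(4) xs(1) ys(1) in simp)
  finally show ?case by (simp add: xs(1) ys(1))
qed simp

definition lift :: "'m \<Rightarrow> 'e \<Rightarrow> 'm \<Rightarrow> 'e" where
  "lift x v = (SOME \<psi>. \<psi> \<in> smooth_sections C \<and> \<psi> x = v)"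

lemma lift: "v \<in> fibre C x \<Longrightarrow> lift x v \<in> smooth_sections C" "v \<in> fibre C x \<Longrightarrow> lift x v x = v"
proof -
  assume "v \<in> fibre C x"
  with vbundle obtain \<psi> where "\<psi> \<in> smooth_sections C" "\<psi> x = v" by (rule section_through)
  then have "lift x v \<in> smooth_sections C \<and> lift x v x = v" 
    unfolding lift_def using someI[of "\<lambda>\<psi>. \<psi> \<in> smooth_sections C \<and> \<psi> x = v" \<psi>] by simp
  then show "lift x v \<in> smooth_sections C" "lift x v x = v" by simp_all
qed

lemma map_lift:
  assumes "set vs \<subseteq> fibre C x"
  shows "map (lift x) vs \<in> alg.secs (length vs)" "map (\<lambda>\<psi>. \<psi> x) (map (lift x) vs) = vs"
  using assms by (induction vs) (simp_all add: lift)

text \<open>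
  A functional on sections read as a form: each vector is replaced by some section through it.  For the
  functionals considered here the result does not depend on the choice (\<open>form_local\<close>).
\<close>

definition pointwise_form :: "nat \<Rightarrow> (('m \<Rightarrow> 'e) list \<Rightarrow> 'm \<Rightarrow> real) \<Rightarrow> ('m, 'e) eform" where
  "pointwise_form p a = (\<lambda>x vs. if length vs = p \<and> set vs \<subseteq> fibre C x then a (map (lift x) vs) x else 0)"

lemma on_sections_pointwise_form:
  assumes a: "alg.alt_form p a" and xs: "xs \<in> alg.secs p"
  shows "on_sections (pointwise_form p a) xs = a xs"
proof
  fix x
  note e = secs_eval[OF xs, of x]
  have "a (map (lift x) (map (\<lambda>\<psi>. \<psi> x) xs)) x = a xs x"
    by (rule form_local[OF a map_lift(1)[OF e(2), unfolded e(1)] xs map_lift(2)[OF e(2)]])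
  then show "on_sections (pointwise_form p a) xs x = a xs x"
    using e unfolding on_sections_def pointwise_form_def by simp
qed

lemma pointwise_form_smooth:
  assumes a: "alg.alt_form p a"
  shows "pointwise_form p a \<in> smooth_forms C p"
proof -
  have "alternating_on (fibre C x) p (pointwise_form p a x)" for x
    unfolding alternating_on_def
  proof (intro conjI allI ballI impI)
    fix vs assume "\<not> (length vs = p \<and> set vs \<subseteq> fibre C x)"
    then show "pointwise_form p a x vs = 0" unfolding pointwise_form_def by (rule if_not_P)
  next
    fix vs i and c d :: real and u w
    assume u: "u \<in> fibre C x" and w: "w \<in> fibre C x" and vs: "length vs = p \<and> set vs \<subseteq> fibre C x \<and> i < p"
    \<comment> \<open>The lift of a linear combination is some section through it, not the combination of the lifts;
      both have the same value at \<open>x\<close>, and only that matters.\<close>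
    have ev: "pointwise_form p a x (vs[i := v]) = a ((map (lift x) vs)[i := \<psi>]) x"
      if "v \<in> fibre C x" "\<psi> \<in> smooth_sections C" "\<psi> x = v" for v \<psi>
    proof -
      have s: "set (vs[i := v]) \<subseteq> fibre C x" using vs that(1) by (intro set_list_update) simp_all
      have "a (map (lift x) (vs[i := v])) x = a ((map (lift x) vs)[i := \<psi>]) x"
      proof (rule form_local[OF a])
        show "map (lift x) (vs[i := v]) \<in> alg.secs p" using map_lift(1)[OF s] vs by simp
        have "map (lift x) vs \<in> alg.secs p" using map_lift(1)[of vs x] vs by simp
        then show "(map (lift x) vs)[i := \<psi>] \<in> alg.secs p"
          using set_list_update[of "map (lift x) vs" "smooth_sections C" \<psi> i] that(2) by (simp add: alg.secs_def)
        show "map (\<lambda>\<psi>. \<psi> x) (map (lift x) (vs[i := v])) = map (\<lambda>\<psi>. \<psi> x) ((map (lift x) vs)[i := \<psi>])"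
          using map_lift(2)[OF s] map_lift(2)[of vs x] vs that(3) unfolding map_update by simp
      qed
      then show ?thesis using s vs unfolding pointwise_form_def by simp
    qed
    let ?L = "map (lift x) vs"
    let ?s = "(\<lambda>y. (\<lambda>_. c) y *\<^sub>R lift x u y) + (\<lambda>y. (\<lambda>_. d) y *\<^sub>R lift x w y)"
    have L: "?L \<in> alg.secs p" using map_lift(1)[of vs x] vs by simp
    have s: "?s \<in> smooth_sections C"
      by (rule alg.add_\<Gamma>[OF alg.scale_\<Gamma>[OF smooth_functions_const lift(1)[OF u]] alg.scale_\<Gamma>[OF smooth_functions_const lift(1)[OF w]]])
    have "pointwise_form p a x (vs[i := c *\<^sub>R u + d *\<^sub>R w]) = a (?L[i := ?s]) x"
      by (rule ev[OF fibre_comb[OF u w] s]) (simp add: lift(2) u w)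
    also have "\<dots> = ((\<lambda>_. c) * a (?L[i := lift x u]) + (\<lambda>_. d) * a (?L[i := lift x w])) x"
      using alg.form_nth_linear[OF a L _ lift(1)[OF u] lift(1)[OF w] smooth_functions_const[of c] smooth_functions_const[of d], of i] vs
      by simp
    also have "\<dots> = c * pointwise_form p a x (vs[i := u]) + d * pointwise_form p a x (vs[i := w])"
      using ev[OF u lift[OF u]] ev[OF w lift[OF w]] by simp
    finally show "pointwise_form p a x (vs[i := c *\<^sub>R u + d *\<^sub>R w])
      = c * pointwise_form p a x (vs[i := u]) + d * pointwise_form p a x (vs[i := w])" .
  next
    fix vs i j assume vs: "length vs = p \<and> set vs \<subseteq> fibre C x \<and> i < j \<and> j < p \<and> vs ! i = vs ! j"
    have "a (map (lift x) vs) = 0"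
      by (rule alg.form_alternating[OF a, of _ i j]) (use map_lift(1)[of vs x] vs in simp_all)
    then show "pointwise_form p a x vs = 0" unfolding pointwise_form_def by simp
  qed
  moreover have "on_sections (pointwise_form p a) xs \<in> smooth_functions C" if "xs \<in> alg.secs p" for xs
    using on_sections_pointwise_form[OF a that] alg.form_A[OF a that] by simp
  ultimately show ?thesis unfolding smooth_forms_def alg.secs_def by simp
qed

lemma pointwise_form_ker_rho:
  assumes a: "alg.alt_form p a"
  shows "pointwise_form p a \<in> ker_rho_forms C p"
proof (cases p)
  case 0
  then show ?thesis using pointwise_form_smooth[OF a] ker_rho_forms_0 by simp
next
  case (Suc q)
  have "on_sections (pointwise_form p a) (bracket C \<psi> \<psi> # xs) = 0"
    if "\<psi> \<in> smooth_sections C" "xs \<in> alg.secs q" for \<psi> xs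
    using on_sections_pointwise_form[OF a, of "bracket C \<psi> \<psi> # xs"] alg.form_square[OF a[unfolded Suc] that] that
    by (simp add: Suc alg.closed)
  then show ?thesis using ker_rho_forms_iff[of "pointwise_form p a" q] pointwise_form_smooth[OF a] Suc by simp
qed

lemma D_on_sections_eq:
  assumes a: "alg.alt_form p (on_sections \<alpha>)" and xs: "xs \<in> alg.secs (Suc p)"
  shows "D_on_sections C \<alpha> xs = alg.ext_d (on_sections \<alpha>) xs"
  unfolding alg.ext_d_eq_sum[OF a xs] D_on_sections_def alg.length_secs[OF xs]
  by (simp only: fun_eq_iff plus_fun_apply fun_sum_apply fun_sign_apply simp_thms)

text \<open>
  Existence of the form $\mathcal{D}\alpha$ is the fact that \<open>ext_d\<close> preserves \<open>alt_form\<close>; uniqueness holds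
  because there is a section through every vector.
\<close>

lemma calD:
  assumes \<alpha>: "\<alpha> \<in> ker_rho_forms C p"
  shows "calD C p \<alpha> \<in> ker_rho_forms C (Suc p)"
    and "xs \<in> alg.secs (Suc p) \<Longrightarrow> on_sections (calD C p \<alpha>) xs = alg.ext_d (on_sections \<alpha>) xs"
proof -
  let ?\<beta> = "pointwise_form (Suc p) (alg.ext_d (on_sections \<alpha>))"
  note f = form_on_sections[OF \<alpha>] and df = alg.form_ext_d[OF form_on_sections[OF \<alpha>]]
  have "calD C p \<alpha> = ?\<beta>"
    unfolding calD_def
  proof (rule the_equality)
    show "?\<beta> \<in> smooth_forms C (Suc p) \<and> (\<forall>\<psi>s. length \<psi>s = Suc p \<and> set \<psi>s \<subseteq> smooth_sections C \<longrightarrow>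
        on_sections ?\<beta> \<psi>s = D_on_sections C \<alpha> \<psi>s)"
      using pointwise_form_smooth[OF df] on_sections_pointwise_form[OF df] D_on_sections_eq[OF f]
      by (simp add: alg.secs_def)
    fix \<beta> assume \<beta>: "\<beta> \<in> smooth_forms C (Suc p) \<and> (\<forall>\<psi>s. length \<psi>s = Suc p \<and> set \<psi>s \<subseteq> smooth_sections C \<longrightarrow>
        on_sections \<beta> \<psi>s = D_on_sections C \<alpha> \<psi>s)"
    show "\<beta> = ?\<beta>"
    proof (rule smooth_forms_eqI[OF conjunct1[OF \<beta>] pointwise_form_smooth[OF df]])
      fix xs assume xs: "xs \<in> alg.secs (Suc p)"
      then have "on_sections \<beta> xs = D_on_sections C \<alpha> xs" using \<beta> by (simp add: alg.secs_def)
      then show "on_sections \<beta> xs = on_sections ?\<beta> xs"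
        using on_sections_pointwise_form[OF df xs] D_on_sections_eq[OF f xs] by simp
    qed
  qed
  then show "calD C p \<alpha> \<in> ker_rho_forms C (Suc p)"
    "xs \<in> alg.secs (Suc p) \<Longrightarrow> on_sections (calD C p \<alpha>) xs = alg.ext_d (on_sections \<alpha>) xs"
    using pointwise_form_ker_rho[OF df] on_sections_pointwise_form[OF df] by simp_all
qed

lemma H_op_on_sections:
  assumes a: "alg.alt_form p (on_sections \<alpha>)" and xs: "xs \<in> alg.secs (Suc (Suc p))"
  shows "on_sections (H_op C p \<alpha>) xs = alg.jac_op (on_sections \<alpha>) xs"
proof
  fix x
  let ?vs = "map (\<lambda>\<psi>. \<psi> x) xs"
  have H: "\<alpha> x (H_tilde C x (?vs ! i) (?vs ! j) (?vs ! k) # omit {i, j, k} ?vs)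
      = on_sections \<alpha> (alg.jacobiator (xs ! i) (xs ! j) (xs ! k) # omit {i, j, k} xs) x"
    if "k < Suc (Suc p)" "j < k" "i < j" for i j k
    using H_jacobi alg.nth_secs[OF xs, of i] alg.nth_secs[OF xs, of j] alg.nth_secs[OF xs, of k] that
      alg.length_secs[OF xs]
    by (simp add: on_sections_Cons alg.jacobiator_def nths_map)
  have "on_sections (H_op C p \<alpha>) xs x = (\<Sum>k<Suc (Suc p). \<Sum>j<k. \<Sum>i<j. (-1) ^ (i + j + k) *
        \<alpha> x (H_tilde C x (?vs ! i) (?vs ! j) (?vs ! k) # omit {i, j, k} ?vs))"
    using secs_eval[OF xs, of x] unfolding on_sections_def H_op_def by (simp del: sum.lessThan_Suc)
  also have "\<dots> = (\<Sum>k<Suc (Suc p). \<Sum>j<k. \<Sum>i<j. (-1) ^ (i + j + k) *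
        on_sections \<alpha> (alg.jacobiator (xs ! i) (xs ! j) (xs ! k) # omit {i, j, k} xs) x)"
    using H by (intro sum.cong refl) simp
  also have "\<dots> = alg.jac_op (on_sections \<alpha>) xs x"
    unfolding alg.jac_op_eq_sum[OF a xs] by (simp only: fun_sum_apply fun_sign_apply)
  finally show "on_sections (H_op C p \<alpha>) xs x = alg.jac_op (on_sections \<alpha>) xs x" .
qed

section \<open>The cochain complex\<close>

text \<open>
  The equality $d^2=\tilde H$ in the form in which it is used.
\<close>

lemma cochains_iff:
  "\<alpha> \<in> cochains C p \<longleftrightarrow> \<alpha> \<in> ker_rho_forms C p \<and>
     (\<forall>xs\<in>alg.secs (Suc (Suc p)). alg.ext_d (alg.ext_d (on_sections \<alpha>)) xs = 0)"
proof (cases "\<alpha> \<in> ker_rho_forms C p")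
  case True
  note f = form_on_sections[OF True]
  have dd: "alg.ext_d (alg.ext_d (on_sections \<alpha>)) xs = on_sections (H_op C p \<alpha>) xs"
    if "xs \<in> alg.secs (Suc (Suc p))" for xs
    using alg.ext_d_ext_d[OF f that] H_op_on_sections[OF f that] by simp
  have "H_op C p \<alpha> = zero_form" if z: "\<And>xs. xs \<in> alg.secs (Suc (Suc p)) \<Longrightarrow> on_sections (H_op C p \<alpha>) xs = 0"
  proof (intro ext)
    fix x vs
    show "H_op C p \<alpha> x vs = zero_form x vs"
    proof (cases "length vs = p + 2 \<and> set vs \<subseteq> fibre C x")
      case True
      then have "set vs \<subseteq> fibre C x" by simp
      then obtain xs where "xs \<in> alg.secs (length vs)" "map (\<lambda>\<psi>. \<psi> x) xs = vs"
        by (elim sections_through_list) (rule that)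
      then show ?thesis using fun_cong[OF z, of xs x] True by (simp add: on_sections_def zero_form_def)
    next
      case False
      then show ?thesis unfolding H_op_def zero_form_def by (rule if_not_P)
    qed
  qed
  moreover have "on_sections (H_op C p \<alpha>) xs = 0" if "H_op C p \<alpha> = zero_form" for xs
    unfolding that by (simp add: on_sections_def zero_form_def zero_fun_def)
  ultimately have "H_op C p \<alpha> = zero_form \<longleftrightarrow> (\<forall>xs\<in>alg.secs (Suc (Suc p)). on_sections (H_op C p \<alpha>) xs = 0)"
    by (intro iffI ballI) simp_all
  then show ?thesis using True dd by (simp add: cochains_def)
qed (simp add: cochains_def)

lemma zero_form_cochain: "zero_form \<in> cochains C p"
proof -
  have os: "on_sections (zero_form :: ('m, 'e) eform) xs = 0" for xs
    by (simp add: on_sections_def zero_form_def zero_fun_def)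
  have s: "zero_form \<in> smooth_forms C p"
    using smooth_functions_const[of 0 C] os
    by (simp add: smooth_forms_def alternating_on_def zero_form_def zero_fun_def on_sections_def)
  have k: "zero_form \<in> ker_rho_forms C p"
    using s ker_rho_forms_0 ker_rho_forms_iff[of zero_form] os by (cases p) simp_all
  have "alg.ext_d (on_sections zero_form) xs = 0" if "xs \<in> alg.secs (Suc p)" for xs
    by (rule alg.ext_d_zero[OF _ that]) (rule os)
  then have "alg.ext_d (alg.ext_d (on_sections zero_form)) xs = 0" if "xs \<in> alg.secs (Suc (Suc p))" for xs
    by (rule alg.ext_d_zero[OF _ that])
  then show ?thesis using k by (simp add: cochains_iff)
qed

lemma act_const: "\<psi> \<in> smooth_sections C \<Longrightarrow> act C \<psi> (\<lambda>_. c) = 0"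
  by (simp add: act_def fun_eq_iff anchor_const sec_fibre)

lemma on_sections_comb: "on_sections (\<lambda>x vs. a * \<alpha> x vs + b * \<beta> x vs) =
    (\<lambda>xs. (\<lambda>_. a) * on_sections \<alpha> xs + (\<lambda>_. b) * on_sections \<beta> xs)"
  by (simp add: on_sections_def fun_eq_iff)

lemma ext_d_comb:
  assumes "alg.alt_form p F" "alg.alt_form p G" "xs \<in> alg.secs (Suc p)"
  shows "alg.ext_d (\<lambda>xs. (\<lambda>_. a) * F xs + (\<lambda>_. b) * G xs) xs = (\<lambda>_. a) * alg.ext_d F xs + (\<lambda>_. b) * alg.ext_d G xs"
  using alg.ext_d_add[OF alg.form_scale[OF assms(1) smooth_functions_const[of a]] alg.form_scale[OF assms(2) smooth_functions_const[of b]] assms(3)]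
    alg.ext_d_const_scale[OF assms(1) smooth_functions_const act_const assms(3), of a]
    alg.ext_d_const_scale[OF assms(2) smooth_functions_const act_const assms(3), of b] by simp

lemma ker_rho_comb:
  assumes \<alpha>: "\<alpha> \<in> ker_rho_forms C p" and \<beta>: "\<beta> \<in> ker_rho_forms C p"
  shows "(\<lambda>x vs. a * \<alpha> x vs + b * \<beta> x vs) \<in> ker_rho_forms C p" (is "?\<gamma> \<in> _")
proof -
  note sa = ker_rho_smooth[OF \<alpha>] and sb = ker_rho_smooth[OF \<beta>]
  let ?f = "\<lambda>xs. (\<lambda>_. a) * on_sections \<alpha> xs + (\<lambda>_. b) * on_sections \<beta> xs"
  have f: "alg.alt_form p ?f"
    by (rule alg.form_add[OF alg.form_scale[OF form_on_sections[OF \<alpha>] smooth_functions_const]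
          alg.form_scale[OF form_on_sections[OF \<beta>] smooth_functions_const]])
  have "?\<gamma> = pointwise_form p ?f"
  proof (intro ext)
    fix x vs
    show "a * \<alpha> x vs + b * \<beta> x vs = pointwise_form p ?f x vs"
    proof (cases "length vs = p \<and> set vs \<subseteq> fibre C x")
      case True
      then show ?thesis
        using map_lift(2)[of vs x] by (simp add: pointwise_form_def on_sections_def)
    next
      case False
      then show ?thesis
        using alternating_default[OF smooth_formsD(1)[OF sa] False] alternating_default[OF smooth_formsD(1)[OF sb] False]
        unfolding pointwise_form_def by (simp only: if_not_P) simp
    qed
  qed
  then show ?thesis using pointwise_form_ker_rho[OF f] by simp
qed

lemma cochain_comb:
  assumes \<alpha>: "\<alpha> \<in> cochains C p" and \<beta>: "\<beta> \<in> cochains C p"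
  shows "(\<lambda>x vs. a * \<alpha> x vs + b * \<beta> x vs) \<in> cochains C p"
proof -
  have k: "\<alpha> \<in> ker_rho_forms C p" "\<beta> \<in> ker_rho_forms C p" using \<alpha> \<beta> by (simp_all add: cochains_iff)
  note f = form_on_sections[OF k(1)] form_on_sections[OF k(2)]
  have "alg.ext_d (alg.ext_d (on_sections (\<lambda>x vs. a * \<alpha> x vs + b * \<beta> x vs))) xs = 0"
    if xs: "xs \<in> alg.secs (Suc (Suc p))" for xs
  proof -
    have "alg.ext_d (alg.ext_d (on_sections (\<lambda>x vs. a * \<alpha> x vs + b * \<beta> x vs))) xs
      = alg.ext_d (\<lambda>xs. (\<lambda>_. a) * alg.ext_d (on_sections \<alpha>) xs + (\<lambda>_. b) * alg.ext_d (on_sections \<beta>) xs) xs"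
      by (rule alg.ext_d_cong[OF xs]) (simp only: on_sections_comb ext_d_comb[OF f])
    also have "\<dots> = 0"
      unfolding ext_d_comb[OF alg.form_ext_d[OF f(1)] alg.form_ext_d[OF f(2)] xs]
      using \<alpha> \<beta> xs by (simp add: cochains_iff)
    finally show ?thesis .
  qed
  then show ?thesis using ker_rho_comb[OF k] by (simp add: cochains_iff)
qed

lemma calD_comb:
  assumes \<alpha>: "\<alpha> \<in> ker_rho_forms C p" and \<beta>: "\<beta> \<in> ker_rho_forms C p"
  shows "calD C p (\<lambda>x vs. a * \<alpha> x vs + b * \<beta> x vs) = (\<lambda>x vs. a * calD C p \<alpha> x vs + b * calD C p \<beta> x vs)"
proof (rule smooth_forms_eqI)
  note k = ker_rho_comb[OF \<alpha> \<beta>, of a b]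
  show "calD C p (\<lambda>x vs. a * \<alpha> x vs + b * \<beta> x vs) \<in> smooth_forms C (Suc p)"
    by (rule ker_rho_smooth[OF calD(1)[OF k]])
  show "(\<lambda>x vs. a * calD C p \<alpha> x vs + b * calD C p \<beta> x vs) \<in> smooth_forms C (Suc p)"
    by (rule ker_rho_smooth[OF ker_rho_comb[OF calD(1)[OF \<alpha>] calD(1)[OF \<beta>]]])
  fix xs assume xs: "xs \<in> alg.secs (Suc p)"
  show "on_sections (calD C p (\<lambda>x vs. a * \<alpha> x vs + b * \<beta> x vs)) xs
      = on_sections (\<lambda>x vs. a * calD C p \<alpha> x vs + b * calD C p \<beta> x vs) xs"
    unfolding calD(2)[OF k xs] on_sections_comb calD(2)[OF \<alpha> xs] calD(2)[OF \<beta> xs]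
    by (rule ext_d_comb[OF form_on_sections[OF \<alpha>] form_on_sections[OF \<beta>] xs])
qed

lemma calD_calD:
  assumes \<alpha>: "\<alpha> \<in> cochains C p"
  shows "calD C (Suc p) (calD C p \<alpha>) = zero_form"
proof (rule smooth_forms_eqI)
  have k: "\<alpha> \<in> ker_rho_forms C p" using \<alpha> by (simp add: cochains_iff)
  note k' = calD(1)[OF k]
  show "calD C (Suc p) (calD C p \<alpha>) \<in> smooth_forms C (Suc (Suc p))"
    by (rule ker_rho_smooth[OF calD(1)[OF k']])
  show "zero_form \<in> smooth_forms C (Suc (Suc p))"
    using zero_form_cochain[of "Suc (Suc p)"] by (simp add: cochains_iff ker_rho_smooth)
  fix xs assume xs: "xs \<in> alg.secs (Suc (Suc p))"
  have "on_sections (calD C (Suc p) (calD C p \<alpha>)) xs = alg.ext_d (alg.ext_d (on_sections \<alpha>)) xs"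
    unfolding calD(2)[OF k' xs] by (rule alg.ext_d_cong[OF xs calD(2)[OF k]])
  also have "\<dots> = 0" using \<alpha> xs by (simp add: cochains_iff)
  finally show "on_sections (calD C (Suc p) (calD C p \<alpha>)) xs = on_sections zero_form xs"
    by (simp add: on_sections_def zero_form_def zero_fun_def)
qed

text \<open>
  $\tilde H(d\alpha)$ is $d(d(d\alpha))$, and $d(d\alpha)$ vanishes already.
\<close>

lemma calD_cochain:
  assumes \<alpha>: "\<alpha> \<in> cochains C p"
  shows "calD C p \<alpha> \<in> cochains C (Suc p)"
  unfolding cochains_iff
proof (intro conjI ballI)
  have k: "\<alpha> \<in> ker_rho_forms C p" using \<alpha> by (simp add: cochains_iff)
  note k' = calD(1)[OF k]
  show "calD C p \<alpha> \<in> ker_rho_forms C (Suc p)" by (rule k')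
  fix xs assume xs: "xs \<in> alg.secs (Suc (Suc (Suc p)))"
  have "on_sections (calD C (Suc p) (calD C p \<alpha>)) ys = 0" for ys
    unfolding calD_calD[OF \<alpha>] by (simp add: on_sections_def zero_form_def zero_fun_def)
  then have "alg.ext_d (on_sections (calD C p \<alpha>)) ys = 0" if "ys \<in> alg.secs (Suc (Suc p))" for ys
    using calD(2)[OF k' that] by simp
  then show "alg.ext_d (alg.ext_d (on_sections (calD C p \<alpha>))) xs = 0"
    by (rule alg.ext_d_zero[OF _ xs])
qed

end

theorem theorem4p2:
  fixes C :: "('m::{t2_space,second_countable_topology}, 'e::real_vector) courant"
  assumes "twisted_courant_algebroid C"
  shows "cochain_complex (cochains C) (calD C)"
proof -
  interpret twisted_courant C by standard (rule assms)
  have k: "\<alpha> \<in> ker_rho_forms C p" if "\<alpha> \<in> cochains C p" for \<alpha> p using that by (simp add: cochains_def)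
  show ?thesis
    unfolding cochain_complex_def
    by (intro conjI allI ballI zero_form_cochain cochain_comb calD_comb calD_cochain calD_calD k)
qed

end
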